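(* Let $s=s(m,n)$ and $t=t(m,n)$ be positive integers satisfying $ms=nt$, and suppose that $m,n\to\infty$. If $st=o\bigl((mn)^{1/5}\bigr)$, then $$\Delta(m,s;n,t)=\frac{5(s+t)}{6st}\bigl(1+o(1)\bigr).$$
   Context: $M(m,s;n,t)$ is the number of $m\times n$ matrices with nonnegative integer entries in which every row sum equals $s$ and every column sum equals $t$ (where $ms=nt$). With $\lambda=s/n=t/m$, the quantity $\Delta(m,s;n,t)$ is defined by the equation $$M(m,s;n,t)=\frac{\displaystyle\binom{n+s-1}{s}^{m}\binom{m+t-1}{t}^{n}}{\displaystyle\binom{mn+\lambda mn-1}{\lambda mn}}\Bigl(\frac{m+1}{m}\Bigr)^{(m-1)/2}\Bigl(\frac{n+1}{n}\Bigr)^{(n-1)/2}\exp\Bigl(-\frac12+\frac{\Delta(m,s;n,t)}{m+n}\Bigr).$$ Here $\lambda mn=ms=nt$. *)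

theory Defs
  imports "HOL-Analysis.Analysis" "HOL-Library.Landau_Symbols" "Jordan_Normal_Form.Matrix"
begin

definition margin_matrices :: "nat \<Rightarrow> nat \<Rightarrow> nat \<Rightarrow> nat \<Rightarrow> nat mat set" where
  "margin_matrices m s n t =
     {A \<in> carrier_mat m n.
        (\<forall>i<m. (\<Sum>j<n. A $$ (i, j)) = s) \<and> (\<forall>j<n. (\<Sum>i<m. A $$ (i, j)) = t)}"

definition M_count :: "nat \<Rightarrow> nat \<Rightarrow> nat \<Rightarrow> nat \<Rightarrow> nat" where
  "M_count m s n t = card (margin_matrices m s n t)"

(* The right-hand side of the equation that determines Delta, as a function of the
   unknown x.  It is meant for m * s = n * t with m, n positive; then
   lambda * m * n = m * s, where lambda = s / n = t / m, and no subtraction on nat truncates. *)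
definition M_formula :: "nat \<Rightarrow> nat \<Rightarrow> nat \<Rightarrow> nat \<Rightarrow> real \<Rightarrow> real" where
  "M_formula m s n t x =
     real ((n + s - 1) choose s) ^ m * real ((m + t - 1) choose t) ^ n
       / real ((m * n + m * s - 1) choose (m * s))
     * ((real m + 1) / real m) powr ((real m - 1) / 2)
     * ((real n + 1) / real n) powr ((real n - 1) / 2)
     * exp (- 1 / 2 + x / (real m + real n))"

(* Well defined whenever m, n > 0 and m * s = n * t: see Delta_eq and Delta_unique. *)
definition Delta :: "nat \<Rightarrow> nat \<Rightarrow> nat \<Rightarrow> nat \<Rightarrow> real" where
  "Delta m s n t = (THE x. real (M_count m s n t) = M_formula m s n t x)"

lemma finite_margin_matrices: "finite (margin_matrices m s n t)"
proof -
  define S where "S = ({..<m} \<times> {..<n}) \<rightarrow>\<^sub>E {..s}"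
  have "finite S" unfolding S_def by (intro finite_PiE) auto
  moreover have "margin_matrices m s n t \<subseteq> (\<lambda>f. mat m n f) ` S"
  proof
    fix A assume A: "A \<in> margin_matrices m s n t"
    define f where "f = restrict (\<lambda>p. A $$ p) ({..<m} \<times> {..<n})"
    have le: "A $$ (i, j) \<le> s" if "i < m" "j < n" for i j
    proof -
      have "A $$ (i, j) \<le> (\<Sum>j<n. A $$ (i, j))"
        using that by (intro member_le_sum) auto
      then show ?thesis using A that by (simp add: margin_matrices_def)
    qed
    have "A = mat m n f"
      using A by (intro eq_matI) (auto simp: f_def margin_matrices_def)
    moreover have "f \<in> S" using le by (auto simp: S_def f_def)
    ultimately show "A \<in> (\<lambda>f. mat m n f) ` S" by blast
  qed
  ultimately show ?thesis using finite_surj by blast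
qed

lemma M_count_pos:
  assumes "m > 0" "n > 0" "m * s = n * t"
  shows "M_count m s n t > 0"
proof -
  define K where "K i j = {k. k < m * s \<and> k div s = i \<and> k mod n = j}" for i j
  define A where "A = mat m n (\<lambda>(i, j). card (K i j))"
  have fin: "finite (K i j)" for i j by (rule finite_subset[of _ "{..<m * s}"]) (auto simp: K_def)
  have row: "(\<Sum>j<n. card (K i j)) = s" if i: "i < m" for i
  proof -
    have "(\<Sum>j<n. card (K i j)) = card (\<Union>j<n. K i j)"
      using fin by (subst card_UN_disjoint) (auto simp: K_def)
    also have "(\<Union>j<n. K i j) = {i * s..<i * s + s}"
    proof (cases "s = 0")
      case True then show ?thesis by (auto simp: K_def)
    next
      case False
      have "(k < m * s \<and> k div s = i) \<longleftrightarrow> k \<in> {i * s..<i * s + s}" for k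
      proof
        assume "k < m * s \<and> k div s = i"
        then show "k \<in> {i * s..<i * s + s}"
          using False div_times_less_eq_dividend[of k s] dividend_less_div_times[of s k] by simp
      next
        assume k: "k \<in> {i * s..<i * s + s}"
        have "(i + 1) * s \<le> m * s" using i by (intro mult_right_mono) auto
        moreover have "k div s = i" using k False
          by (intro div_nat_eqI) (auto simp: mult.commute)
        ultimately show "k < m * s \<and> k div s = i" using k by auto
      qed
      then have "{i * s..<i * s + s} = {k. k < m * s \<and> k div s = i}" by blast
      also have "\<dots> = (\<Union>j<n. K i j)" unfolding K_def using mod_less_divisor[OF assms(2)] by blast
      finally show ?thesis by (rule sym)
    qed
    finally show ?thesis by simp
  qed
  have col: "(\<Sum>i<m. card (K i j)) = t" if j: "j < n" for j
  proof -
    have "(\<Sum>i<m. card (K i j)) = card (\<Union>i<m. K i j)"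
      using fin by (subst card_UN_disjoint) (auto simp: K_def)
    also have "(\<Union>i<m. K i j) = (\<lambda>q. q * n + j) ` {..<t}"
    proof (intro equalityI subsetI)
      fix k assume "k \<in> (\<Union>i<m. K i j)"
      then have k: "k < n * t" "k mod n = j" using assms(3) by (auto simp: K_def)
      then have "k div n < t" by (simp add: less_mult_imp_div_less mult.commute)
      moreover have "k = k div n * n + j" using k div_mult_mod_eq[of k n] by simp
      ultimately show "k \<in> (\<lambda>q. q * n + j) ` {..<t}" by blast
    next
      fix k assume "k \<in> (\<lambda>q. q * n + j) ` {..<t}"
      then obtain q where q: "q < t" "k = q * n + j" by auto
      have "(q + 1) * n \<le> t * n" using q by (intro mult_right_mono) auto
      then have "k < m * s" using q j assms(3) by (simp add: mult.commute)
      moreover have "k div s < m" using calculation by (simp add: less_mult_imp_div_less)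
      moreover have "k mod n = j" using q j by simp
      ultimately show "k \<in> (\<Union>i<m. K i j)" by (auto simp: K_def)
    qed
    also have "card \<dots> = t" using assms(2) by (subst card_image) (auto simp: inj_on_def)
    finally show ?thesis .
  qed
  have "A \<in> margin_matrices m s n t"
    using row col by (auto simp: margin_matrices_def A_def)
  then show ?thesis using finite_margin_matrices card_gt_0_iff unfolding M_count_def by blast
qed

lemma M_formula_exp:
  assumes "m > 0" "n > 0"
  obtains C where "C > 0" "\<And>x. M_formula m s n t x = C * exp (x / (real m + real n))"
proof -
  have "(n + s - 1 choose s) > 0" "(m + t - 1 choose t) > 0"
    using assms by auto
  moreover have "(m * n + m * s - 1 choose (m * s)) > 0"
  proof -
    have "m * n > 0" using assms by simp
    then have "m * s \<le> m * n + m * s - 1" by linarith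
    then show ?thesis by simp
  qed
  ultimately have "M_formula m s n t 0 > 0"
    using assms by (simp add: M_formula_def)
  moreover have "M_formula m s n t x = M_formula m s n t 0 * exp (x / (real m + real n))" for x
  proof -
    have "exp (- 1 / 2 + x / (real m + real n))
        = exp (- 1 / 2 + 0 / (real m + real n)) * exp (x / (real m + real n))"
      by (simp flip: exp_add)
    then show ?thesis unfolding M_formula_def mult.assoc by (rule arg_cong)
  qed
  ultimately show ?thesis using that by blast
qed

lemma Delta_unique:
  assumes "m > 0" "n > 0" "m * s = n * t"
  shows "\<exists>!x. real (M_count m s n t) = M_formula m s n t x"
proof -
  obtain C where C: "C > 0" "\<And>x. M_formula m s n t x = C * exp (x / (real m + real n))"
    using M_formula_exp assms(1,2) by blast
  have mn: "real m + real n > 0" using assms by simp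
  have M: "real (M_count m s n t) > 0" using M_count_pos[OF assms] by simp
  show ?thesis
  proof
    show "real (M_count m s n t)
        = M_formula m s n t ((real m + real n) * ln (real (M_count m s n t) / C))"
      using C M mn by simp
  next
    fix x assume "real (M_count m s n t) = M_formula m s n t x"
    then have "real (M_count m s n t) / C = exp (x / (real m + real n))" using C by simp
    then show "x = (real m + real n) * ln (real (M_count m s n t) / C)" using mn by simp
  qed
qed

lemma Delta_eq:
  assumes "m > 0" "n > 0" "m * s = n * t"
  shows "real (M_count m s n t) = M_formula m s n t (Delta m s n t)"
  unfolding Delta_def by (rule theI'[OF Delta_unique[OF assms]])

(* The mode of convergence "m, n tend to infinity", where (m, n) ranges over D.  The set D
   is needed because m * s = n * t forces s \<ge> n / gcd m n and t \<ge> m / gcd m n, so s * t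
   cannot be small for all pairs (m, n). *)
definition pairs_at_top :: "(nat \<times> nat) set \<Rightarrow> (nat \<times> nat) filter" where
  "pairs_at_top D = inf (at_top \<times>\<^sub>F at_top) (principal D)"

end

theory Submission
  imports Defs
begin

text \<open>
  Write \<open>N = m s = n t\<close>.  The proof rests on an exact formula for the number of matrices.  Let
  \<open>d\<^sub>k\<close> be the proportion of derangements among the permutations of \<open>k\<close> points, so that
  \<open>d\<^sub>0 = 1\<close>, \<open>d\<^sub>1 = 0\<close>, \<open>d\<^sub>2 = 1/2\<close>, \<open>d\<^sub>3 = 1/3\<close>.  Sorting permutations by their set of
  moved points gives \<open>1 = (\<Sum>k\<le>a. d\<^sub>k / (a - k)!)\<close>.  Multiply these identities over all entries
  \<open>a\<close> of a matrix, and sum over all matrices; the sum of \<open>\<Prod> 1 / b!\<close> over the tables with given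
  margins has a closed form (\<open>sum_tables_inverse_fact\<close>), and
  \<open>M = (\<Sum>K. (\<Prod>d\<^bsub>K i j\<^esub>) (N - |K|)! / ((\<Prod>i. (s - row i K)!) (\<Prod>j. (t - col j K)!)))\<close>
  follows (\<open>M_count_eq_sum_weight\<close>).  All terms are nonnegative and \<open>K = 0\<close> contributes the
  main factor \<open>N! / (s!\<^sup>m t!\<^sup>n)\<close>.  The logarithm of the ratio of the sum to this main factor
  can have order \<open>s t\<close>, possibly a power of \<open>N\<close>, but is needed with an error of smaller order than \<open>1 / N\<close>.

  The sum is treated as the partition function of a dilute gas whose particles are the nonzero
  cells of \<open>K\<close>.  Give every particle the activity \<open>u\<close>.  Removing a particle from a cell
  changes the weight by an explicit factor, the rate of that cell, and so the derivative of the
  logarithm of the partition function at \<open>u\<close> is the average of the total rate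
  (\<open>removal_identity\<close>, the analogue of the Mecke equation for a Poisson process).  A cell takes
  the value \<open>a\<close> at rate at most \<open>y\<^sup>a\<close> with \<open>y = 2 s t / N\<close>, and there are \<open>N\<^sup>2 / (s t)\<close> cells.
  Hence \<open>|K|\<close> has mean of order \<open>s t\<close>, values \<open>a \<ge> 4\<close> contribute order \<open>(s t)\<^sup>3 / N\<^sup>2\<close>, and the
  total rate is affine in \<open>|K|\<close> up to an error whose average is of that order
  (\<open>total_rate_expansion\<close>, \<open>avg_expansion_error_le\<close>).  The same identity gives the mean of
  \<open>|K|\<close> to leading order, and integration over \<open>0 \<le> u \<le> 1\<close> yields \<open>ln M\<close> up to
  \<open>O((s t)\<^sup>3 / N\<^sup>2)\<close>.  The rates are under control only while \<open>|K| \<le> N / 2\<close>; the states beyond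
  that bound are cut off first, and \<open>tail_le\<close> shows directly that their weight is
  exponentially small.

  In the equation that defines \<open>\<Delta>\<close> the factorials cancel exactly against \<open>N! / (s!\<^sup>m t!\<^sup>n)\<close>.
  What remains are sums of \<open>ln (1 + i c)\<close>, expanded to second order.  All terms of order one
  cancel, and the coefficient of \<open>1 / N\<close>, a polynomial in \<open>s\<close> and \<open>t\<close>, collapses to the constant
  \<open>5/6\<close> (\<open>leading_coefficient_identity\<close>), so that \<open>\<Delta> / (m + n) = 5 / (6 N) + O((s t)\<^sup>3 / N\<^sup>2)\<close>.
  Since \<open>m + n = N (s + t) / (s t)\<close>, the main term is \<open>5 (s + t) / (6 s t)\<close>.  Since \<open>m n s t = N\<^sup>2\<close>, the
  hypothesis \<open>s t = o((m n)\<^bsup>1/5\<^esup>)\<close> says exactly that \<open>(s t)\<^sup>3 = o(N)\<close>, which makes the relative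
  error vanish.
\<close>

section \<open>Tables with prescribed margins\<close>

abbreviation cells :: "nat \<Rightarrow> nat \<Rightarrow> (nat \<times> nat) set" where
  "cells m n \<equiv> {..<m} \<times> {..<n}"

definition row_sum :: "nat \<Rightarrow> (nat \<times> nat \<Rightarrow> nat) \<Rightarrow> nat \<Rightarrow> nat" where
  "row_sum n K i = (\<Sum>j<n. K (i, j))"

definition col_sum :: "nat \<Rightarrow> (nat \<times> nat \<Rightarrow> nat) \<Rightarrow> nat \<Rightarrow> nat" where
  "col_sum m K j = (\<Sum>i<m. K (i, j))"

definition total :: "nat \<Rightarrow> nat \<Rightarrow> (nat \<times> nat \<Rightarrow> nat) \<Rightarrow> nat" where
  "total m n K = (\<Sum>p\<in>cells m n. K p)"

lemma sum_fun_upd_add: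
  fixes K :: "'a \<Rightarrow> nat"
  assumes "finite A" "p \<in> A"
  shows "(\<Sum>q\<in>A. (K(p := a)) q) + K p = (\<Sum>q\<in>A. K q) + a"
proof -
  have "(\<Sum>q\<in>A - {p}. (K(p := a)) q) = (\<Sum>q\<in>A - {p}. K q)"
    by (intro sum.cong) auto
  then show ?thesis
    using assms by (simp add: sum.remove[of A p])
qed

lemma row_sum_upd:
  assumes "j < n"
  shows "row_sum n (K((i, j) := a)) i + K (i, j) = row_sum n K i + a"
proof -
  have "(\<Sum>q<n. (K((i, j) := a)) (i, q)) = (\<Sum>q<n. ((\<lambda>q. K (i, q))(j := a)) q)"
    by (intro sum.cong) auto
  then show ?thesis
    using sum_fun_upd_add[of "{..<n}" j "\<lambda>q. K (i, q)" a] assms by (simp add: row_sum_def)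
qed

lemma row_sum_upd_other [simp]: "i' \<noteq> i \<Longrightarrow> row_sum n (K((i, j) := a)) i' = row_sum n K i'"
  by (simp add: row_sum_def)

lemma col_sum_upd:
  assumes "i < m"
  shows "col_sum m (K((i, j) := a)) j + K (i, j) = col_sum m K j + a"
proof -
  have "(\<Sum>q<m. (K((i, j) := a)) (q, j)) = (\<Sum>q<m. ((\<lambda>q. K (q, j))(i := a)) q)"
    by (intro sum.cong) auto
  then show ?thesis
    using sum_fun_upd_add[of "{..<m}" i "\<lambda>q. K (q, j)" a] assms by (simp add: col_sum_def)
qed

lemma col_sum_upd_other [simp]: "j' \<noteq> j \<Longrightarrow> col_sum m (K((i, j) := a)) j' = col_sum m K j'"
  by (simp add: col_sum_def)

lemma total_upd: "p \<in> cells m n \<Longrightarrow> total m n (K(p := a)) + K p = total m n K + a"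
  unfolding total_def by (rule sum_fun_upd_add) auto

lemma total_eq_rows: "total m n K = (\<Sum>i<m. row_sum n K i)"
  unfolding total_def row_sum_def by (subst sum.cartesian_product) simp

lemma total_eq_cols: "total m n K = (\<Sum>j<n. col_sum m K j)"
  unfolding total_eq_rows row_sum_def col_sum_def by (rule sum.swap)

lemma cell_le_row: "j < n \<Longrightarrow> K (i, j) \<le> row_sum n K i"
  unfolding row_sum_def by (rule member_le_sum) auto

lemma cell_le_col: "i < m \<Longrightarrow> K (i, j) \<le> col_sum m K j"
  unfolding col_sum_def using member_le_sum[of i "{..<m}" "\<lambda>i. K (i, j)"] by auto

lemma prod_fun_upd:
  fixes f :: "'b \<Rightarrow> 'c::comm_monoid_mult"
  assumes "finite A" "p \<in> A"
  shows "(\<Prod>q\<in>A. f ((K(p := a)) q)) = f a * (\<Prod>q\<in>A - {p}. f (K q))"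
proof -
  have "(\<Prod>q\<in>A - {p}. f ((K(p := a)) q)) = (\<Prod>q\<in>A - {p}. f (K q))"
    by (intro prod.cong) auto
  then show ?thesis using assms by (simp add: prod.remove[of A p])
qed

definition tables :: "nat \<Rightarrow> nat \<Rightarrow> (nat \<Rightarrow> nat) \<Rightarrow> (nat \<Rightarrow> nat) \<Rightarrow> (nat \<times> nat \<Rightarrow> nat) set" where
  "tables m n r c = {B \<in> cells m n \<rightarrow>\<^sub>E UNIV.
     (\<forall>i<m. row_sum n B i = r i) \<and> (\<forall>j<n. col_sum m B j = c j)}"

lemma finite_tables: "finite (tables m n r c)"
proof (rule finite_subset)
  show "tables m n r c \<subseteq> (\<Pi>\<^sub>E p\<in>cells m n. {..r (fst p)})"
  proof
    fix B assume B: "B \<in> tables m n r c"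
    then have "B p \<le> r (fst p)" if "p \<in> cells m n" for p
      using cell_le_row[of "snd p" n B "fst p"] that by (auto simp: tables_def)
    then show "B \<in> (\<Pi>\<^sub>E p\<in>cells m n. {..r (fst p)})"
      using B by (auto simp: tables_def PiE_def)
  qed
  show "finite (\<Pi>\<^sub>E p\<in>cells m n. {..r (fst p)})"
    by (intro finite_PiE) auto
qed

lemma PiE_upd: "K \<in> A \<rightarrow>\<^sub>E UNIV \<Longrightarrow> p \<in> A \<Longrightarrow> K(p := a) \<in> A \<rightarrow>\<^sub>E UNIV"
  by (auto simp: PiE_def extensional_def)

text \<open>The factor \<open>B (i, j)\<close> both kills the tables from which no unit can be removed and turns
\<open>1 / B!\<close> into \<open>1 / (B - 1)!\<close>, so the sum becomes one over the tables with one unit less.\<close>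

lemma tables_remove_unit:
  fixes m n :: nat
  assumes "i < m" "j < n" "r i > 0" "c j > 0"
  shows "(\<Sum>B\<in>tables m n r c. real (B (i, j)) * (\<Prod>p\<in>cells m n. 1 / fact (B p)))
       = (\<Sum>B\<in>tables m n (r(i := r i - 1)) (c(j := c j - 1)). \<Prod>p\<in>cells m n. 1 / fact (B p))"
    (is "?L = ?R")
proof -
  let ?p = "(i, j)"
  have p: "?p \<in> cells m n" using assms by auto
  have "?L = (\<Sum>B\<in>{B \<in> tables m n r c. B ?p > 0}. real (B ?p) * (\<Prod>p\<in>cells m n. 1 / fact (B p)))"
    by (rule sum.mono_neutral_right) (auto simp: finite_tables)
  also have "\<dots> = ?R"
  proof (rule sum.reindex_bij_witness[of _ "\<lambda>B. B(?p := B ?p + 1)" "\<lambda>B. B(?p := B ?p - 1)"])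
    fix B assume B: "B \<in> {B \<in> tables m n r c. B ?p > 0}"
    show "(B(?p := B ?p - 1))(?p := (B(?p := B ?p - 1)) ?p + 1) = B" using B by auto
    show "B(?p := B ?p - 1) \<in> tables m n (r(i := r i - 1)) (c(j := c j - 1))"
    proof -
      have "B(?p := B ?p - 1) \<in> cells m n \<rightarrow>\<^sub>E UNIV"
        using B p by (intro PiE_upd) (auto simp: tables_def)
      moreover have "row_sum n (B(?p := B ?p - 1)) i' = (r(i := r i - 1)) i'" if "i' < m" for i'
        using row_sum_upd[OF assms(2), of B i "B ?p - 1"] B that
        by (cases "i' = i") (auto simp: tables_def)
      moreover have "col_sum m (B(?p := B ?p - 1)) j' = (c(j := c j - 1)) j'" if "j' < n" for j'
        using col_sum_upd[OF assms(1), of B j "B ?p - 1"] B that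
        by (cases "j' = j") (auto simp: tables_def)
      ultimately show ?thesis by (simp add: tables_def del: fun_upd_apply)
    qed
    obtain b where b: "B ?p = Suc b" using B by (cases "B ?p") auto
    have "(\<Prod>p\<in>cells m n. 1 / fact ((B(?p := B ?p - 1)) p))
        = 1 / fact b * (\<Prod>q\<in>cells m n - {?p}. 1 / fact (B q) :: real)"
      using p b by (subst prod_fun_upd[where f = "\<lambda>k. 1 / fact k"]) auto
    moreover have "(\<Prod>p\<in>cells m n. 1 / fact (B p))
        = 1 / fact (Suc b) * (\<Prod>q\<in>cells m n - {?p}. 1 / fact (B q) :: real)"
      using p b by (subst prod.remove[of _ ?p]) auto
    ultimately show "(\<Prod>p\<in>cells m n. 1 / fact ((B(?p := B ?p - 1)) p))
        = real (B ?p) * (\<Prod>p\<in>cells m n. 1 / fact (B p))"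
      unfolding b by (simp only: fact_Suc) (simp del: of_nat_Suc fun_upd_apply)
  next
    fix B assume B: "B \<in> tables m n (r(i := r i - 1)) (c(j := c j - 1))"
    show "(B(?p := B ?p + 1))(?p := (B(?p := B ?p + 1)) ?p - 1) = B" by auto
    have "B(?p := B ?p + 1) \<in> cells m n \<rightarrow>\<^sub>E UNIV"
      using B p by (intro PiE_upd) (auto simp: tables_def)
    moreover have "row_sum n (B(?p := B ?p + 1)) i' = r i'" if "i' < m" for i'
    proof (cases "i' = i")
      case True
      have "row_sum n B i = r i - 1" using B assms(1) by (simp add: tables_def)
      then show ?thesis using row_sum_upd[OF assms(2), of B i "B ?p + 1"] assms(3) True by simp
    qed (use B that in \<open>auto simp: tables_def\<close>)
    moreover have "col_sum m (B(?p := B ?p + 1)) j' = c j'" if "j' < n" for j'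
    proof (cases "j' = j")
      case True
      have "col_sum m B j = c j - 1" using B assms(2) by (simp add: tables_def)
      then show ?thesis using col_sum_upd[OF assms(1), of B j "B ?p + 1"] assms(4) True by simp
    qed (use B that in \<open>auto simp: tables_def\<close>)
    ultimately show "B(?p := B ?p + 1) \<in> {B \<in> tables m n r c. B ?p > 0}"
      by (simp add: tables_def)
  qed
  finally show ?thesis .
qed

lemma prod_fact_decrement:
  fixes r :: "'a \<Rightarrow> nat"
  assumes "finite A" "i \<in> A" "r i > 0"
  shows "(\<Prod>q\<in>A. fact (r q) :: real) = real (r i) * (\<Prod>q\<in>A. fact ((r(i := r i - 1)) q))"
  using assms by (subst prod_fun_upd) (auto simp: prod.remove[of A i] fact_reduce[of "r i"])

text \<open>Induction on the sum \<open>R\<close> of the entries.  Multiplying by \<open>R\<close>, written as the sum of the entries of the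
table, amounts to choosing a cell and one of its units; removing that unit gives a table with
smaller margins, and \<open>tables_remove_unit\<close> turns the choice into an exact recursion.\<close>

theorem sum_tables_inverse_fact:
  assumes "(\<Sum>i<m. r i) = R" "(\<Sum>j<n. c j) = R"
  shows "(\<Sum>B\<in>tables m n r c. \<Prod>p\<in>cells m n. 1 / fact (B p) :: real)
       = fact R / ((\<Prod>i<m. fact (r i)) * (\<Prod>j<n. fact (c j)))"
  using assms
proof (induction R arbitrary: r c)
  case 0
  have r0: "r i = 0" if "i < m" for i using 0(1) that by simp
  have c0: "c j = 0" if "j < n" for j using 0(2) that by simp
  have "tables m n r c = {\<lambda>p\<in>cells m n. 0}"
  proof (intro equalityI subsetI)
    fix B assume B: "B \<in> tables m n r c"
    have "B p = 0" if "p \<in> cells m n" for p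
      using cell_le_row[of "snd p" n B "fst p"] B r0 that by (auto simp: tables_def)
    then show "B \<in> {\<lambda>p\<in>cells m n. 0}"
      using B by (auto simp: tables_def PiE_def extensional_def fun_eq_iff restrict_def)
  next
    fix B assume "B \<in> {\<lambda>p\<in>cells m n. 0::nat}"
    then show "B \<in> tables m n r c"
      using r0 c0 by (auto simp: tables_def row_sum_def col_sum_def)
  qed
  then show ?case using r0 c0 by simp
next
  case (Suc R)
  define P :: "(nat \<times> nat \<Rightarrow> nat) \<Rightarrow> real" where "P B = (\<Prod>p\<in>cells m n. 1 / fact (B p))" for B
  define Q :: real where "Q = (\<Prod>i<m. fact (r i)) * (\<Prod>j<n. fact (c j))"
  have Qpos: "Q > 0" unfolding Q_def by (intro mult_pos_pos prod_pos) auto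
  have cell: "(\<Sum>B\<in>tables m n r c. real (B (i, j)) * P B) = fact R * real (r i) * real (c j) / Q"
    if ij: "i < m" "j < n" for i j
  proof (cases "r i > 0 \<and> c j > 0")
    case True
    then have "(\<Sum>B\<in>tables m n r c. real (B (i, j)) * P B)
       = (\<Sum>B\<in>tables m n (r(i := r i - 1)) (c(j := c j - 1)). P B)"
      using tables_remove_unit[OF ij] by (simp add: P_def)
    also have "\<dots> = fact R / ((\<Prod>q<m. fact ((r(i := r i - 1)) q)) * (\<Prod>q<n. fact ((c(j := c j - 1)) q)))"
      unfolding P_def
      using sum_fun_upd_add[of "{..<m}" i r "r i - 1"] sum_fun_upd_add[of "{..<n}" j c "c j - 1"]
        True Suc.prems ij by (intro Suc.IH) auto
    also have "\<dots> = fact R * real (r i) * real (c j) / Q"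
      unfolding Q_def
      using True ij prod_fact_decrement[of "{..<m}" i r] prod_fact_decrement[of "{..<n}" j c]
      by (simp add: field_simps del: fun_upd_apply)
    finally show ?thesis .
  next
    case False
    have "B (i, j) = 0" if "B \<in> tables m n r c" for B
      using cell_le_row[of j n B i] cell_le_col[of i m B j] that ij False by (auto simp: tables_def)
    then have "(\<Sum>B\<in>tables m n r c. real (B (i, j)) * P B) = 0"
      by (intro sum.neutral) simp
    then show ?thesis using False by auto
  qed
  have "real (Suc R) * (\<Sum>B\<in>tables m n r c. P B) = (\<Sum>B\<in>tables m n r c. real (total m n B) * P B)"
    unfolding sum_distrib_left
    by (intro sum.cong refl, subst total_eq_rows) (auto simp: tables_def Suc.prems(1)[symmetric])
  also have "\<dots> = (\<Sum>p\<in>cells m n. \<Sum>B\<in>tables m n r c. real (B p) * P B)"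
    unfolding total_def of_nat_sum sum_distrib_right by (rule sum.swap)
  also have "\<dots> = (\<Sum>p\<in>cells m n. fact R * real (r (fst p)) * real (c (snd p)) / Q)"
    using cell by (intro sum.cong) auto
  also have "\<dots> = fact R / Q * ((\<Sum>i<m. real (r i)) * (\<Sum>j<n. real (c j)))"
    by (simp add: sum_product sum.cartesian_product sum_distrib_left case_prod_unfold algebra_simps)
  also have "\<dots> = real (Suc R) * (fact (Suc R) / Q)"
    using Suc.prems by (simp flip: of_nat_sum add: algebra_simps add_divide_distrib)
  finally have "(\<Sum>B\<in>tables m n r c. P B) = fact (Suc R) / Q"
    by (subst (asm) mult_cancel_left) (simp del: of_nat_Suc fact_Suc)
  then show ?case unfolding P_def Q_def .
qed

section \<open>Derangement proportions\<close>

text \<open>The number of derangements of \<open>k\<close> points divided by \<open>k!\<close>.\<close>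

definition derange :: "nat \<Rightarrow> real" where
  "derange k = (\<Sum>i\<le>k. (- 1) ^ i / fact i)"

lemma derange_simps [simp]: "derange 0 = 1" "derange (Suc 0) = 0"
  by (simp_all add: derange_def)

lemma derange_2: "derange 2 = 1 / 2"
  by (simp add: derange_def numeral_2_eq_2)

lemma derange_3: "derange 3 = 1 / 3"
  by (simp add: derange_def numeral_3_eq_3 fact_numeral)

text \<open>The classical recursion for derangement numbers.  In this normalization it is a convex combination,
which confines all values to the interval from 0 to 1.\<close>

lemma derange_rec:
  "derange (Suc (Suc k)) = (real (Suc k) * derange (Suc k) + derange k) / real (Suc (Suc k))"
proof -
  have D: "derange (Suc k) = derange k + (- 1) ^ (Suc k) / fact (Suc k)" for k
    by (simp add: derange_def)
  have *: "x - e / (c * f) + e / ((c + 1) * (c * f)) = (c * (x - e / (c * f)) + x) / (c + 1)"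
    if "c > 0" "f > 0" for x e f c :: real
    using that by (simp add: divide_simps) (simp add: algebra_simps)
  show ?thesis
    using *[of "real (Suc k)" "fact k" "derange k" "(- 1) ^ k"] unfolding D[of "Suc k"] D[of k]
    by (simp add: algebra_simps)
qed

lemma derange_bounds: "0 \<le> derange k \<and> derange k \<le> 1 \<and> 0 \<le> derange (Suc k) \<and> derange (Suc k) \<le> 1"
proof (induction k)
  case (Suc k)
  have "real (Suc k) * derange (Suc k) + derange k \<le> real (Suc k) * 1 + 1"
    using Suc by (intro add_mono mult_left_mono) auto
  then show ?case
    using Suc unfolding derange_rec by (auto simp: divide_le_eq_1)
qed simp

lemma derange_nonneg: "0 \<le> derange k" and derange_le_1: "derange k \<le> 1"
  using derange_bounds by auto

text \<open>After multiplication by \<open>a!\<close> this sorts the permutations of \<open>a\<close> points by the set of points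
that they move.\<close>

lemma sum_derange: "(\<Sum>k\<le>a. derange k / fact (a - k)) = 1"
proof (induction a)
  case (Suc a)
  have D: "derange (Suc k) = derange k + (- 1) ^ (Suc k) / fact (Suc k)" for k
    by (simp add: derange_def)
  have "(\<Sum>k\<le>Suc a. derange k / fact (Suc a - k))
      = 1 / fact (Suc a) + (\<Sum>k\<le>a. derange (Suc k) / fact (a - k))"
    by (subst sum.atMost_Suc_shift) simp
  also have "\<dots> = 1 / fact (Suc a) + (\<Sum>k\<le>a. derange k / fact (a - k))
      + (\<Sum>k\<le>a. (- 1) ^ Suc k / (fact (Suc k) * fact (a - k)))"
    unfolding D by (simp only: add_divide_distrib sum.distrib divide_divide_eq_left add.assoc)
  finally have step: "(\<Sum>k\<le>Suc a. derange k / fact (Suc a - k))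
      = 1 / fact (Suc a) + (\<Sum>k\<le>a. derange k / fact (a - k))
      + (\<Sum>k\<le>a. (- 1) ^ Suc k / (fact (Suc k) * fact (a - k)))" .
  have "1 / fact (Suc a) + (\<Sum>k\<le>a. (- 1) ^ Suc k / (fact (Suc k) * fact (a - k)))
      = (\<Sum>k\<le>Suc a. (- 1) ^ k / (fact k * fact (Suc a - k)) :: real)"
    by (subst sum.atMost_Suc_shift) simp
  also have "\<dots> = (\<Sum>k\<le>Suc a. (- 1) ^ k * real (Suc a choose k)) / fact (Suc a)"
    unfolding sum_divide_distrib
    by (intro sum.cong refl) (simp add: binomial_fact del: fact_Suc)
  also have "\<dots> = 0"
    using choose_alternating_sum[of "Suc a"] by (simp add: atMost_atLeast0)
  finally show ?case using Suc step by linarith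
qed simp

section \<open>The number of matrices as a sum of positive weights\<close>

text \<open>The index set of the expansion.  Cells with entry 1 are excluded because they carry weight 0, and
this makes every nonempty line sum at least 2.  The bound \<open>L\<close> on the total allows truncation.\<close>

definition states :: "nat \<Rightarrow> nat \<Rightarrow> nat \<Rightarrow> nat \<Rightarrow> nat \<Rightarrow> (nat \<times> nat \<Rightarrow> nat) set" where
  "states m s n t L = {K \<in> cells m n \<rightarrow>\<^sub>E UNIV. (\<forall>p\<in>cells m n. K p \<noteq> 1) \<and>
     (\<forall>i<m. row_sum n K i \<le> s) \<and> (\<forall>j<n. col_sum m K j \<le> t) \<and> total m n K \<le> L}"

definition weight :: "nat \<Rightarrow> nat \<Rightarrow> nat \<Rightarrow> nat \<Rightarrow> (nat \<times> nat \<Rightarrow> nat) \<Rightarrow> real" where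
  "weight m s n t K = (\<Prod>p\<in>cells m n. derange (K p)) * (fact (m * s - total m n K) /
     ((\<Prod>i<m. fact (s - row_sum n K i)) * (\<Prod>j<n. fact (t - col_sum m K j))))"

lemma card_tables_eq_M_count: "card (tables m n (\<lambda>_. s) (\<lambda>_. t)) = M_count m s n t"
  unfolding M_count_def
proof (rule bij_betw_same_card)
  show "bij_betw (mat m n) (tables m n (\<lambda>_. s) (\<lambda>_. t)) (margin_matrices m s n t)"
  proof (rule bij_betw_byWitness[where f' = "\<lambda>A. \<lambda>p\<in>cells m n. A $$ p"])
    show "\<forall>B\<in>tables m n (\<lambda>_. s) (\<lambda>_. t). (\<lambda>p\<in>cells m n. mat m n B $$ p) = B"
    proof
      fix B assume "B \<in> tables m n (\<lambda>_. s) (\<lambda>_. t)"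
      then have "B \<in> extensional (cells m n)" by (simp add: tables_def PiE_def)
      then show "(\<lambda>p\<in>cells m n. mat m n B $$ p) = B"
        by (intro extensionalityI[of _ "cells m n"]) auto
    qed
    show "\<forall>A\<in>margin_matrices m s n t. mat m n (\<lambda>p\<in>cells m n. A $$ p) = A"
      by (auto simp: margin_matrices_def intro!: eq_matI)
    show "mat m n ` tables m n (\<lambda>_. s) (\<lambda>_. t) \<subseteq> margin_matrices m s n t"
    proof (rule image_subsetI)
      fix B assume "B \<in> tables m n (\<lambda>_. s) (\<lambda>_. t)"
      then show "mat m n B \<in> margin_matrices m s n t"
        by (simp add: margin_matrices_def tables_def row_sum_def col_sum_def)
    qed
    show "(\<lambda>A. \<lambda>p\<in>cells m n. A $$ p) ` margin_matrices m s n t \<subseteq> tables m n (\<lambda>_. s) (\<lambda>_. t)"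
    proof (rule image_subsetI)
      fix A :: "nat mat" assume "A \<in> margin_matrices m s n t"
      then show "(\<lambda>p\<in>cells m n. A $$ p) \<in> tables m n (\<lambda>_. s) (\<lambda>_. t)"
        by (simp add: margin_matrices_def tables_def row_sum_def col_sum_def)
    qed
  qed
qed

text \<open>Each entry \<open>a\<close> of a matrix is split as \<open>K + B\<close> by means of \<open>sum_derange\<close>.  For fixed \<open>K\<close> the
matrices \<open>B\<close> range over all tables with the margins left over by \<open>K\<close>, and their weights sum to a
closed form.\<close>

theorem M_count_eq_sum_weight:
  assumes "m * s = n * t"
  shows "real (M_count m s n t) = (\<Sum>K\<in>states m s n t (m * s). weight m s n t K)"
proof -
  define T where "T = tables m n (\<lambda>_. s) (\<lambda>_. t)"
  define S where "S = {K \<in> cells m n \<rightarrow>\<^sub>E UNIV.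
     (\<forall>i<m. row_sum n K i \<le> s) \<and> (\<forall>j<n. col_sum m K j \<le> t)}"
  define C where "C K = tables m n (\<lambda>i. s - row_sum n K i) (\<lambda>j. t - col_sum m K j)" for K
  have rows: "row_sum n A i = row_sum n K i + row_sum n B i"
    if "i < m" "\<And>p. p \<in> cells m n \<Longrightarrow> A p = K p + B p" for A K B i
    using that by (simp add: row_sum_def flip: sum.distrib)
  have cols: "col_sum m A j = col_sum m K j + col_sum m B j"
    if "j < n" "\<And>p. p \<in> cells m n \<Longrightarrow> A p = K p + B p" for A K B j
    using that by (simp add: col_sum_def flip: sum.distrib)
  have finS: "finite S"
  proof (rule finite_subset)
    show "S \<subseteq> cells m n \<rightarrow>\<^sub>E {..s}"
    proof
      fix K assume K: "K \<in> S"
      then have "K p \<le> s" if "p \<in> cells m n" for p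
        using cell_le_row[of "snd p" n K "fst p"] that by (fastforce simp: S_def)
      then show "K \<in> cells m n \<rightarrow>\<^sub>E {..s}" using K by (auto simp: S_def PiE_def)
    qed
  qed (intro finite_PiE, auto)
  have "real (M_count m s n t) = (\<Sum>A\<in>T. \<Prod>p\<in>cells m n. \<Sum>k\<le>A p. derange k / fact (A p - k))"
    unfolding card_tables_eq_M_count[symmetric] T_def[symmetric] sum_derange by simp
  also have "\<dots> = (\<Sum>A\<in>T. \<Sum>K\<in>Pi\<^sub>E (cells m n) (\<lambda>p. {..A p}).
      \<Prod>p\<in>cells m n. derange (K p) / fact (A p - K p))"
    by (intro sum.cong refl prod_sum_PiE) auto
  also have "\<dots> = (\<Sum>(A, K)\<in>Sigma T (\<lambda>A. Pi\<^sub>E (cells m n) (\<lambda>p. {..A p})).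
      \<Prod>p\<in>cells m n. derange (K p) / fact (A p - K p))"
    by (rule sum.Sigma) (auto simp: T_def finite_tables intro!: finite_PiE)
  also have "\<dots> = (\<Sum>(K, B)\<in>Sigma S C. \<Prod>p\<in>cells m n. derange (K p) * (1 / fact (B p)))"
  proof (rule sum.reindex_bij_witness[of _
        "\<lambda>(K, B). (\<lambda>p\<in>cells m n. K p + B p, K)" "\<lambda>(A, K). (K, \<lambda>p\<in>cells m n. A p - K p)"])
    fix a assume a: "a \<in> Sigma T (\<lambda>A. Pi\<^sub>E (cells m n) (\<lambda>p. {..A p}))"
    obtain A K where aeq: "a = (A, K)" by (cases a)
    have A: "A \<in> T" and K: "K \<in> Pi\<^sub>E (cells m n) (\<lambda>p. {..A p})" using a aeq by auto
    have le: "K p \<le> A p" if "p \<in> cells m n" for p using K that by (auto simp: PiE_def)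
    have *: "A p = K p + (\<lambda>p\<in>cells m n. A p - K p) p" if "p \<in> cells m n" for p
      using le[OF that] that by simp
    show "(case (case a of (A, K) \<Rightarrow> (K, \<lambda>p\<in>cells m n. A p - K p)) of
           (K, B) \<Rightarrow> (\<lambda>p\<in>cells m n. K p + B p, K)) = a"
    proof -
      have "A \<in> extensional (cells m n)" using A by (simp add: T_def tables_def PiE_def)
      then have "(\<lambda>p\<in>cells m n. K p + (\<lambda>p\<in>cells m n. A p - K p) p) = A"
        using le by (intro extensionalityI[of _ "cells m n"]) auto
      then show ?thesis unfolding aeq by simp
    qed
    have "row_sum n K i + row_sum n (\<lambda>p\<in>cells m n. A p - K p) i = s" if "i < m" for i
      using rows[OF that, of A K "\<lambda>p\<in>cells m n. A p - K p", OF *] A that by (simp add: T_def tables_def)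
    moreover have "col_sum m K j + col_sum m (\<lambda>p\<in>cells m n. A p - K p) j = t" if "j < n" for j
      using cols[OF that, of A K "\<lambda>p\<in>cells m n. A p - K p", OF *] A that by (simp add: T_def tables_def)
    moreover have "K \<in> cells m n \<rightarrow>\<^sub>E UNIV" using K by (auto simp: PiE_def)
    ultimately show "(case a of (A, K) \<Rightarrow> (K, \<lambda>p\<in>cells m n. A p - K p)) \<in> Sigma S C"
      unfolding aeq by (fastforce simp: S_def C_def tables_def)
    show "(case (case a of (A, K) \<Rightarrow> (K, \<lambda>p\<in>cells m n. A p - K p)) of
           (K, B) \<Rightarrow> \<Prod>p\<in>cells m n. derange (K p) * (1 / fact (B p)))
        = (case a of (A, K) \<Rightarrow> \<Prod>p\<in>cells m n. derange (K p) / fact (A p - K p))"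
      unfolding aeq by (auto intro!: prod.cong)
  next
    fix b assume b: "b \<in> Sigma S C"
    obtain K B where beq: "b = (K, B)" by (cases b)
    have K: "K \<in> S" and B: "B \<in> C K" using b beq by auto
    have *: "(\<lambda>p\<in>cells m n. K p + B p) p = K p + B p" if "p \<in> cells m n" for p
      using that by simp
    show "(case (case b of (K, B) \<Rightarrow> (\<lambda>p\<in>cells m n. K p + B p, K)) of
           (A, K) \<Rightarrow> (K, \<lambda>p\<in>cells m n. A p - K p)) = b"
    proof -
      have "B \<in> extensional (cells m n)" using B by (simp add: C_def tables_def PiE_def)
      then have "(\<lambda>p\<in>cells m n. (\<lambda>p\<in>cells m n. K p + B p) p - K p) = B"
        by (intro extensionalityI[of _ "cells m n"]) auto
      then show ?thesis unfolding beq by simp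
    qed
    have "row_sum n (\<lambda>p\<in>cells m n. K p + B p) i = s" if "i < m" for i
      using rows[OF that, of "\<lambda>p\<in>cells m n. K p + B p" K B, OF *] K B that by (simp add: S_def C_def tables_def)
    moreover have "col_sum m (\<lambda>p\<in>cells m n. K p + B p) j = t" if "j < n" for j
      using cols[OF that, of "\<lambda>p\<in>cells m n. K p + B p" K B, OF *] K B that by (simp add: S_def C_def tables_def)
    moreover have "K \<in> Pi\<^sub>E (cells m n) (\<lambda>p. {..(\<lambda>p\<in>cells m n. K p + B p) p})"
      using K by (auto simp: S_def PiE_def)
    ultimately show "(case b of (K, B) \<Rightarrow> (\<lambda>p\<in>cells m n. K p + B p, K))
        \<in> Sigma T (\<lambda>A. Pi\<^sub>E (cells m n) (\<lambda>p. {..A p}))"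
      unfolding beq by (auto simp: T_def tables_def)
  qed
  also have "\<dots> = (\<Sum>K\<in>S. \<Sum>B\<in>C K. \<Prod>p\<in>cells m n. derange (K p) * (1 / fact (B p)))"
    by (rule sum.Sigma[symmetric]) (auto simp: finS C_def finite_tables)
  also have "\<dots> = (\<Sum>K\<in>S. weight m s n t K)"
  proof (intro sum.cong refl)
    fix K assume K: "K \<in> S"
    have "(\<Sum>i<m. s - row_sum n K i) = m * s - total m n K"
      using K unfolding total_eq_rows by (subst sum_subtractf_nat) (auto simp: S_def)
    moreover have "(\<Sum>j<n. t - col_sum m K j) = m * s - total m n K"
      using K assms unfolding total_eq_cols by (subst sum_subtractf_nat) (auto simp: S_def)
    ultimately show "(\<Sum>B\<in>C K. \<Prod>p\<in>cells m n. derange (K p) * (1 / fact (B p))) = weight m s n t K"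
      unfolding prod.distrib sum_distrib_left[symmetric] C_def weight_def
      by (subst sum_tables_inverse_fact) auto
  qed
  also have "\<dots> = (\<Sum>K\<in>states m s n t (m * s). weight m s n t K)"
  proof (rule sum.mono_neutral_right[OF finS])
    show "states m s n t (m * s) \<subseteq> S" by (auto simp: states_def S_def)
    show "\<forall>K\<in>S - states m s n t (m * s). weight m s n t K = 0"
    proof
      fix K assume K: "K \<in> S - states m s n t (m * s)"
      have "total m n K \<le> (\<Sum>i<m. s)"
        unfolding total_eq_rows using K by (intro sum_mono) (auto simp: S_def)
      then obtain p where "p \<in> cells m n" "K p = 1" using K by (auto simp: S_def states_def)
      then have "(\<Prod>p\<in>cells m n. derange (K p)) = 0" by (intro prod_zero finite_cartesian_product bexI[of _ p]) auto
      then show "weight m s n t K = 0" by (simp add: weight_def)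
    qed
  qed
  finally show ?thesis .
qed

section \<open>Falling factorials\<close>

definition ffall :: "nat \<Rightarrow> nat \<Rightarrow> real" where
  "ffall x a = (\<Prod>i<a. real x - real i)"

lemma ffall_eq_0: "x < a \<Longrightarrow> ffall x a = 0"
  unfolding ffall_def by (rule prod_zero) auto

lemma ffall_nonneg: "0 \<le> ffall x a"
proof (cases "x < a")
  case False
  then show ?thesis unfolding ffall_def by (intro prod_nonneg) auto
qed (simp add: ffall_eq_0)

lemma ffall_le_power: "ffall x a \<le> real x ^ a"
proof (cases "x < a")
  case False
  then have "ffall x a \<le> (\<Prod>i<a. real x)"
    unfolding ffall_def by (intro prod_mono) auto
  then show ?thesis by simp
qed (simp add: ffall_eq_0)

lemma ffall_ge_power: "a \<le> x \<Longrightarrow> real (x - a) ^ a \<le> ffall x a"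
proof -
  assume "a \<le> x"
  then have "(\<Prod>i<a. real (x - a)) \<le> ffall x a"
    unfolding ffall_def by (intro prod_mono) auto
  then show ?thesis by simp
qed

lemma fact_eq_ffall: "a \<le> x \<Longrightarrow> fact x = ffall x a * fact (x - a)"
proof (induction a)
  case (Suc a)
  then have "x - a = Suc (x - Suc a)" by simp
  then have "fact (x - a) = (real x - real a) * (fact (x - Suc a) :: real)"
    using Suc.prems by (simp add: of_nat_diff)
  then show ?case using Suc by (simp add: ffall_def)
qed (simp add: ffall_def)

lemma ffall_2: "ffall x 2 = real x * (real x - 1)"
  by (simp add: ffall_def numeral_2_eq_2)

lemma ffall_3: "ffall x 3 = real x * (real x - 1) * (real x - 2)"
  by (simp add: ffall_def numeral_3_eq_3)

lemma ffall_mono: "x \<le> y \<Longrightarrow> ffall x a \<le> ffall y a"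
proof (cases "x < a")
  case False
  assume "x \<le> y"
  then show ?thesis using False unfolding ffall_def by (intro prod_mono) auto
qed (simp add: ffall_eq_0 ffall_nonneg)

lemma sum_ffall_2:
  fixes R :: "nat \<Rightarrow> nat"
  assumes "\<And>i. i < m \<Longrightarrow> R i \<le> s"
  shows "(\<Sum>i<m. ffall (s - R i) 2) = real m * real s * (real s - 1)
     - (2 * (real s - 1) - 1) * (\<Sum>i<m. real (R i)) + (\<Sum>i<m. real (R i) * (real (R i) - 2))"
proof -
  have "(\<Sum>i<m. ffall (s - R i) 2) = (\<Sum>i<m. real s * (real s - 1)
      - (2 * (real s - 1) - 1) * real (R i) + real (R i) * (real (R i) - 2))"
    using assms by (intro sum.cong refl) (simp add: ffall_2 of_nat_diff algebra_simps)
  then show ?thesis by (simp add: sum.distrib sum_subtractf sum_distrib_left)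
qed

text \<open>Lowering the argument by one lowers the cubic falling factorial by three times the quadratic one.\<close>

lemma ffall_3_diff: "R \<le> s \<Longrightarrow> ffall s 3 - 3 * (real s)\<^sup>2 * real R \<le> ffall (s - R) 3"
proof (induction R)
  case (Suc R)
  define p where "p = s - Suc R"
  have p: "s - R = Suc p" "p \<le> s" using Suc.prems by (auto simp: p_def)
  have "ffall (Suc p) 3 = ffall p 3 + 3 * (real p * (real p - 1))"
    by (simp add: ffall_3 algebra_simps)
  moreover have "real p * (real p - 1) \<le> (real s)\<^sup>2"
  proof -
    have "real p * (real p - 1) \<le> real p * real p" by (intro mult_left_mono) auto
    also have "\<dots> \<le> real s * real s" using p(2) by (intro mult_mono) auto
    finally show ?thesis by (simp add: power2_eq_square)
  qed
  ultimately show ?case using Suc p(1) unfolding p_def[symmetric] by (simp add: algebra_simps)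
qed simp

text \<open>A weak form of Stirling's bound, with 3 in place of \<open>e\<close>; it follows from \<open>(1 + 1/k)\<^sup>k \<le> e \<le> 3\<close>.\<close>

lemma fact_ge_power_div_3: "(real k / 3) ^ k \<le> fact k"
proof (induction k)
  case (Suc k)
  have "(1 + 1 / real k) ^ k \<le> 3"
  proof (cases "k = 0")
    case False
    have "(1 + 1 / real k) ^ k \<le> exp (1 / real k) ^ k"
      using exp_ge_add_one_self[of "1 / real k"] by (intro power_mono) auto
    also have "\<dots> = exp 1" using False by (simp flip: exp_of_nat_mult)
    also have "\<dots> \<le> 3" by (rule exp_le)
    finally show ?thesis .
  qed simp
  then have "real (Suc k) / 3 * ((1 + 1 / real k) ^ k * (real k / 3) ^ k) \<le> real (Suc k) / 3 * (3 * fact k)"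
    using Suc by (intro mult_left_mono mult_mono) auto
  moreover have "(1 + 1 / real k) ^ k * (real k / 3) ^ k = (real (Suc k) / 3) ^ k"
  proof (cases "k = 0")
    case False
    then have "(1 + 1 / real k) * (real k / 3) = real (Suc k) / 3" by (simp add: field_simps)
    then show ?thesis by (simp flip: power_mult_distrib)
  qed simp
  ultimately show ?case by (simp del: of_nat_Suc)
qed simp

section \<open>Removing an occupied cell\<close>

text \<open>The factor by which the weight of \<open>K\<close> grows when the empty cell \<open>p\<close> receives the value \<open>a\<close>.
It is 0 when the margins leave no room for \<open>a\<close>, because the falling factorials vanish.\<close>

definition rate :: "nat \<Rightarrow> nat \<Rightarrow> nat \<Rightarrow> nat \<Rightarrow> (nat \<times> nat \<Rightarrow> nat) \<Rightarrow> nat \<times> nat \<Rightarrow> nat \<Rightarrow> real" where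
  "rate m s n t K p a = derange a * ffall (s - row_sum n K (fst p)) a *
     ffall (t - col_sum m K (snd p)) a / ffall (m * s - total m n K) a"

lemma rate_nonneg: "0 \<le> rate m s n t K p a"
  unfolding rate_def by (intro divide_nonneg_nonneg mult_nonneg_nonneg derange_nonneg ffall_nonneg)

lemma prod_fact_deficit:
  fixes f g :: "nat \<Rightarrow> nat"
  assumes "i < m" "g i = f i + a" "\<And>i'. i' < m \<Longrightarrow> i' \<noteq> i \<Longrightarrow> g i' = f i'" "a \<le> s - f i"
  shows "(\<Prod>i<m. fact (s - f i)) = ffall (s - f i) a * (\<Prod>i<m. fact (s - g i) :: real)"
proof -
  have "(\<Prod>i'\<in>{..<m} - {i}. fact (s - f i')) = (\<Prod>i'\<in>{..<m} - {i}. fact (s - g i') :: real)"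
    using assms(3) by (intro prod.cong) auto
  moreover have "(fact (s - f i) :: real) = ffall (s - f i) a * fact (s - g i)"
    using fact_eq_ffall[OF assms(4)] assms(2) by simp
  ultimately show ?thesis using assms(1) by (simp add: prod.remove[of "{..<m}" i])
qed

lemma weight_upd:
  assumes "i < m" "j < n" "K (i, j) = 0" "total m n K + a \<le> m * s"
    "a \<le> s - row_sum n K i" "a \<le> t - col_sum m K j"
  shows "weight m s n t (K((i, j) := a)) = weight m s n t K * rate m s n t K (i, j) a"
proof -
  let ?p = "(i, j)" and ?K = "K((i, j) := a)"
  have p: "?p \<in> cells m n" using assms by auto
  have D: "(\<Prod>q\<in>cells m n. derange (?K q)) = derange a * (\<Prod>q\<in>cells m n. derange (K q))"
    using p assms(3) by (subst prod_fun_upd) (auto simp: prod.remove[of "cells m n" ?p])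
  have T: "total m n ?K = total m n K + a" using total_upd[OF p, of K a] assms(3) by simp
  have F: "(fact (m * s - total m n K) :: real)
      = ffall (m * s - total m n K) a * fact (m * s - total m n ?K)"
    using fact_eq_ffall[of a "m * s - total m n K"] assms(4) T by simp
  have R: "(\<Prod>i<m. fact (s - row_sum n K i))
      = ffall (s - row_sum n K i) a * (\<Prod>i<m. fact (s - row_sum n ?K i) :: real)"
    using assms row_sum_upd[of j n K i a] by (intro prod_fact_deficit) auto
  have C: "(\<Prod>j<n. fact (t - col_sum m K j))
      = ffall (t - col_sum m K j) a * (\<Prod>j<n. fact (t - col_sum m ?K j) :: real)"
    using assms col_sum_upd[of i m K j a] by (intro prod_fact_deficit) auto
  have nz: "(fact k :: real) \<noteq> 0" for k by simp
  have "ffall (s - row_sum n K i) a \<noteq> 0" "ffall (t - col_sum m K j) a \<noteq> 0"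
    "ffall (m * s - total m n K) a \<noteq> 0"
    using fact_eq_ffall[OF assms(5)] fact_eq_ffall[OF assms(6)] F nz by (metis mult_zero_left)+
  moreover have "(\<Prod>i<m. fact (s - row_sum n ?K i) :: real) \<noteq> 0"
    "(\<Prod>j<n. fact (t - col_sum m ?K j) :: real) \<noteq> 0" by (simp_all del: fun_upd_apply)
  ultimately show ?thesis
    unfolding weight_def rate_def D F R C by (simp add: field_simps del: fun_upd_apply)
qed

lemma weight_nonneg: "0 \<le> weight m s n t K"
  unfolding weight_def
  by (intro mult_nonneg_nonneg divide_nonneg_nonneg prod_nonneg ballI derange_nonneg) auto

lemma finite_states: "finite (states m s n t L)"
proof (rule finite_subset)
  show "states m s n t L \<subseteq> cells m n \<rightarrow>\<^sub>E {..s}"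
  proof
    fix K assume K: "K \<in> states m s n t L"
    then have "K p \<le> s" if "p \<in> cells m n" for p
      using cell_le_row[of "snd p" n K "fst p"] that by (fastforce simp: states_def)
    then show "K \<in> cells m n \<rightarrow>\<^sub>E {..s}" using K by (auto simp: states_def PiE_def)
  qed
qed (intro finite_PiE, auto)

definition occupied :: "nat \<Rightarrow> nat \<Rightarrow> (nat \<times> nat \<Rightarrow> nat) \<Rightarrow> nat" where
  "occupied m n K = card {p \<in> cells m n. K p \<noteq> 0}"

lemma occupied_upd:
  assumes "p \<in> cells m n" "K p \<noteq> 0"
  shows "occupied m n K = Suc (occupied m n (K(p := 0)))"
proof -
  have "{q \<in> cells m n. K q \<noteq> 0} = insert p {q \<in> cells m n. (K(p := 0)) q \<noteq> 0}"
    using assms by auto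
  then show ?thesis unfolding occupied_def by simp
qed

lemma occupied_le_total: "occupied m n K \<le> total m n K"
proof -
  have "occupied m n K = (\<Sum>p\<in>{p \<in> cells m n. K p \<noteq> 0}. 1)" by (simp add: occupied_def)
  also have "\<dots> \<le> (\<Sum>p\<in>{p \<in> cells m n. K p \<noteq> 0}. K p)" by (intro sum_mono) auto
  also have "\<dots> \<le> total m n K" unfolding total_def by (intro sum_mono2) auto
  finally show ?thesis .
qed

lemma states_upd_iff:
  assumes "p \<in> cells m n" "K p = 0" "K \<in> states m s n t L"
  shows "K(p := a) \<in> states m s n t L \<longleftrightarrow> a \<noteq> 1 \<and> a + total m n K \<le> L \<and>
     a \<le> s - row_sum n K (fst p) \<and> a \<le> t - col_sum m K (snd p)"
proof -
  obtain i j where p: "p = (i, j)" "i < m" "j < n" using assms(1) by (cases p) auto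
  have le: "row_sum n K i \<le> s" "col_sum m K j \<le> t" using assms(3) p by (auto simp: states_def)
  have "K(p := a) \<in> cells m n \<rightarrow>\<^sub>E UNIV"
    using assms by (intro PiE_upd) (auto simp: states_def)
  moreover have "(\<forall>q\<in>cells m n. (K(p := a)) q \<noteq> 1) \<longleftrightarrow> a \<noteq> 1"
    using assms by (auto simp: states_def)
  moreover have "(\<forall>i'<m. row_sum n (K(p := a)) i' \<le> s) \<longleftrightarrow> row_sum n K i + a \<le> s"
  proof -
    have "row_sum n (K(p := a)) i = row_sum n K i + a"
      using row_sum_upd[OF p(3), of K i a] assms(2) p(1) by simp
    moreover have "row_sum n (K(p := a)) i' \<le> s" if "i' < m" "i' \<noteq> i" for i'
      using assms(3) that p by (simp add: states_def)
    ultimately show ?thesis using p(2) by metis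
  qed
  moreover have "(\<forall>j'<n. col_sum m (K(p := a)) j' \<le> t) \<longleftrightarrow> col_sum m K j + a \<le> t"
  proof -
    have "col_sum m (K(p := a)) j = col_sum m K j + a"
      using col_sum_upd[OF p(2), of K j a] assms(2) p(1) by simp
    moreover have "col_sum m (K(p := a)) j' \<le> t" if "j' < n" "j' \<noteq> j" for j'
      using assms(3) that p by (simp add: states_def)
    ultimately show ?thesis using p(3) by metis
  qed
  moreover have "total m n (K(p := a)) = total m n K + a"
    using total_upd[OF assms(1), of K a] assms(2) by simp
  ultimately show ?thesis using le p(1) by (auto simp: states_def)
qed

lemma states_upd_0:
  assumes "K \<in> states m s n t L" "p \<in> cells m n"
  shows "K(p := 0) \<in> states m s n t L"
proof -
  obtain i j where p: "p = (i, j)" "i < m" "j < n" using assms(2) by (cases p) auto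
  have "K(p := 0) \<in> cells m n \<rightarrow>\<^sub>E UNIV"
    using assms by (intro PiE_upd) (auto simp: states_def)
  moreover have "row_sum n (K(p := 0)) i' \<le> row_sum n K i'" for i'
    unfolding row_sum_def by (intro sum_mono) auto
  moreover have "col_sum m (K(p := 0)) j' \<le> col_sum m K j'" for j'
    unfolding col_sum_def by (intro sum_mono) auto
  moreover have "total m n (K(p := 0)) \<le> total m n K"
    unfolding total_def by (intro sum_mono) auto
  ultimately show ?thesis
    using assms(1) unfolding states_def by (simp, meson le_trans)
qed

text \<open>The states in which \<open>p\<close> is occupied correspond to pairs of a state with \<open>p\<close> empty and a value
\<open>a \<ge> 2\<close>.  The pairs that would violate a margin have rate 0 and may be added.\<close>

lemma removal_identity_cell:
  fixes m n s t L :: nat and \<psi> :: "nat \<Rightarrow> (nat \<times> nat \<Rightarrow> nat) \<Rightarrow> real"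
  assumes p: "p \<in> cells m n" and L: "L \<le> m * s"
  defines "\<Omega> \<equiv> states m s n t L"
  shows "(\<Sum>K | K \<in> \<Omega> \<and> K p \<noteq> 0. weight m s n t K * \<psi> (K p) (K(p := 0)))
       = (\<Sum>K | K \<in> \<Omega> \<and> K p = 0. \<Sum>a = 2..L - total m n K.
            weight m s n t K * (rate m s n t K p a * \<psi> a K))"
proof -
  obtain i j where pij: "p = (i, j)" "i < m" "j < n" using p by (cases p) auto
  define J where "J K = {a \<in> {2..L - total m n K}.
    a \<le> s - row_sum n K i \<and> a \<le> t - col_sum m K j}" for K
  define A where "A = {K. K \<in> \<Omega> \<and> K p = 0}"
  have finO: "finite \<Omega>" unfolding \<Omega>_def by (rule finite_states)
  have "(\<Sum>K | K \<in> \<Omega> \<and> K p \<noteq> 0. weight m s n t K * \<psi> (K p) (K(p := 0)))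
      = (\<Sum>(K, a)\<in>Sigma A J. weight m s n t K * (rate m s n t K p a * \<psi> a K))"
  proof (rule sum.reindex_bij_witness[of _ "\<lambda>(K, a). K(p := a)" "\<lambda>K. (K(p := 0), K p)"])
    fix K assume "K \<in> {K. K \<in> \<Omega> \<and> K p \<noteq> 0}"
    then have K: "K \<in> \<Omega>" "K p \<noteq> 0" by auto
    let ?K = "K(p := 0)"
    have K0: "?K \<in> \<Omega>" using K(1) p unfolding \<Omega>_def by (rule states_upd_0)
    have upd: "?K(p := K p) = K" by simp
    show "(case (?K, K p) of (K, a) \<Rightarrow> K(p := a)) = K" by simp
    have *: "K p \<noteq> 1 \<and> K p + total m n ?K \<le> L \<and>
     K p \<le> s - row_sum n ?K (fst p) \<and> K p \<le> t - col_sum m ?K (snd p)"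
      using states_upd_iff[OF p, of ?K s t L "K p"] K(1) K0 unfolding upd \<Omega>_def by simp
    then show "(?K, K p) \<in> Sigma A J"
      using K0 K(2) pij unfolding A_def J_def by auto
    have "weight m s n t K = weight m s n t ?K * rate m s n t ?K p (K p)"
      using weight_upd[of i m j n ?K "K p" s t] * pij L upd by (simp del: fun_upd_apply) simp
    then show "(case (?K, K p) of (K, a) \<Rightarrow> weight m s n t K * (rate m s n t K p a * \<psi> a K))
        = weight m s n t K * \<psi> (K p) (K(p := 0))" by simp
  next
    fix b assume b: "b \<in> Sigma A J"
    obtain K a where beq: "b = (K, a)" by (cases b)
    have K: "K \<in> \<Omega>" "K p = 0" and a: "a \<in> J K" using b beq by (auto simp: A_def)
    have "K(p := a) \<in> \<Omega>"
      using a K states_upd_iff[of p m n K s t L a, OF p K(2)] pij unfolding \<Omega>_def by (auto simp: J_def)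
    then show "(case b of (K, a) \<Rightarrow> K(p := a)) \<in> {K. K \<in> \<Omega> \<and> K p \<noteq> 0}"
      using a unfolding beq by (auto simp: J_def)
    show "((case b of (K, a) \<Rightarrow> K(p := a))(p := 0), (case b of (K, a) \<Rightarrow> K(p := a)) p) = b"
      unfolding beq using K(2) by (auto simp: fun_eq_iff)
  qed
  also have "\<dots> = (\<Sum>K\<in>A. \<Sum>a\<in>J K. weight m s n t K * (rate m s n t K p a * \<psi> a K))"
    by (rule sum.Sigma[symmetric]) (auto simp: A_def J_def finO)
  also have "\<dots> = (\<Sum>K\<in>A. \<Sum>a = 2..L - total m n K. weight m s n t K * (rate m s n t K p a * \<psi> a K))"
  proof (rule sum.cong[OF refl], rule sum.mono_neutral_left)
    fix K assume "K \<in> A"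
    show "\<forall>a\<in>{2..L - total m n K} - J K. weight m s n t K * (rate m s n t K p a * \<psi> a K) = 0"
    proof
      fix a assume "a \<in> {2..L - total m n K} - J K"
      then have "s - row_sum n K i < a \<or> t - col_sum m K j < a" by (auto simp: J_def)
      then have "rate m s n t K p a = 0" unfolding rate_def pij by (auto simp: ffall_eq_0)
      then show "weight m s n t K * (rate m s n t K p a * \<psi> a K) = 0" by simp
    qed
  qed (auto simp: J_def)
  finally show ?thesis unfolding A_def .
qed

text \<open>The analogue of the Mecke equation.  The exponent on the left is that of the state after the removal,
so the identity holds at \<open>u = 0\<close> as well and expresses the derivative of the partition function.\<close>

theorem removal_identity:
  fixes m n s t L :: nat and \<phi> :: "nat \<times> nat \<Rightarrow> nat \<Rightarrow> (nat \<times> nat \<Rightarrow> nat) \<Rightarrow> real" and u :: real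
  assumes "L \<le> m * s"
  defines "\<Omega> \<equiv> states m s n t L"
  shows "(\<Sum>K\<in>\<Omega>. u ^ (occupied m n K - 1) * weight m s n t K *
            (\<Sum>p | p \<in> cells m n \<and> K p \<noteq> 0. \<phi> p (K p) (K(p := 0))))
       = (\<Sum>K\<in>\<Omega>. u ^ occupied m n K * weight m s n t K *
            (\<Sum>p | p \<in> cells m n \<and> K p = 0. \<Sum>a = 2..L - total m n K. rate m s n t K p a * \<phi> p a K))"
    (is "?lhs = ?rhs")
proof -
  have finO: "finite \<Omega>" unfolding \<Omega>_def by (rule finite_states)
  have "?lhs = (\<Sum>K\<in>\<Omega>. \<Sum>p | p \<in> cells m n \<and> K p \<noteq> 0.
      weight m s n t K * (u ^ occupied m n (K(p := 0)) * \<phi> p (K p) (K(p := 0))))"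
    unfolding sum_distrib_left
  proof (intro sum.cong refl)
    fix K :: "nat \<times> nat \<Rightarrow> nat" and p
    assume "p \<in> {p \<in> cells m n. K p \<noteq> 0}"
    then have "occupied m n K - 1 = occupied m n (K(p := 0))" using occupied_upd[of p m n K] by simp
    then show "u ^ (occupied m n K - 1) * weight m s n t K * \<phi> p (K p) (K(p := 0))
      = weight m s n t K * (u ^ occupied m n (K(p := 0)) * \<phi> p (K p) (K(p := 0)))" by simp
  qed
  also have "\<dots> = (\<Sum>p\<in>cells m n. \<Sum>K | K \<in> \<Omega> \<and> K p \<noteq> 0.
      weight m s n t K * (u ^ occupied m n (K(p := 0)) * \<phi> p (K p) (K(p := 0))))"
    by (rule sum.swap_restrict) (auto simp: finO)
  also have "\<dots> = (\<Sum>p\<in>cells m n. \<Sum>K | K \<in> \<Omega> \<and> K p = 0. \<Sum>a = 2..L - total m n K.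
            weight m s n t K * (rate m s n t K p a * (u ^ occupied m n K * \<phi> p a K)))"
    unfolding \<Omega>_def
    by (intro sum.cong refl removal_identity_cell[where \<psi> = "\<lambda>a K. u ^ occupied m n K * \<phi> _ a K"] assms(1)) auto
  also have "\<dots> = (\<Sum>K\<in>\<Omega>. \<Sum>p | p \<in> cells m n \<and> K p = 0. \<Sum>a = 2..L - total m n K.
            weight m s n t K * (rate m s n t K p a * (u ^ occupied m n K * \<phi> p a K)))"
    by (rule sum.swap_restrict[symmetric]) (auto simp: finO)
  also have "\<dots> = ?rhs"
    unfolding sum_distrib_left by (intro sum.cong refl) (simp add: mult_ac)
  finally show ?thesis .
qed

section \<open>Real inequalities for the expansion\<close>

text \<open>Consecutive terms decrease at least by the factor \<open>4 y \<le> 1/2\<close>, so the first term dominates.\<close>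

lemma sum_square_times_power_le:
  fixes y :: real
  assumes "0 \<le> y" "y \<le> 1 / 8" "1 \<le> j"
  shows "(\<Sum>a=j..M. (real a)\<^sup>2 * y ^ a) \<le> 2 * (real j)\<^sup>2 * y ^ j"
proof (cases "j \<le> M")
  case True
  then show ?thesis using assms(3)
  proof (induction j rule: inc_induct)
    case base
    then show ?case using assms by simp
  next
    case (step j)
    have "real (Suc j) \<le> 2 * real j" using step by simp
    then have "(real (Suc j))\<^sup>2 \<le> (2 * real j)\<^sup>2" by (intro power_mono) auto
    then have "2 * (real (Suc j))\<^sup>2 * y \<le> 2 * (2 * real j)\<^sup>2 * (1 / 8)"
      using assms by (intro mult_mono) auto
    then have "2 * (real (Suc j))\<^sup>2 * y * y ^ j \<le> (real j)\<^sup>2 * y ^ j"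
      using assms by (intro mult_right_mono) (auto simp: power2_eq_square)
    moreover have "(\<Sum>a=j..M. (real a)\<^sup>2 * y ^ a)
        = (real j)\<^sup>2 * y ^ j + (\<Sum>a=Suc j..M. (real a)\<^sup>2 * y ^ a)"
      using step by (intro sum.atLeast_Suc_atMost) auto
    ultimately show ?case using step.IH step.prems by (simp add: mult_ac)
  qed
next
  case False
  then show ?thesis using assms by simp
qed

text \<open>Expansion of the rate of entries equal to 2.  Here \<open>P\<close> and \<open>Q\<close> stand for the sums of \<open>p (p - 1)\<close>
over the remaining row and column sums \<open>p\<close>.  They are affine in \<open>k\<close> apart from the defects \<open>R1\<close> and \<open>R2\<close>.  The
target is chosen so that, after multiplication by \<open>(N - k) (N - k - 1)\<close>, the terms of orders \<open>N\<^sup>2\<close> and \<open>N\<close>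
cancel.\<close>

lemma pair_term_expansion:
  fixes N k \<sigma> \<tau> R1 R2 P Q :: real
  assumes N: "N \<ge> 4" and k: "0 \<le> k" "k \<le> N / 2" and st: "0 \<le> \<sigma>" "0 \<le> \<tau>"
    and R: "0 \<le> R1" "0 \<le> R2"
    and P: "P = N * \<sigma> - (2 * \<sigma> - 1) * k + R1" "P \<le> N * \<sigma>"
    and Q: "Q = N * \<tau> - (2 * \<tau> - 1) * k + R2" "0 \<le> Q" "Q \<le> N * \<tau>"
  shows "\<bar>P * Q / ((N - k) * (N - k - 1)) - (\<sigma> * \<tau> * (1 + 1 / N) + k * (\<sigma> + \<tau> - 2 * \<sigma> * \<tau>) / N)\<bar>
     \<le> 8 * (R1 * (\<tau> + 1) + (\<sigma> + 1) * R2) / N + 88 * ((\<sigma> + 1) * (\<tau> + 1)) * (k + 1)\<^sup>2 / N\<^sup>2"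
proof -
  define r where "r = N - k"
  define P0 where "P0 = N * \<sigma> - (2 * \<sigma> - 1) * k"
  define Q0 where "Q0 = N * \<tau> - (2 * \<tau> - 1) * k"
  define x where "x = (\<sigma> + 1) * (\<tau> + 1)"
  define D where "D = \<sigma> + \<tau> - 2 * \<sigma> * \<tau>"
  define T where "T = \<sigma> * \<tau> * (1 + 1 / N) + k * D / N"
  have Npos: "N > 0" using N by simp
  have st0: "0 \<le> \<sigma> * \<tau>" using st by simp
  have "(N / 2) * (N / 4) \<le> r * (r - 1)"
    using N k unfolding r_def by (intro mult_mono) auto
  then have rr: "N\<^sup>2 / 8 \<le> r * (r - 1)" by (simp add: power2_eq_square)
  have rrpos: "r * (r - 1) > 0"
    using rr Npos by (smt (verit) zero_less_power divide_pos_pos)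
  have P0le: "P0 \<le> N * (\<sigma> + 1)" using P R Npos unfolding P0_def by (simp add: algebra_simps)
  have "P0 = \<sigma> * (N - 2 * k) + k" by (simp add: P0_def algebra_simps)
  then have P0ge: "0 \<le> P0" using st k by simp
  have Qle: "Q \<le> N * (\<tau> + 1)" using Q Npos by (simp add: algebra_simps)
  have 1: "\<bar>P * Q - P0 * Q0\<bar> \<le> N * (R1 * (\<tau> + 1) + (\<sigma> + 1) * R2)"
  proof -
    have "P * Q - P0 * Q0 = R1 * Q + P0 * R2"
      unfolding P(1) Q(1) P0_def Q0_def by (simp add: algebra_simps)
    moreover have "R1 * Q \<le> R1 * (N * (\<tau> + 1))" using Qle R by (intro mult_left_mono)
    moreover have "P0 * R2 \<le> N * (\<sigma> + 1) * R2" using P0le R by (intro mult_right_mono)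
    moreover have "0 \<le> R1 * Q" "0 \<le> P0 * R2" using R Q P0ge by simp_all
    ultimately show ?thesis by (simp add: algebra_simps)
  qed
  \<comment> \<open>The terms of orders \<open>N\<^sup>2\<close> and \<open>N\<close> cancel; the equation below lists what is left.\<close>
  have 2: "\<bar>P0 * Q0 - T * (r * (r - 1))\<bar> \<le> 11 * x * (k + 1)\<^sup>2"
  proof -
    have eq: "P0 * Q0 - T * (r * (r - 1)) = (2 * \<sigma> - 1) * (2 * \<tau> - 1) * k\<^sup>2
       + (2 * k + 1) * (\<sigma> * \<tau> + k * D) - \<sigma> * \<tau> * (k\<^sup>2 + k) - (k\<^sup>2 + k) / N * (\<sigma> * \<tau> + k * D)"
      unfolding P0_def Q0_def T_def r_def D_def using Npos
      by (simp add: field_simps power2_eq_square)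
    have x: "x = \<sigma> * \<tau> + \<sigma> + \<tau> + 1" by (simp add: x_def algebra_simps)
    have D: "\<bar>D\<bar> \<le> 2 * x" unfolding D_def x using st st0 unfolding mult.assoc abs_le_iff by argo
    have stx: "\<sigma> * \<tau> \<le> x" "0 \<le> x" unfolding x using st st0 by linarith+
    have "\<bar>k * D\<bar> \<le> k * (2 * x)" unfolding abs_mult using k D by (intro mult_mono) auto
    then have S: "\<bar>\<sigma> * \<tau> + k * D\<bar> \<le> 2 * x * (k + 1)"
    proof -
      have "2 * x * (k + 1) = k * (2 * x) + 2 * x" by (simp add: algebra_simps)
      moreover have "\<bar>\<sigma> * \<tau> + k * D\<bar> \<le> \<bar>\<sigma> * \<tau>\<bar> + \<bar>k * D\<bar>" by (rule abs_triangle_ineq)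
      moreover have "\<bar>\<sigma> * \<tau>\<bar> = \<sigma> * \<tau>" using st0 by simp
      ultimately show ?thesis using \<open>\<bar>k * D\<bar> \<le> k * (2 * x)\<close> stx by linarith
    qed
    have k1: "k\<^sup>2 + k \<le> (k + 1)\<^sup>2" "k\<^sup>2 \<le> (k + 1)\<^sup>2" using k by (simp_all add: power2_eq_square algebra_simps)
    have "\<bar>(2 * \<sigma> - 1) * (2 * \<tau> - 1)\<bar> \<le> 4 * x"
    proof -
      have "(2 * \<sigma> - 1) * (2 * \<tau> - 1) = 4 * (\<sigma> * \<tau>) - 2 * \<sigma> - 2 * \<tau> + 1" by (simp add: algebra_simps)
      then show ?thesis unfolding x abs_le_iff using st st0 by argo
    qed
    then have a: "\<bar>(2 * \<sigma> - 1) * (2 * \<tau> - 1) * k\<^sup>2\<bar> \<le> 4 * x * (k + 1)\<^sup>2"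
      unfolding abs_mult[of _ "k\<^sup>2"] using k1 by (intro mult_mono) auto
    have b: "\<bar>(2 * k + 1) * (\<sigma> * \<tau> + k * D)\<bar> \<le> (2 * (k + 1)) * (2 * x * (k + 1))"
      unfolding abs_mult using k S by (intro mult_mono) auto
    have c: "\<bar>\<sigma> * \<tau> * (k\<^sup>2 + k)\<bar> \<le> x * (k + 1)\<^sup>2"
      unfolding abs_mult using k k1 stx st0 by (intro mult_mono) auto
    have "(k\<^sup>2 + k) / N = k / N * (k + 1)" by (simp add: power2_eq_square field_simps)
    also have "\<dots> \<le> 1 * (k + 1)" using k Npos by (intro mult_right_mono) auto
    finally have "(k\<^sup>2 + k) / N \<le> k + 1" by simp
    then have d: "\<bar>(k\<^sup>2 + k) / N * (\<sigma> * \<tau> + k * D)\<bar> \<le> (k + 1) * (2 * x * (k + 1))"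
      unfolding abs_mult using k S Npos by (intro mult_mono) auto
    have "(k + 1) * (2 * x * (k + 1)) = 2 * (x * (k + 1)\<^sup>2)"
      "(2 * (k + 1)) * (2 * x * (k + 1)) = 4 * (x * (k + 1)\<^sup>2)"
      by (simp_all add: power2_eq_square algebra_simps)
    then show ?thesis unfolding eq using a b c d by linarith
  qed
  have "\<bar>P * Q - T * (r * (r - 1))\<bar> \<le> N * (R1 * (\<tau> + 1) + (\<sigma> + 1) * R2) + 11 * x * (k + 1)\<^sup>2"
    (is "_ \<le> ?E") using 1 2 by linarith
  moreover have E0: "0 \<le> ?E" using calculation by linarith
  moreover have "\<bar>P * Q / (r * (r - 1)) - T\<bar> = \<bar>P * Q - T * (r * (r - 1))\<bar> / (r * (r - 1))"
  proof -
    have "P * Q / (r * (r - 1)) - T = (P * Q - T * (r * (r - 1))) / (r * (r - 1))"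
      using rrpos by (subst diff_divide_distrib) auto
    then show ?thesis using rrpos by (simp only: abs_divide abs_of_pos)
  qed
  ultimately have "\<bar>P * Q / (r * (r - 1)) - T\<bar> \<le> ?E / (N\<^sup>2 / 8)"
    using rr Npos by (simp only:) (intro frac_le, auto)
  also have "\<dots> = 8 * (R1 * (\<tau> + 1) + (\<sigma> + 1) * R2) / N + 88 * x * (k + 1)\<^sup>2 / N\<^sup>2"
    using Npos by (simp add: power2_eq_square field_simps)
  finally show ?thesis unfolding T_def D_def x_def r_def .
qed

text \<open>Entries equal to 3 occur at a rate smaller by the factor \<open>s t / N\<close>, so here the value at \<open>k = 0\<close> is
precise enough.\<close>

lemma triple_term_expansion:
  fixes N k s t A B P Q :: real
  assumes N: "N \<ge> 12" and k: "0 \<le> k" "k \<le> N / 2" and st: "0 \<le> s" "0 \<le> t"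
    and A: "A \<le> N * s\<^sup>2" and B: "B \<le> N * t\<^sup>2"
    and P: "A - 3 * s\<^sup>2 * k \<le> P" "0 \<le> P" "P \<le> A"
    and Q: "B - 3 * t\<^sup>2 * k \<le> Q" "0 \<le> Q" "Q \<le> B"
  shows "\<bar>P * Q / ((N - k) * (N - k - 1) * (N - k - 2)) - A * B / N ^ 3\<bar> \<le> 243 * (s * t)\<^sup>2 * (k + 1) / N\<^sup>2"
proof -
  define D where "D = (N - k) * (N - k - 1) * (N - k - 2)"
  have Npos: "N > 0" using N by simp
  have D1: "D \<le> N ^ 3"
  proof -
    have "D \<le> N * N * N" unfolding D_def using N k by (intro mult_mono) auto
    then show ?thesis by (simp add: power3_eq_cube)
  qed
  have D2: "N ^ 3 / 27 \<le> D"
  proof -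
    have "(N/3) * (N/3) * (N/3) \<le> D" unfolding D_def using N k by (intro mult_mono) auto
    then show ?thesis by (simp add: power3_eq_cube)
  qed
  have D3: "N ^ 3 - 3 * (k + 2) * N\<^sup>2 \<le> D"
  proof -
    have "(N - (k + 2)) * (N - (k + 2)) * (N - (k + 2)) \<le> D" unfolding D_def using N k by (intro mult_mono) auto
    moreover have "(N - (k + 2)) * (N - (k + 2)) * (N - (k + 2)) =
       N ^ 3 - 3 * (k + 2) * N\<^sup>2 + (k + 2) * (k + 2) * (3 * N - (k + 2))"
      by (simp add: power3_eq_cube power2_eq_square algebra_simps)
    moreover have "0 \<le> (k + 2) * (k + 2) * (3 * N - (k + 2))" using N k by (intro mult_nonneg_nonneg) auto
    ultimately show ?thesis by linarith
  qed
  have AB0: "0 \<le> A" "0 \<le> B" using P Q by linarith+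
  have AB: "A * B \<le> N\<^sup>2 * (s * t)\<^sup>2"
  proof -
    have "A * B \<le> (N * s\<^sup>2) * (N * t\<^sup>2)" using A B AB0 by (intro mult_mono) auto
    then show ?thesis by (simp add: power2_eq_square algebra_simps)
  qed
  have 1: "P * Q \<le> A * B" using P Q by (intro mult_mono) auto
  have 2: "A * B - P * Q \<le> 6 * (s * t)\<^sup>2 * k * N"
  proof -
    have "A * B - P * Q = (A - P) * B + P * (B - Q)" by (simp add: algebra_simps)
    moreover have "(A - P) * B \<le> (3 * s\<^sup>2 * k) * (N * t\<^sup>2)" using P B AB0 k by (intro mult_mono) auto
    moreover have "P * (B - Q) \<le> (N * s\<^sup>2) * (3 * t\<^sup>2 * k)" using P Q A k Npos by (intro mult_mono) auto
    ultimately show ?thesis by (simp add: power2_eq_square algebra_simps)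
  qed
  have "P * Q / D - A * B / N ^ 3 = ((P * Q - A * B) * N ^ 3 + A * B * (N ^ 3 - D)) / (D * N ^ 3)"
  proof -
    have "D > 0" using D2 zero_less_power[OF Npos, of 3] by linarith
    then show ?thesis using Npos by (simp add: divide_simps) (simp add: algebra_simps)
  qed
  moreover have "\<bar>(P * Q - A * B) * N ^ 3 + A * B * (N ^ 3 - D)\<bar> \<le> N ^ 4 * (s * t)\<^sup>2 * (9 * k + 6)"
  proof -
    have "\<bar>(P * Q - A * B) * N ^ 3\<bar> \<le> (6 * (s * t)\<^sup>2 * k * N) * N ^ 3"
      unfolding abs_mult using 1 2 Npos k by (intro mult_mono) auto
    moreover have "\<bar>A * B * (N ^ 3 - D)\<bar> \<le> (N\<^sup>2 * (s * t)\<^sup>2) * (3 * (k + 2) * N\<^sup>2)"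
      unfolding abs_mult[of "A * B"] using AB AB0 D1 D3 Npos by (intro mult_mono) auto
    moreover have "(6 * (s * t)\<^sup>2 * k * N) * N ^ 3 + (N\<^sup>2 * (s * t)\<^sup>2) * (3 * (k + 2) * N\<^sup>2)
       = N ^ 4 * (s * t)\<^sup>2 * (9 * k + 6)"
      by (simp add: algebra_simps power2_eq_square power3_eq_cube power4_eq_xxxx)
    ultimately show ?thesis by linarith
  qed
  moreover have "(N ^ 3 / 27) * N ^ 3 \<le> \<bar>D * N ^ 3\<bar>"
    using D2 Npos mult_right_mono[OF D2, of "N ^ 3"] by (simp add: abs_le_iff)
  ultimately have "\<bar>P * Q / D - A * B / N ^ 3\<bar> \<le> N ^ 4 * (s * t)\<^sup>2 * (9 * k + 6) / ((N ^ 3 / 27) * N ^ 3)"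
    using Npos k by (simp only: abs_divide) (intro frac_le, auto)
  also have "\<dots> = 27 * ((s * t)\<^sup>2 * (9 * k + 6)) / N\<^sup>2"
    using Npos by (simp add: field_simps power2_eq_square power3_eq_cube power4_eq_xxxx)
  also have "\<dots> \<le> 243 * (s * t)\<^sup>2 * (k + 1) / N\<^sup>2"
  proof (intro divide_right_mono)
    have "(s * t)\<^sup>2 * (9 * k + 6) \<le> (s * t)\<^sup>2 * (9 * (k + 1))" using k by (intro mult_left_mono) auto
    then show "27 * ((s * t)\<^sup>2 * (9 * k + 6)) \<le> 243 * (s * t)\<^sup>2 * (k + 1)" by (simp add: algebra_simps)
  qed auto
  finally show ?thesis unfolding D_def .
qed

lemma abs_diff_divide_le:
  fixes a b e c :: real
  assumes "\<bar>a - b\<bar> \<le> e" "0 < c"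
  shows "\<bar>a / c - b / c\<bar> \<le> e / c"
proof -
  have "a / c - b / c = (a - b) / c" by (simp add: diff_divide_distrib)
  then show ?thesis using assms by (simp only: abs_divide abs_of_pos) (simp add: divide_right_mono)
qed

section \<open>Expansion of the logarithms in the defining formula\<close>

lemma ln_add_one_bounds:
  fixes z :: real
  assumes "0 \<le> z"
  shows "z - z\<^sup>2 / 2 \<le> ln (1 + z)" "ln (1 + z) \<le> z - z\<^sup>2 / 2 + z ^ 3 / 3"
proof -
  have "((\<lambda>z. ln (1 + z) - (z - z\<^sup>2 / 2)) has_real_derivative (1 / (1 + w) - (1 - w))) (at w)"
    if "w \<ge> 0" for w :: real
    using that by (auto intro!: derivative_eq_intros)
  moreover have "0 \<le> 1 / (1 + w) - (1 - w)" if "w \<ge> 0" for w :: real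
    using that by (simp add: field_simps power2_eq_square)
  ultimately have "ln (1 + 0) - (0 - 0\<^sup>2 / 2) \<le> ln (1 + z) - (z - z\<^sup>2 / 2)"
    using DERIV_nonneg_imp_nondecreasing[OF assms, of "\<lambda>z. ln (1 + z) - (z - z\<^sup>2 / 2)"] by force
  then show "z - z\<^sup>2 / 2 \<le> ln (1 + z)" by simp
  have "((\<lambda>z. z - z\<^sup>2 / 2 + z ^ 3 / 3 - ln (1 + z)) has_real_derivative (1 - w + w\<^sup>2 - 1 / (1 + w))) (at w)"
    if "w \<ge> 0" for w :: real
    using that by (auto intro!: derivative_eq_intros)
  moreover have "0 \<le> 1 - w + w\<^sup>2 - 1 / (1 + w)" if "w \<ge> 0" for w :: real
  proof -
    have "1 - w + w\<^sup>2 - 1 / (1 + w) = w ^ 3 / (1 + w)"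
      using that by (simp add: field_simps power2_eq_square power3_eq_cube)
    then show ?thesis using that by simp
  qed
  ultimately have "0 - 0\<^sup>2 / 2 + 0 ^ 3 / 3 - ln (1 + 0) \<le> z - z\<^sup>2 / 2 + z ^ 3 / 3 - ln (1 + z)"
    using DERIV_nonneg_imp_nondecreasing[OF assms, of "\<lambda>z. z - z\<^sup>2 / 2 + z ^ 3 / 3 - ln (1 + z)"] by force
  then show "ln (1 + z) \<le> z - z\<^sup>2 / 2 + z ^ 3 / 3" by simp
qed

lemma sum_ln_expansion:
  fixes c :: real and s :: nat
  assumes "0 \<le> c"
  shows "\<bar>(\<Sum>i<s. ln (1 + real i * c)) -
      (c * (real s * (real s - 1)) / 2 - c\<^sup>2 * ((real s - 1) * real s * (2 * real s - 1)) / 12)\<bar>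
     \<le> c ^ 3 * real s ^ 4 / 3"
proof -
  have s1: "(\<Sum>i<s. real i) = real s * (real s - 1) / 2"
    by (induction s) (simp_all add: field_simps)
  have s2: "(\<Sum>i<s. (real i)\<^sup>2) = (real s - 1) * real s * (2 * real s - 1) / 6"
    by (induction s) (simp_all add: field_simps power2_eq_square)
  have s3: "(\<Sum>i<s. (real i) ^ 3) \<le> real s ^ 4"
  proof -
    have "(\<Sum>i<s. (real i) ^ 3) \<le> (\<Sum>i<s. (real s) ^ 3)" by (intro sum_mono power_mono) auto
    then show ?thesis by (simp add: power3_eq_cube power4_eq_xxxx)
  qed
  have main: "(\<Sum>i<s. real i * c - (real i * c)\<^sup>2 / 2)
     = c * (real s * (real s - 1)) / 2 - c\<^sup>2 * ((real s - 1) * real s * (2 * real s - 1)) / 12"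
  proof -
    have "(\<Sum>i<s. real i * c - (real i * c)\<^sup>2 / 2) = c * (\<Sum>i<s. real i) - c\<^sup>2 / 2 * (\<Sum>i<s. (real i)\<^sup>2)"
      by (simp add: sum_subtractf sum_distrib_left power_mult_distrib mult_ac)
    then show ?thesis unfolding s1 s2 by simp
  qed
  have lo: "(\<Sum>i<s. real i * c - (real i * c)\<^sup>2 / 2) \<le> (\<Sum>i<s. ln (1 + real i * c))"
    using assms by (intro sum_mono ln_add_one_bounds) auto
  have "(\<Sum>i<s. ln (1 + real i * c)) \<le> (\<Sum>i<s. real i * c - (real i * c)\<^sup>2 / 2 + (real i * c) ^ 3 / 3)"
    using assms by (intro sum_mono ln_add_one_bounds) auto
  also have "\<dots> = (\<Sum>i<s. real i * c - (real i * c)\<^sup>2 / 2) + c ^ 3 / 3 * (\<Sum>i<s. real i ^ 3)"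
    by (simp add: sum.distrib sum_distrib_left power_mult_distrib mult_ac)
  also have "c ^ 3 / 3 * (\<Sum>i<s. real i ^ 3) \<le> c ^ 3 / 3 * real s ^ 4"
    using assms s3 by (intro mult_left_mono) auto
  finally show ?thesis using lo unfolding main abs_le_iff by (intro conjI) (simp_all add: field_simps)
qed

text \<open>The contribution of the factors \<open>((m + 1) / m)\<^bsup>(m - 1) / 2\<^esup>\<close> in the equation that defines \<open>\<Delta>\<close>.\<close>

lemma half_power_factor_expansion:
  assumes "m > 0"
  shows "\<bar>(real m - 1) / 2 * ln ((real m + 1) / real m) - (1 / 2 - 3 / (4 * real m))\<bar> \<le> 1 / (real m)\<^sup>2"
proof -
  define z where "z = 1 / real m"
  have m1: "real m \<ge> 1" using assms by simp
  have z: "0 < z" "z \<le> 1" unfolding z_def using m1 by auto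
  have mz: "real m = 1 / z" by (simp add: z_def)
  have arg: "(real m + 1) / real m = 1 + z" using m1 by (simp add: z_def field_simps)
  have "(real m - 1) / 2 * (z - z\<^sup>2 / 2) \<le> (real m - 1) / 2 * ln (1 + z)"
    using z m1 by (intro mult_left_mono ln_add_one_bounds) auto
  moreover have "(real m - 1) / 2 * ln (1 + z) \<le> (real m - 1) / 2 * (z - z\<^sup>2 / 2 + z ^ 3 / 3)"
    using z m1 by (intro mult_left_mono ln_add_one_bounds) auto
  moreover have "(real m - 1) / 2 * (z - z\<^sup>2 / 2) = 1 / 2 - 3 / 4 * z + z\<^sup>2 / 4"
    unfolding mz using z by (simp add: field_simps power2_eq_square)
  moreover have "(real m - 1) / 2 * (z - z\<^sup>2 / 2 + z ^ 3 / 3) = 1 / 2 - 3 / 4 * z + z\<^sup>2 / 4 + (z\<^sup>2 - z ^ 3) / 6"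
    unfolding mz using z by (simp add: field_simps power2_eq_square power3_eq_cube)
  moreover have "0 \<le> z ^ 3" "0 \<le> z\<^sup>2" using z by simp_all
  moreover have "3 / (4 * real m) = 3 / 4 * z" "1 / (real m)\<^sup>2 = z\<^sup>2"
    by (simp_all add: z_def power_one_over)
  ultimately show ?thesis unfolding arg abs_le_iff by argo
qed

lemma binomial_rising_product:
  assumes "n > 0"
  shows "real ((n + s - 1) choose s) * fact s = (\<Prod>i<s. real (n + i))"
proof (induction s)
  case (Suc s)
  have "Suc s * (Suc (n + s - 1) choose Suc s) = Suc (n + s - 1) * ((n + s - 1) choose s)"
    by (rule Suc_times_binomial)
  moreover have "Suc (n + s - 1) = n + s" using assms by simp
  ultimately have "real (Suc s) * real ((n + s) choose Suc s) = real (n + s) * real ((n + s - 1) choose s)"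
    by (metis of_nat_mult)
  then have "real (Suc s) * real ((n + s) choose Suc s) * fact s
      = real (n + s) * (real ((n + s - 1) choose s) * fact s)"
    by (simp only: mult.assoc)
  then have "real ((n + Suc s - 1) choose Suc s) * fact (Suc s)
      = real (n + s) * (real ((n + s - 1) choose s) * fact s)"
    unfolding fact_Suc by (simp add: mult_ac del: of_nat_Suc of_nat_add)
  then show ?case using Suc by (simp add: mult_ac del: of_nat_add)
qed simp

lemma ln_binomial_rising:
  assumes "n > 0"
  shows "ln (real ((n + s - 1) choose s))
     = real s * ln (real n) + (\<Sum>i<s. ln (1 + real i * (1 / real n))) - ln (fact s)"
proof -
  have pos: "real ((n + s - 1) choose s) > 0" using assms by (simp add: zero_less_binomial_iff)
  have "ln (real ((n + s - 1) choose s)) + ln (fact s) = ln (real ((n + s - 1) choose s) * fact s)"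
    using pos by (simp add: ln_mult)
  also have "\<dots> = (\<Sum>i<s. ln (real (n + i)))"
    unfolding binomial_rising_product[OF assms] using assms by (intro ln_prod) auto
  also have "\<dots> = (\<Sum>i<s. ln (real n) + ln (1 + real i * (1 / real n)))"
  proof (intro sum.cong refl)
    fix i
    have "real (n + i) = real n * (1 + real i * (1 / real n))" using assms by (simp add: field_simps)
    moreover have "1 + real i * (1 / real n) > 0" by (simp add: add_pos_nonneg)
    ultimately show "ln (real (n + i)) = ln (real n) + ln (1 + real i * (1 / real n))"
      using assms by (simp add: ln_mult)
  qed
  finally show ?thesis by (simp add: sum.distrib)
qed

text \<open>All contributions to \<open>\<Delta> / (m + n)\<close> up to order \<open>v = 1 / N\<close>: first the logarithm of the partition
function, then the three binomial coefficients and the two powers.\<close>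

lemma leading_coefficient_identity:
  fixes s t v :: real
  shows "(s - 1) * (t - 1) * (1 + 1 * v) / 2 + (s - 1) * (s - 1 - 1) * ((t - 1) * (t - 1 - 1)) * v / 3
      + (s - 1 + (t - 1) - 2 * (s - 1) * (t - 1)) * ((s - 1) * (t - 1)) * v / 4
      - (t * (s - 1) / 2 - t\<^sup>2 * (s - 1) * (2 * s - 1) * v / 12)
      - (s * (t - 1) / 2 - s\<^sup>2 * (t - 1) * (2 * t - 1) * v / 12)
      + (s * t / 2 - s * t * v / 2 - (s * t)\<^sup>2 * v / 6)
      - (1 / 2 - 3 * s * v / 4) - (1 / 2 - 3 * t * v / 4) + 1 / 2 = 5 * v / 6"
  by (simp add: field_simps power2_eq_square)

text \<open>The powers of \<open>m\<close> and \<open>n\<close> from the three binomial coefficients cancel because \<open>N = m s = n t\<close>, and the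
factorials combine to the weight of the empty state.\<close>

lemma ln_M_formula:
  assumes "m > 0" "n > 0" "m * s = n * t" "s > 0"
  shows "ln (M_formula m s n t \<delta>) =
     ln (fact (m * s) / (fact s ^ m * fact t ^ n))
     + real m * (\<Sum>i<s. ln (1 + real i * (1 / real n))) + real n * (\<Sum>i<t. ln (1 + real i * (1 / real m)))
     - (\<Sum>i<m * s. ln (1 + real i * (1 / real (m * n))))
     + (real m - 1) / 2 * ln ((real m + 1) / real m) + (real n - 1) / 2 * ln ((real n + 1) / real n)
     - 1 / 2 + \<delta> / (real m + real n)"
proof -
  define A where "A = real ((n + s - 1) choose s)"
  define B where "B = real ((m + t - 1) choose t)"
  define C where "C = real ((m * n + m * s - 1) choose (m * s))"
  define U where "U = (real m + 1) / real m"
  define V where "V = (real n + 1) / real n"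
  have mn: "m * n > 0" using assms by simp
  have "m * s \<le> m * n + m * s - 1" using mn by linarith
  then have pos: "0 < A" "0 < B" "0 < C" "0 < U" "0 < V"
    using assms by (auto simp: A_def B_def C_def U_def V_def zero_less_binomial_iff)
  have "ln (M_formula m s n t \<delta>) = real m * ln A + real n * ln B - ln C
     + (real m - 1) / 2 * ln U + (real n - 1) / 2 * ln V + (- 1 / 2 + \<delta> / (real m + real n))"
    unfolding M_formula_def A_def[symmetric] B_def[symmetric] C_def[symmetric] U_def[symmetric] V_def[symmetric]
    using pos by (simp add: ln_mult ln_div ln_realpow ln_powr)
  moreover have "ln A = real s * ln (real n) + (\<Sum>i<s. ln (1 + real i * (1 / real n))) - ln (fact s)"
    unfolding A_def by (rule ln_binomial_rising[OF assms(2)])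
  moreover have "ln B = real t * ln (real m) + (\<Sum>i<t. ln (1 + real i * (1 / real m))) - ln (fact t)"
    unfolding B_def by (rule ln_binomial_rising[OF assms(1)])
  moreover have "ln C = real (m * s) * ln (real (m * n)) + (\<Sum>i<m * s. ln (1 + real i * (1 / real (m * n))))
      - ln (fact (m * s))"
    unfolding C_def by (rule ln_binomial_rising[OF mn])
  moreover have "ln (real (m * n)) = ln (real m) + ln (real n)" using assms by (simp add: ln_mult)
  moreover have "ln (fact (m * s) / (fact s ^ m * fact t ^ n))
      = ln (fact (m * s)) - (real m * ln (fact s) + real n * ln (fact t :: real))"
    by (simp add: ln_mult ln_div ln_realpow)
  moreover have "real (m * s) * (ln (real m) + ln (real n))
      = real n * (real t * ln (real m)) + real m * (real s * ln (real n))"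
  proof -
    have "real m * real s = real n * real t" using assms(3) by (metis of_nat_mult)
    then show ?thesis by (simp add: algebra_simps)
  qed
  ultimately show ?thesis
    unfolding U_def V_def by (auto simp add: right_diff_distrib distrib_left)
qed

section \<open>Sparse margins: sizes and rates\<close>

text \<open>The constant 30000 is an arbitrary choice that is large enough for all estimates, in particular for
the exponential bound on the states of large total.\<close>

locale sparse_margins =
  fixes m s n t :: nat
  assumes s_pos: "s > 0" and t_pos: "t > 0"
    and margins: "m * s = n * t" and sparse: "30000 * (s * t) \<le> m * s"
begin

definition "N = m * s"
definition "low = states m s n t (N div 2)"
definition x :: real where "x = real s * real t"
text \<open>A bound for the cost of one unit in a cell, valid while at least \<open>N / 2\<close> units remain.\<close>

definition y :: real where "y = 2 * x / real N"

abbreviation k :: "(nat \<times> nat \<Rightarrow> nat) \<Rightarrow> real" where "k K \<equiv> real (total m n K)"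
abbreviation cell_rate :: "(nat \<times> nat \<Rightarrow> nat) \<Rightarrow> nat \<times> nat \<Rightarrow> nat \<Rightarrow> real" where "cell_rate \<equiv> rate m s n t"

lemma x_ge_1: "1 \<le> x"
proof -
  have "1 \<le> s * t" using s_pos t_pos by simp
  then have "1 \<le> real (s * t)" by linarith
  then show ?thesis unfolding x_def by simp
qed

lemma N_ge: "30000 * x \<le> real N"
proof -
  have "real (30000 * (s * t)) \<le> real N" using sparse unfolding N_def by (simp only: of_nat_le_iff)
  then show ?thesis by (simp add: x_def)
qed

lemma N_large: "30000 \<le> real N" using N_ge x_ge_1 by linarith

lemma N_pos: "0 < real N" using N_large by linarith

lemma N_rows: "real N = real m * real s" and N_cols: "real N = real n * real t"
  unfolding N_def using margins by (simp_all flip: of_nat_mult)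

lemma cells_x: "real m * real n * x = (real N)\<^sup>2"
  unfolding power2_eq_square x_def by (subst N_rows, subst N_cols) (simp add: mult_ac)

lemma cells_y2: "real m * real n * y\<^sup>2 = 4 * x"
proof -
  have "real m * real n * y\<^sup>2 = 4 * x * (real m * real n * x) / (real N)\<^sup>2"
    unfolding y_def by (simp add: power2_eq_square field_simps)
  then show ?thesis unfolding cells_x using N_pos by simp
qed

lemma y_bounds: "0 < y" "y \<le> 1 / 8"
  unfolding y_def using x_ge_1 N_ge N_pos by (simp_all add: divide_le_eq)

lemma lowD:
  assumes "K \<in> low"
  shows "K \<in> cells m n \<rightarrow>\<^sub>E UNIV" "\<And>p. p \<in> cells m n \<Longrightarrow> K p \<noteq> 1"
    "\<And>i. i < m \<Longrightarrow> row_sum n K i \<le> s" "\<And>j. j < n \<Longrightarrow> col_sum m K j \<le> t"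
    "total m n K \<le> N div 2" "2 * total m n K \<le> N"
  using assms unfolding low_def states_def by auto

lemma finite_low: "finite low" unfolding low_def by (rule finite_states)

text \<open>As long as the remaining total stays at least \<open>c\<close>, adding \<open>a\<close> to a cell costs a factor of at most \<open>s t / c\<close>
per unit.\<close>

lemma rate_le_general:
  assumes "c > 0" "c \<le> real (N - total m n K - a)" "a \<le> N - total m n K"
  shows "cell_rate K p a \<le> (x / c) ^ a"
proof -
  have "c ^ a \<le> real (N - total m n K - a) ^ a" using assms by (intro power_mono) auto
  also have "\<dots> \<le> ffall (N - total m n K) a" using assms(3) by (rule ffall_ge_power)
  finally have D: "c ^ a \<le> ffall (N - total m n K) a" .
  have "ffall (s - row_sum n K (fst p)) a \<le> real s ^ a"
    by (rule order_trans[OF ffall_le_power]) (intro power_mono, auto)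
  moreover have "ffall (t - col_sum m K (snd p)) a \<le> real t ^ a"
    by (rule order_trans[OF ffall_le_power]) (intro power_mono, auto)
  ultimately have "derange a * ffall (s - row_sum n K (fst p)) a * ffall (t - col_sum m K (snd p)) a
      \<le> 1 * real s ^ a * real t ^ a"
    by (intro mult_mono derange_le_1) (auto intro: ffall_nonneg mult_nonneg_nonneg derange_nonneg)
  also have "\<dots> = x ^ a" by (simp add: x_def power_mult_distrib)
  finally have "cell_rate K p a \<le> x ^ a / c ^ a"
    unfolding rate_def N_def[symmetric] using D assms(1) x_ge_1 by (intro frac_le) auto
  then show ?thesis by (simp add: power_divide)
qed

lemma rate_le:
  assumes "K \<in> low" "a \<le> N div 2 - total m n K"
  shows "cell_rate K p a \<le> y ^ a"
proof -
  have "cell_rate K p a \<le> (x / (real N / 2)) ^ a"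
    using lowD(5)[OF assms(1)] assms(2) N_pos by (intro rate_le_general) (linarith+)
  then show ?thesis by (simp add: y_def mult.commute)
qed

lemma rate_le_small:
  assumes "K \<in> low" "a \<le> 3"
  shows "cell_rate K p a \<le> (3 * x / real N) ^ a"
proof -
  have "cell_rate K p a \<le> (x / (real N / 3)) ^ a"
    using lowD(6)[OF assms(1)] assms(2) N_large by (intro rate_le_general) (linarith+)
  then show ?thesis by (simp add: mult.commute)
qed

section \<open>Averages over low states\<close>

definition tilted_weight :: "real \<Rightarrow> (nat \<times> nat \<Rightarrow> nat) \<Rightarrow> real" where
  "tilted_weight u K = u ^ occupied m n K * weight m s n t K"

definition Z :: "real \<Rightarrow> real" where "Z u = (\<Sum>K\<in>low. tilted_weight u K)"

definition avg :: "real \<Rightarrow> ((nat \<times> nat \<Rightarrow> nat) \<Rightarrow> real) \<Rightarrow> real" where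
  "avg u f = (\<Sum>K\<in>low. tilted_weight u K * f K) / Z u"

definition empty_state :: "nat \<times> nat \<Rightarrow> nat" where "empty_state = (\<lambda>p\<in>cells m n. 0)"

lemma empty_state_low: "empty_state \<in> states m s n t L"
  by (auto simp: empty_state_def states_def row_sum_def col_sum_def total_def)

lemma total_empty_state: "total m n empty_state = 0"
  by (simp add: total_def empty_state_def)

lemma weight_empty_state: "weight m s n t empty_state = fact N / (fact s ^ m * fact t ^ n)"
  by (simp add: weight_def empty_state_def N_def total_def row_sum_def col_sum_def)

lemma tilted_weight_nonneg: "0 \<le> u \<Longrightarrow> 0 \<le> tilted_weight u K"
  unfolding tilted_weight_def by (intro mult_nonneg_nonneg weight_nonneg) auto

lemma Z_ge: assumes "0 \<le> u" shows "fact N / (fact s ^ m * fact t ^ n) \<le> Z u"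
proof -
  have "tilted_weight u empty_state \<le> Z u"
    unfolding Z_def using empty_state_low tilted_weight_nonneg[OF assms]
    by (intro member_le_sum) (auto simp: finite_low, auto simp: low_def)
  moreover have "occupied m n empty_state = 0"
    using occupied_le_total[of m n empty_state] total_empty_state by simp
  ultimately show ?thesis by (simp add: tilted_weight_def weight_empty_state)
qed

lemma Z_pos: "0 \<le> u \<Longrightarrow> 0 < Z u"
  by (rule less_le_trans[OF _ Z_ge]) auto

lemma avg_add: "avg u (\<lambda>K. f K + g K) = avg u f + avg u g"
  unfolding avg_def by (simp add: distrib_left sum.distrib add_divide_distrib)

lemma avg_cmult: "avg u (\<lambda>K. c * f K) = c * avg u f"
  unfolding avg_def by (simp add: sum_distrib_left mult_ac)

lemma avg_diff: "avg u (\<lambda>K. f K - g K) = avg u f - avg u g"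
  unfolding avg_def by (simp add: right_diff_distrib sum_subtractf diff_divide_distrib)

lemma avg_const: "0 \<le> u \<Longrightarrow> avg u (\<lambda>K. c) = c"
  unfolding avg_def using Z_pos[of u] by (simp add: Z_def flip: sum_distrib_right)

lemma avg_mono:
  assumes "0 \<le> u" "\<And>K. K \<in> low \<Longrightarrow> f K \<le> g K"
  shows "avg u f \<le> avg u g"
  unfolding avg_def using assms Z_pos[of u] tilted_weight_nonneg[of u]
  by (intro divide_right_mono sum_mono mult_left_mono) auto

lemma avg_cong: "(\<And>K. K \<in> low \<Longrightarrow> f K = g K) \<Longrightarrow> avg u f = avg u g"
  unfolding avg_def by simp

lemma avg_abs_le:
  assumes "0 \<le> u"
  shows "\<bar>avg u f\<bar> \<le> avg u (\<lambda>K. \<bar>f K\<bar>)"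
proof -
  have "avg u f \<le> avg u (\<lambda>K. \<bar>f K\<bar>)" using assms by (intro avg_mono) auto
  moreover have "avg u (\<lambda>K. - 1 * f K) \<le> avg u (\<lambda>K. \<bar>f K\<bar>)" using assms by (intro avg_mono) auto
  ultimately show ?thesis unfolding avg_cmult by linarith
qed

text \<open>The right-hand side of the removal identity: a sum over the possible insertions into empty cells.\<close>

definition gain :: "(nat \<times> nat \<Rightarrow> nat \<Rightarrow> (nat \<times> nat \<Rightarrow> nat) \<Rightarrow> real) \<Rightarrow> (nat \<times> nat \<Rightarrow> nat) \<Rightarrow> real" where
  "gain \<phi> K = (\<Sum>p | p \<in> cells m n \<and> K p = 0. \<Sum>a = 2..N div 2 - total m n K. cell_rate K p a * \<phi> p a K)"

lemma low_removal:
  "(\<Sum>K\<in>low. u ^ (occupied m n K - 1) * weight m s n t K *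
       (\<Sum>p | p \<in> cells m n \<and> K p \<noteq> 0. \<phi> p (K p) (K(p := 0))))
   = (\<Sum>K\<in>low. tilted_weight u K * gain \<phi> K)"
  unfolding low_def tilted_weight_def gain_def by (rule removal_identity) (simp add: N_def)

text \<open>The factor \<open>u\<close> on the right restores the exponent of the state before the removal.\<close>

lemma avg_removal:
  "avg u (\<lambda>K. \<Sum>p | p \<in> cells m n \<and> K p \<noteq> 0. \<phi> p (K p) (K(p := 0))) = u * avg u (gain \<phi>)"
proof -
  define G where "G K = (\<Sum>p | p \<in> cells m n \<and> K p \<noteq> 0. \<phi> p (K p) (K(p := 0)))" for K
  have "tilted_weight u K * G K = u * (u ^ (occupied m n K - 1) * weight m s n t K * G K)" for K
  proof (cases "occupied m n K")
    case 0
    then have "{p \<in> cells m n. K p \<noteq> 0} = {}"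
      unfolding occupied_def by (subst (asm) card_eq_0_iff) auto
    then have "G K = 0" unfolding G_def by (simp only: sum.empty)
    then show ?thesis by simp
  qed (simp add: tilted_weight_def)
  note eq = this
  have "(\<Sum>K\<in>low. tilted_weight u K * G K) = u * (\<Sum>K\<in>low. tilted_weight u K * gain \<phi> K)"
    unfolding low_removal[symmetric] G_def[symmetric] sum_distrib_left by (intro sum.cong refl eq)
  then show ?thesis unfolding avg_def G_def by simp
qed

text \<open>Each unit in a cell costs a factor \<open>y\<close>, so \<open>a = 2\<close> dominates the first part of the bound and \<open>a = 3\<close>
the second.  Separating the two parts matters: for defects the contribution of \<open>a = 2\<close> needs an
already occupied line, and this is what makes them small.\<close>

lemma gain_le:
  assumes K: "K \<in> low" and c: "\<And>p. p \<in> cells m n \<Longrightarrow> 0 \<le> c p" and d: "0 \<le> d"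
    and le: "\<And>p a. p \<in> cells m n \<Longrightarrow> 2 \<le> a \<Longrightarrow> \<phi> p a K \<le> (real a)\<^sup>2 * (c p + (if a \<ge> 3 then d else 0))"
  shows "gain \<phi> K \<le> 8 * y\<^sup>2 * (\<Sum>p\<in>cells m n. c p) + 18 * (real m * real n) * y ^ 3 * d"
proof -
  let ?A = "N div 2 - total m n K"
  have inner: "(\<Sum>a = 2..?A. cell_rate K p a * \<phi> p a K) \<le> 8 * y\<^sup>2 * c p + 18 * y ^ 3 * d"
    if p: "p \<in> cells m n" for p
  proof -
    have "(\<Sum>a = 2..?A. cell_rate K p a * \<phi> p a K)
        \<le> (\<Sum>a = 2..?A. c p * ((real a)\<^sup>2 * y ^ a) + (if a \<ge> 3 then d * ((real a)\<^sup>2 * y ^ a) else 0))"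
    proof (intro sum_mono)
      fix a assume a: "a \<in> {2..?A}"
      have "cell_rate K p a * \<phi> p a K \<le> cell_rate K p a * ((real a)\<^sup>2 * (c p + (if a \<ge> 3 then d else 0)))"
        using le[OF p] a by (intro mult_left_mono rate_nonneg) auto
      also have "\<dots> \<le> y ^ a * ((real a)\<^sup>2 * (c p + (if a \<ge> 3 then d else 0)))"
        using a K c[OF p] d by (intro mult_right_mono rate_le) auto
      finally show "cell_rate K p a * \<phi> p a K
        \<le> c p * ((real a)\<^sup>2 * y ^ a) + (if a \<ge> 3 then d * ((real a)\<^sup>2 * y ^ a) else 0)"
        by (simp add: algebra_simps split: if_splits)
    qed
    also have "\<dots> = c p * (\<Sum>a = 2..?A. (real a)\<^sup>2 * y ^ a)
        + (\<Sum>a = 2..?A. if a \<ge> 3 then d * ((real a)\<^sup>2 * y ^ a) else 0)"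
      by (simp add: sum.distrib sum_distrib_left)
    also have "(\<Sum>a = 2..?A. if a \<ge> 3 then d * ((real a)\<^sup>2 * y ^ a) else 0)
        = (\<Sum>a = 3..?A. d * ((real a)\<^sup>2 * y ^ a))"
      by (intro sum.mono_neutral_cong_right) auto
    also have "\<dots> = d * (\<Sum>a = 3..?A. (real a)\<^sup>2 * y ^ a)" by (simp add: sum_distrib_left)
    also have "c p * (\<Sum>a = 2..?A. (real a)\<^sup>2 * y ^ a) + d * (\<Sum>a = 3..?A. (real a)\<^sup>2 * y ^ a)
        \<le> c p * (2 * (real 2)\<^sup>2 * y ^ 2) + d * (2 * (real 3)\<^sup>2 * y ^ 3)"
      using y_bounds c[OF p] d by (intro add_mono mult_left_mono sum_square_times_power_le) auto
    finally show ?thesis by (simp add: algebra_simps)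
  qed
  have nn: "0 \<le> 8 * y\<^sup>2 * c p + 18 * y ^ 3 * d" if "p \<in> cells m n" for p
    using y_bounds(1) c[OF that] d by (intro add_nonneg_nonneg mult_nonneg_nonneg) auto
  have "gain \<phi> K \<le> (\<Sum>p | p \<in> cells m n \<and> K p = 0. 8 * y\<^sup>2 * c p + 18 * y ^ 3 * d)"
    unfolding gain_def using inner by (intro sum_mono) auto
  also have "\<dots> \<le> (\<Sum>p\<in>cells m n. 8 * y\<^sup>2 * c p + 18 * y ^ 3 * d)"
    using nn by (intro sum_mono2) auto
  also have "\<dots> = 8 * y\<^sup>2 * (\<Sum>p\<in>cells m n. c p) + 18 * (real m * real n) * y ^ 3 * d"
    by (simp add: sum.distrib algebra_simps flip: sum_distrib_left sum_distrib_right)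
  finally show ?thesis .
qed

lemma avg_nonneg: "0 \<le> u \<Longrightarrow> (\<And>K. 0 \<le> f K) \<Longrightarrow> 0 \<le> avg u f"
  using avg_mono[of u "\<lambda>_. 0" f] avg_const[of u 0] by simp

lemma gain_nonneg: "(\<And>p a. 0 \<le> \<phi> p a K) \<Longrightarrow> 0 \<le> gain \<phi> K"
  unfolding gain_def by (intro sum_nonneg mult_nonneg_nonneg rate_nonneg)

section \<open>Moments\<close>

lemma total_eq_occupied_sum: "total m n K = (\<Sum>p | p \<in> cells m n \<and> K p \<noteq> 0. K p)"
  unfolding total_def by (intro sum.mono_neutral_right) auto

lemma avg_total_le:
  assumes "0 \<le> u" "u \<le> 1"
  shows "avg u k \<le> 32 * x"
proof -
  have "avg u k = avg u (\<lambda>K. \<Sum>p | p \<in> cells m n \<and> K p \<noteq> 0. real (K p))"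
    unfolding total_eq_occupied_sum by simp
  also have "\<dots> = u * avg u (gain (\<lambda>p a K. real a))" by (rule avg_removal)
  also have "\<dots> \<le> 1 * (32 * x)"
  proof (intro mult_mono)
    have "gain (\<lambda>p a K. real a) K \<le> 8 * y\<^sup>2 * (\<Sum>p\<in>cells m n. 1) + 18 * (real m * real n) * y ^ 3 * 0"
      if "K \<in> low" for K
      using that by (intro gain_le) (auto simp: power2_eq_square)
    then have "avg u (gain (\<lambda>p a K. real a)) \<le> avg u (\<lambda>K. 8 * (real m * real n * y\<^sup>2))"
      using assms by (intro avg_mono) (auto simp: algebra_simps)
    then show "avg u (gain (\<lambda>p a K. real a)) \<le> 32 * x"
      unfolding avg_const[OF assms(1)] cells_y2 by simp
    show "0 \<le> avg u (gain (\<lambda>p a K. real a))"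
      using assms(1) by (intro avg_nonneg gain_nonneg) auto
  qed (use assms in auto)
  finally show ?thesis by simp
qed

lemma avg_total_square_le:
  assumes "0 \<le> u" "u \<le> 1"
  shows "avg u (\<lambda>K. (k K)\<^sup>2) \<le> 1056 * x\<^sup>2"
proof -
  let ?g = "gain (\<lambda>p a K. real a * real (total m n K + a))"
  have "avg u (\<lambda>K. (k K)\<^sup>2)
     = avg u (\<lambda>K. \<Sum>p | p \<in> cells m n \<and> K p \<noteq> 0. real (K p) * real (total m n (K(p := 0)) + K p))"
  proof (intro avg_cong)
    fix K
    have "(\<Sum>p | p \<in> cells m n \<and> K p \<noteq> 0. real (K p) * real (total m n (K(p := 0)) + K p))
        = (\<Sum>p | p \<in> cells m n \<and> K p \<noteq> 0. real (K p) * k K)"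
      using total_upd[of _ m n K 0] by (intro sum.cong refl) auto
    also have "\<dots> = (k K)\<^sup>2"
      unfolding power2_eq_square sum_distrib_right[symmetric] by (subst (2) total_eq_occupied_sum) simp
    finally show "(k K)\<^sup>2 = (\<Sum>p | p \<in> cells m n \<and> K p \<noteq> 0. real (K p) * real (total m n (K(p := 0)) + K p))" ..
  qed
  also have "\<dots> = u * avg u ?g" by (rule avg_removal)
  also have "\<dots> \<le> 1 * (32 * x * (32 * x + 1))"
  proof (intro mult_mono)
    have "?g K \<le> 32 * x * (k K + 1)" if "K \<in> low" for K
    proof -
      have "?g K \<le> 8 * y\<^sup>2 * (\<Sum>p\<in>cells m n. k K + 1) + 18 * (real m * real n) * y ^ 3 * 0"
      proof (intro gain_le that)
        fix a :: nat assume "2 \<le> a"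
        then have "1 * k K \<le> real a * k K" by (intro mult_right_mono) auto
        then have "real (total m n K + a) \<le> real a * (k K + 1)" by (simp add: algebra_simps)
        then have "real a * real (total m n K + a) \<le> real a * (real a * (k K + 1))"
          by (intro mult_left_mono) auto
        then show "real a * real (total m n K + a) \<le> (real a)\<^sup>2 * (k K + 1 + (if a \<ge> 3 then 0 else 0))"
          by (simp add: power2_eq_square mult_ac)
      qed auto
      also have "\<dots> = 8 * (real m * real n * y\<^sup>2) * (k K + 1)" by simp
      finally show ?thesis unfolding cells_y2 by simp
    qed
    then have "avg u ?g \<le> avg u (\<lambda>K. 32 * x * (k K + 1))" using assms by (intro avg_mono) auto
    also have "\<dots> = 32 * x * (avg u k + 1)" unfolding avg_cmult avg_add avg_const[OF assms(1)] ..
    also have "\<dots> \<le> 32 * x * (32 * x + 1)"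
      using avg_total_le[OF assms] x_ge_1 by (intro mult_left_mono) auto
    finally show "avg u ?g \<le> 32 * x * (32 * x + 1)" .
    show "0 \<le> avg u ?g"
      using assms(1) by (intro avg_nonneg gain_nonneg) auto
  qed (use assms in auto)
  also have "\<dots> = 1024 * x\<^sup>2 + 32 * x * 1" by (simp add: power2_eq_square algebra_simps)
  also have "\<dots> \<le> 1024 * x\<^sup>2 + 32 * x * x" using x_ge_1 by (intro add_mono mult_left_mono) auto
  finally show ?thesis by (simp add: power2_eq_square)
qed

text \<open>A line with sum 2 has defect 0.  A positive defect requires either two occupied cells in one line or
an entry of at least 3; after the removal of a cell these are the two parts of \<open>gain_le\<close>.  The function
\<open>line\<close> stands for row sums and for column sums.\<close>

lemma avg_line_defect_le:
  fixes line :: "(nat \<times> nat \<Rightarrow> nat) \<Rightarrow> nat \<times> nat \<Rightarrow> nat"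
  assumes u: "0 \<le> u" "u \<le> 1"
    and upd: "\<And>K p. p \<in> cells m n \<Longrightarrow> line K p = line (K(p := 0)) p + K p"
    and tot: "\<And>K. (\<Sum>p\<in>cells m n. real (line K p)) = c * k K" and c: "0 \<le> c"
  shows "avg u (\<lambda>K. \<Sum>p | p \<in> cells m n \<and> K p \<noteq> 0. real (K p) * (real (line K p) - 2))
     \<le> 8 * y\<^sup>2 * c * (32 * x) + 144 * x\<^sup>2 / real N" (is "_ \<le> ?B")
proof -
  let ?\<phi> = "\<lambda>p a K. real a * (real (line K p) + real a - 2)"
  have "avg u (\<lambda>K. \<Sum>p | p \<in> cells m n \<and> K p \<noteq> 0. real (K p) * (real (line K p) - 2))
     = avg u (\<lambda>K. \<Sum>p | p \<in> cells m n \<and> K p \<noteq> 0. ?\<phi> p (K p) (K(p := 0)))"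
  proof (intro avg_cong sum.cong refl)
    fix K p assume "p \<in> {p \<in> cells m n. (K p :: nat) \<noteq> 0}"
    then show "real (K p) * (real (line K p) - 2) = ?\<phi> p (K p) (K(p := 0))"
      using upd[of p K] by simp
  qed
  also have "\<dots> = u * avg u (gain ?\<phi>)" by (rule avg_removal)
  also have "\<dots> \<le> u * ?B"
  proof (intro mult_left_mono u)
    have "gain ?\<phi> K \<le> 8 * y\<^sup>2 * c * k K + 144 * x\<^sup>2 / real N" if "K \<in> low" for K
    proof -
      have "gain ?\<phi> K \<le> 8 * y\<^sup>2 * (\<Sum>p\<in>cells m n. real (line K p)) + 18 * (real m * real n) * y ^ 3 * 1"
      proof (intro gain_le that)
        fix p a assume "2 \<le> (a::nat)"
        show "real a * (real (line K p) + real a - 2) \<le> (real a)\<^sup>2 * (real (line K p) + (if a \<ge> 3 then 1 else 0))"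
        proof (cases "a = 2")
          case False
          have "1 * real (line K p) \<le> real a * real (line K p)"
            using \<open>2 \<le> a\<close> by (intro mult_right_mono) auto
          then have "real (line K p) + real a - 2 \<le> real a * (real (line K p) + 1)"
            unfolding distrib_left by linarith
          then have "real a * (real (line K p) + real a - 2) \<le> real a * (real a * (real (line K p) + 1))"
            by (intro mult_left_mono) auto
          then show ?thesis using False \<open>2 \<le> a\<close> by (simp add: power2_eq_square mult_ac)
        qed simp
      qed auto
      also have "18 * (real m * real n) * y ^ 3 * 1 = 18 * (real m * real n * y\<^sup>2) * y"
        by (simp add: power2_eq_square power3_eq_cube)
      also have "\<dots> = 144 * x\<^sup>2 / real N" unfolding cells_y2 by (simp add: y_def power2_eq_square)
      finally show ?thesis unfolding tot by simp
    qed
    then have "avg u (gain ?\<phi>) \<le> avg u (\<lambda>K. 8 * y\<^sup>2 * c * k K + 144 * x\<^sup>2 / real N)"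
      using u by (intro avg_mono)
    also have "\<dots> = 8 * y\<^sup>2 * c * avg u k + 144 * x\<^sup>2 / real N"
      unfolding avg_add avg_cmult avg_const[OF u(1)] ..
    also have "\<dots> \<le> ?B"
      using avg_total_le[OF u] c by (intro add_mono mult_left_mono) auto
    finally show "avg u (gain ?\<phi>) \<le> ?B" .
  qed
  also have "\<dots> \<le> 1 * ?B"
    using u c x_ge_1 by (intro mult_right_mono add_nonneg_nonneg mult_nonneg_nonneg divide_nonneg_nonneg) auto
  finally show ?thesis by simp
qed

text \<open>It vanishes for the typical states, whose rows are empty or contain a single entry 2.  Up to this
correction the sum of \<open>p (p - 1)\<close> over the remaining row sums \<open>p\<close> is affine in the total.\<close>

definition row_defect :: "(nat \<times> nat \<Rightarrow> nat) \<Rightarrow> real" where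
  "row_defect K = (\<Sum>i<m. real (row_sum n K i) * (real (row_sum n K i) - 2))"

definition col_defect :: "(nat \<times> nat \<Rightarrow> nat) \<Rightarrow> real" where
  "col_defect K = (\<Sum>j<n. real (col_sum m K j) * (real (col_sum m K j) - 2))"

lemma row_defect_cells:
  "row_defect K = (\<Sum>p | p \<in> cells m n \<and> K p \<noteq> 0. real (K p) * (real (row_sum n K (fst p)) - 2))"
proof -
  have "row_defect K = (\<Sum>i<m. \<Sum>j<n. real (K (i, j)) * (real (row_sum n K i) - 2))"
    unfolding row_defect_def by (intro sum.cong refl, subst (1) row_sum_def) (simp add: sum_distrib_right)
  also have "\<dots> = (\<Sum>p\<in>cells m n. real (K p) * (real (row_sum n K (fst p)) - 2))"
    by (subst sum.cartesian_product) (simp add: case_prod_unfold)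
  also have "\<dots> = (\<Sum>p | p \<in> cells m n \<and> K p \<noteq> 0. real (K p) * (real (row_sum n K (fst p)) - 2))"
    by (intro sum.mono_neutral_right) auto
  finally show ?thesis .
qed

lemma col_defect_cells:
  "col_defect K = (\<Sum>p | p \<in> cells m n \<and> K p \<noteq> 0. real (K p) * (real (col_sum m K (snd p)) - 2))"
proof -
  have "col_defect K = (\<Sum>j<n. \<Sum>i<m. real (K (i, j)) * (real (col_sum m K j) - 2))"
    unfolding col_defect_def by (intro sum.cong refl, subst (1) col_sum_def) (simp add: sum_distrib_right)
  also have "\<dots> = (\<Sum>i<m. \<Sum>j<n. real (K (i, j)) * (real (col_sum m K j) - 2))" by (rule sum.swap)
  also have "\<dots> = (\<Sum>p\<in>cells m n. real (K p) * (real (col_sum m K (snd p)) - 2))"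
    by (subst sum.cartesian_product) (simp add: case_prod_unfold)
  also have "\<dots> = (\<Sum>p | p \<in> cells m n \<and> K p \<noteq> 0. real (K p) * (real (col_sum m K (snd p)) - 2))"
    by (intro sum.mono_neutral_right) auto
  finally show ?thesis .
qed

lemma x2_over_N_le: "x\<^sup>2 / real N \<le> real s * x\<^sup>2 / real N" "x\<^sup>2 / real N \<le> real t * x\<^sup>2 / real N"
  using s_pos t_pos by (auto intro!: divide_right_mono mult_right_mono[of 1 "real _" "x\<^sup>2", simplified])

lemma avg_row_defect_le:
  assumes "0 \<le> u" "u \<le> 1"
  shows "avg u row_defect \<le> 1168 * (real s * x\<^sup>2 / real N)"
proof -
  have "avg u row_defect \<le> 8 * y\<^sup>2 * real n * (32 * x) + 144 * x\<^sup>2 / real N"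
    unfolding row_defect_cells using assms
  proof (intro avg_line_defect_le)
    fix K :: "nat \<times> nat \<Rightarrow> nat" and p assume "p \<in> cells m n"
    then show "row_sum n K (fst p) = row_sum n (K(p := 0)) (fst p) + K p"
      using row_sum_upd[of "snd p" n K "fst p" 0] by auto
  next
    fix K
    have "(\<Sum>p\<in>cells m n. real (row_sum n K (fst p))) = (\<Sum>i<m. \<Sum>j<n. real (row_sum n K i))"
      by (subst sum.cartesian_product) (simp add: case_prod_unfold)
    then show "(\<Sum>p\<in>cells m n. real (row_sum n K (fst p))) = real n * k K"
      by (simp add: total_eq_rows sum_distrib_left)
  qed auto
  also have "8 * y\<^sup>2 * real n * (32 * x) = 1024 * (real s * x\<^sup>2 / real N)"
    unfolding y_def using t_pos N_pos
    by (simp add: N_cols x_def power2_eq_square divide_simps)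
  finally have "avg u row_defect \<le> 1024 * (real s * x\<^sup>2 / real N) + 144 * (x\<^sup>2 / real N)" by simp
  then show ?thesis using x2_over_N_le(1) by argo
qed

lemma avg_col_defect_le:
  assumes "0 \<le> u" "u \<le> 1"
  shows "avg u col_defect \<le> 1168 * (real t * x\<^sup>2 / real N)"
proof -
  have "avg u col_defect \<le> 8 * y\<^sup>2 * real m * (32 * x) + 144 * x\<^sup>2 / real N"
    unfolding col_defect_cells using assms
  proof (intro avg_line_defect_le)
    fix K :: "nat \<times> nat \<Rightarrow> nat" and p assume "p \<in> cells m n"
    then show "col_sum m K (snd p) = col_sum m (K(p := 0)) (snd p) + K p"
      using col_sum_upd[of "fst p" m K "snd p" 0] by auto
  next
    fix K
    have "(\<Sum>p\<in>cells m n. real (col_sum m K (snd p))) = (\<Sum>i<m. \<Sum>j<n. real (col_sum m K j))"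
      by (subst sum.cartesian_product) (simp add: case_prod_unfold)
    then show "(\<Sum>p\<in>cells m n. real (col_sum m K (snd p))) = real m * k K"
      by (simp add: total_eq_cols sum_distrib_left)
  qed auto
  also have "8 * y\<^sup>2 * real m * (32 * x) = 1024 * (real t * x\<^sup>2 / real N)"
    unfolding y_def using s_pos N_pos
    by (simp add: N_rows x_def power2_eq_square divide_simps)
  finally have "avg u col_defect \<le> 1024 * (real t * x\<^sup>2 / real N) + 144 * (x\<^sup>2 / real N)" by simp
  then show ?thesis using x2_over_N_le(2) by argo
qed

section \<open>First-order expansion of the total rate\<close>

text \<open>The rate of the value \<open>b\<close> summed over all cells, occupied or not, and without regard to the cutoff on
the total.  In this form the sum factors into row and column sums.\<close>

definition full_rate :: "nat \<Rightarrow> (nat \<times> nat \<Rightarrow> nat) \<Rightarrow> real" where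
  "full_rate b K = (\<Sum>p\<in>cells m n. cell_rate K p b)"

lemma full_rate_eq:
  "full_rate b K = derange b * ((\<Sum>i<m. ffall (s - row_sum n K i) b) * (\<Sum>j<n. ffall (t - col_sum m K j) b))
     / ffall (N - total m n K) b"
proof -
  have "full_rate b K = (\<Sum>i<m. \<Sum>j<n. cell_rate K (i, j) b)"
    unfolding full_rate_def by (subst sum.cartesian_product) (simp add: case_prod_unfold)
  also have "\<dots> = (\<Sum>i<m. \<Sum>j<n. derange b * (ffall (s - row_sum n K i) b * ffall (t - col_sum m K j) b)
      / ffall (N - total m n K) b)"
    by (simp add: rate_def N_def mult.assoc)
  also have "\<dots> = derange b * (\<Sum>i<m. \<Sum>j<n. ffall (s - row_sum n K i) b * ffall (t - col_sum m K j) b)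
      / ffall (N - total m n K) b"
    by (simp only: sum_distrib_left sum_divide_distrib)
  finally show ?thesis unfolding sum_product .
qed

lemma full_rate_le:
  assumes "K \<in> low" "b \<in> {2, 3}"
  shows "full_rate b K \<le> 9 * x"
proof -
  let ?z = "3 * x / real N"
  have z: "0 \<le> ?z" "?z \<le> 1" using x_ge_1 N_ge N_pos by (auto simp: divide_le_eq)
  have "?z ^ b \<le> ?z ^ 2" using assms(2) z by (intro power_decreasing) auto
  then have "cell_rate K p b \<le> ?z\<^sup>2" for p
    using rate_le_small[OF assms(1), of b p] assms(2) by auto
  then have "full_rate b K \<le> (\<Sum>p\<in>cells m n. ?z\<^sup>2)"
    unfolding full_rate_def by (intro sum_mono)
  also have "\<dots> = 9 * x * (real m * real n * x) / (real N)\<^sup>2"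
    by (simp add: power2_eq_square)
  finally show ?thesis unfolding cells_x using N_pos by simp
qed

definition total_rate :: "(nat \<times> nat \<Rightarrow> nat) \<Rightarrow> real" where "total_rate = gain (\<lambda>_ _ _. 1)"

lemma sum_from_2_split:
  fixes f :: "nat \<Rightarrow> real"
  shows "(\<Sum>a=2..A. f a) = (if 2 \<le> A then f 2 else 0) + (if 3 \<le> A then f 3 else 0) + (\<Sum>a=4..A. f a)"
proof (cases "3 \<le> A")
  case True
  then have "(\<Sum>a=2..A. f a) = f 2 + (f 3 + (\<Sum>a=4..A. f a))"
    by (simp add: sum.atLeast_Suc_atMost[of 2] sum.atLeast_Suc_atMost[of 3])
  then show ?thesis using True by simp
next
  case False
  then have "A = 2 \<or> A < 2" by linarith
  then show ?thesis by auto
qed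

text \<open>There are at most \<open>k K\<close> occupied cells, each with a rate of order \<open>(s t / N)\<^sup>2\<close>.  The cutoff can only
interfere when \<open>k K\<close> is at least \<open>N / 4\<close>, and then the term with \<open>(k K)\<^sup>2\<close> pays for the whole sum.\<close>

lemma free_cells_sum:
  assumes K: "K \<in> low" and b: "b \<in> {2, 3}"
  shows "\<bar>(\<Sum>p | p \<in> cells m n \<and> K p = 0. if b \<le> N div 2 - total m n K then cell_rate K p b else 0) - full_rate b K\<bar>
     \<le> 9 * x\<^sup>2 * k K / (real N)\<^sup>2 + 144 * x * (k K)\<^sup>2 / (real N)\<^sup>2" (is "\<bar>?S - _\<bar> \<le> ?B1 + ?B2")
proof (cases "b \<le> N div 2 - total m n K")
  case True
  let ?z = "3 * x / real N"
  have z: "0 \<le> ?z" "?z \<le> 1" using x_ge_1 N_ge N_pos by (auto simp: divide_le_eq)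
  have "?z ^ b \<le> ?z ^ 2" using b z by (intro power_decreasing) auto
  then have r: "cell_rate K p b \<le> ?z\<^sup>2" for p
    using rate_le_small[OF K, of b p] b by auto
  have "full_rate b K = ?S + (\<Sum>p | p \<in> cells m n \<and> K p \<noteq> 0. cell_rate K p b)"
  proof -
    have "cells m n = {p \<in> cells m n. K p = 0} \<union> {p \<in> cells m n. K p \<noteq> 0}" by auto
    then have "full_rate b K = (\<Sum>p\<in>{p \<in> cells m n. K p = 0} \<union> {p \<in> cells m n. K p \<noteq> 0}. cell_rate K p b)"
      unfolding full_rate_def by (rule arg_cong)
    also have "\<dots> = (\<Sum>p | p \<in> cells m n \<and> K p = 0. cell_rate K p b) + (\<Sum>p | p \<in> cells m n \<and> K p \<noteq> 0. cell_rate K p b)"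
      by (rule sum.union_disjoint) auto
    finally show ?thesis using True by simp
  qed
  moreover have "0 \<le> (\<Sum>p | p \<in> cells m n \<and> K p \<noteq> 0. cell_rate K p b)" by (intro sum_nonneg rate_nonneg)
  moreover have "(\<Sum>p | p \<in> cells m n \<and> K p \<noteq> 0. cell_rate K p b) \<le> ?B1"
  proof -
    have "(\<Sum>p | p \<in> cells m n \<and> K p \<noteq> 0. cell_rate K p b) \<le> (\<Sum>p | p \<in> cells m n \<and> K p \<noteq> 0. ?z\<^sup>2)"
      using r by (intro sum_mono)
    also have "\<dots> = real (occupied m n K) * ?z\<^sup>2" by (simp add: occupied_def)
    also have "\<dots> \<le> k K * ?z\<^sup>2" using occupied_le_total[of m n K] by (intro mult_right_mono) auto
    also have "\<dots> = ?B1" by (simp add: power2_eq_square)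
    finally show ?thesis .
  qed
  moreover have "0 \<le> ?B2" using x_ge_1 by simp
  ultimately show ?thesis by linarith
next
  case False
  then have "real N / 4 \<le> k K"
    using b N_large by auto
  then have "(real N / 4)\<^sup>2 \<le> (k K)\<^sup>2" using N_pos by (intro power_mono) auto
  then have "1 \<le> 16 * (k K)\<^sup>2 / (real N)\<^sup>2" using N_pos by (simp add: power_divide field_simps)
  then have "9 * x * 1 \<le> 9 * x * (16 * (k K)\<^sup>2 / (real N)\<^sup>2)" using x_ge_1 by (intro mult_left_mono) auto
  then have "9 * x \<le> ?B2" by simp
  moreover have "0 \<le> full_rate b K" unfolding full_rate_def by (intro sum_nonneg rate_nonneg)
  moreover have "full_rate b K \<le> 9 * x" using full_rate_le[OF K b] .
  moreover have "?S = 0" using False by simp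
  moreover have "0 \<le> ?B1" by simp
  ultimately show ?thesis by linarith
qed

lemma total_rate_near_full:
  assumes K: "K \<in> low"
  shows "\<bar>total_rate K - (full_rate 2 K + full_rate 3 K)\<bar>
     \<le> 18 * x\<^sup>2 * k K / (real N)\<^sup>2 + 288 * x * (k K)\<^sup>2 / (real N)\<^sup>2 + 512 * x ^ 3 / (real N)\<^sup>2"
proof -
  let ?A = "N div 2 - total m n K"
  define S where "S b = (\<Sum>p | p \<in> cells m n \<and> K p = 0. if b \<le> ?A then cell_rate K p b else 0)" for b
  define T where "T = (\<Sum>p | p \<in> cells m n \<and> K p = 0. \<Sum>a=4..?A. cell_rate K p a)"
  have "total_rate K = S 2 + S 3 + T"
    unfolding total_rate_def gain_def S_def T_def mult_1_right by (simp only: sum_from_2_split sum.distrib)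
  moreover have "0 \<le> T" unfolding T_def by (intro sum_nonneg rate_nonneg)
  moreover have "T \<le> 512 * x ^ 3 / (real N)\<^sup>2"
  proof -
    have "(\<Sum>a=4..?A. cell_rate K p a) \<le> 32 * y ^ 4" for p
    proof -
      have "(\<Sum>a=4..?A. cell_rate K p a) \<le> (\<Sum>a=4..?A. (real a)\<^sup>2 * y ^ a)"
      proof (intro sum_mono)
        fix a assume a: "a \<in> {4..?A}"
        have "cell_rate K p a \<le> 1 * y ^ a" using rate_le[OF K] a by simp
        also have "\<dots> \<le> (real a)\<^sup>2 * y ^ a" using a y_bounds by (intro mult_right_mono) auto
        finally show "cell_rate K p a \<le> (real a)\<^sup>2 * y ^ a" .
      qed
      also have "\<dots> \<le> 2 * (real 4)\<^sup>2 * y ^ 4" using y_bounds by (intro sum_square_times_power_le) auto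
      finally show ?thesis by simp
    qed
    then have "T \<le> (\<Sum>p | p \<in> cells m n \<and> K p = 0. 32 * y ^ 4)" unfolding T_def by (intro sum_mono)
    also have "\<dots> \<le> (\<Sum>p\<in>cells m n. 32 * y ^ 4)" using y_bounds by (intro sum_mono2) auto
    also have "\<dots> = 32 * (real m * real n * y\<^sup>2) * y\<^sup>2" by (simp add: power2_eq_square power4_eq_xxxx)
    also have "\<dots> = 512 * x ^ 3 / (real N)\<^sup>2"
      unfolding cells_y2 by (simp add: y_def power2_eq_square power3_eq_cube)
    finally show ?thesis .
  qed
  moreover have "\<bar>S 2 - full_rate 2 K\<bar> \<le> 9 * x\<^sup>2 * k K / (real N)\<^sup>2 + 144 * x * (k K)\<^sup>2 / (real N)\<^sup>2"
    "\<bar>S 3 - full_rate 3 K\<bar> \<le> 9 * x\<^sup>2 * k K / (real N)\<^sup>2 + 144 * x * (k K)\<^sup>2 / (real N)\<^sup>2"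
    unfolding S_def using K by (intro free_cells_sum; simp)+
  moreover have "18 * x\<^sup>2 * k K / (real N)\<^sup>2 = 2 * (9 * x\<^sup>2 * k K / (real N)\<^sup>2)"
    "288 * x * (k K)\<^sup>2 / (real N)\<^sup>2 = 2 * (144 * x * (k K)\<^sup>2 / (real N)\<^sup>2)" by simp_all
  ultimately show ?thesis by linarith
qed

definition \<sigma> :: real where "\<sigma> = real s - 1"
definition \<tau> :: real where "\<tau> = real t - 1"

lemma sigma_tau: "0 \<le> \<sigma>" "0 \<le> \<tau>" "\<sigma> + 1 = real s" "\<tau> + 1 = real t" "x = (\<sigma> + 1) * (\<tau> + 1)"
  using s_pos t_pos by (auto simp: \<sigma>_def \<tau>_def x_def)

text \<open>No line sum equals 1, because no entry does.\<close>

lemma line_defect_nonneg: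
  assumes K: "K \<in> low"
  shows "0 \<le> row_defect K" "0 \<le> col_defect K"
proof -
  have "0 \<le> real (row_sum n K i) * (real (row_sum n K i) - 2)" if "i < m" for i
  proof -
    have "row_sum n K i \<noteq> 1"
    proof
      assume 1: "row_sum n K i = 1"
      have "\<exists>j<n. K (i, j) \<noteq> 0"
        by (rule ccontr) (use 1 in \<open>simp add: row_sum_def\<close>)
      then obtain j where j: "j < n" "K (i, j) \<noteq> 0" by auto
      then have "K (i, j) \<ge> 2" using lowD(2)[OF K, of "(i, j)"] that by auto
      then show False using cell_le_row[OF j(1), of K i] 1 by simp
    qed
    then consider "row_sum n K i = 0" | "row_sum n K i \<ge> 2" by linarith
    then show ?thesis by cases auto
  qed
  then show "0 \<le> row_defect K" unfolding row_defect_def by (intro sum_nonneg) auto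
  have "0 \<le> real (col_sum m K j) * (real (col_sum m K j) - 2)" if "j < n" for j
  proof -
    have "col_sum m K j \<noteq> 1"
    proof
      assume 1: "col_sum m K j = 1"
      have "\<exists>i<m. K (i, j) \<noteq> 0"
        by (rule ccontr) (use 1 in \<open>simp add: col_sum_def\<close>)
      then obtain i where i: "i < m" "K (i, j) \<noteq> 0" by auto
      then have "K (i, j) \<ge> 2" using lowD(2)[OF K, of "(i, j)"] that by auto
      then show False using cell_le_col[OF i(1), of K j] 1 by simp
    qed
    then consider "col_sum m K j = 0" | "col_sum m K j \<ge> 2" by linarith
    then show ?thesis by cases auto
  qed
  then show "0 \<le> col_defect K" unfolding col_defect_def by (intro sum_nonneg) auto
qed

lemma full_rate_2_expansion:
  assumes K: "K \<in> low"
  shows "\<bar>full_rate 2 K - (\<sigma> * \<tau> * (1 + 1 / real N) + k K * (\<sigma> + \<tau> - 2 * \<sigma> * \<tau>) / real N) / 2\<bar>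
     \<le> 4 * (row_defect K * real t + real s * col_defect K) / real N + 44 * x * (k K + 1)\<^sup>2 / (real N)\<^sup>2"
proof -
  define P where "P = (\<Sum>i<m. ffall (s - row_sum n K i) 2)"
  define Q where "Q = (\<Sum>j<n. ffall (t - col_sum m K j) 2)"
  have P: "P = real N * \<sigma> - (2 * \<sigma> - 1) * k K + row_defect K"
    unfolding P_def row_defect_def \<sigma>_def total_eq_rows N_rows
    by (subst sum_ffall_2) (use lowD(3)[OF K] in auto)
  have Q: "Q = real N * \<tau> - (2 * \<tau> - 1) * k K + col_defect K"
    unfolding Q_def col_defect_def \<tau>_def total_eq_cols N_cols
    by (subst sum_ffall_2) (use lowD(4)[OF K] in auto)
  have "P \<le> (\<Sum>i<m. ffall s 2)" unfolding P_def by (intro sum_mono ffall_mono) auto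
  then have P2: "P \<le> real N * \<sigma>" by (simp add: ffall_2 N_rows \<sigma>_def)
  have "Q \<le> (\<Sum>j<n. ffall t 2)" unfolding Q_def by (intro sum_mono ffall_mono) auto
  then have Q2: "Q \<le> real N * \<tau>" by (simp add: ffall_2 N_cols \<tau>_def)
  have Q0: "0 \<le> Q" unfolding Q_def by (intro sum_nonneg ffall_nonneg)
  have k: "0 \<le> k K" "k K \<le> real N / 2" using lowD(6)[OF K] by linarith+
  have "full_rate 2 K = derange 2 * (P * Q) / ffall (N - total m n K) 2"
    unfolding full_rate_eq P_def Q_def ..
  then have f: "full_rate 2 K = P * Q / ((real N - k K) * (real N - k K - 1)) / 2"
    using lowD(6)[OF K] by (simp add: derange_2 ffall_2 of_nat_diff mult_ac)
  have "\<bar>P * Q / ((real N - k K) * (real N - k K - 1)) - (\<sigma> * \<tau> * (1 + 1 / real N) + k K * (\<sigma> + \<tau> - 2 * \<sigma> * \<tau>) / real N)\<bar>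
     \<le> 8 * (row_defect K * (\<tau> + 1) + (\<sigma> + 1) * col_defect K) / real N
       + 88 * ((\<sigma> + 1) * (\<tau> + 1)) * (k K + 1)\<^sup>2 / (real N)\<^sup>2"
    using N_large k sigma_tau line_defect_nonneg[OF K] P P2 Q Q0 Q2
    by (intro pair_term_expansion) auto
  from abs_diff_divide_le[OF this, of 2] show ?thesis
    unfolding f sigma_tau(3,4) x_def[symmetric] by (simp add: add_divide_distrib mult_ac)
qed

lemma full_rate_3_expansion:
  assumes K: "K \<in> low"
  shows "\<bar>full_rate 3 K - \<sigma> * (\<sigma> - 1) * (\<tau> * (\<tau> - 1)) / (3 * real N)\<bar> \<le> 81 * x\<^sup>2 * (k K + 1) / (real N)\<^sup>2"
proof -
  define P where "P = (\<Sum>i<m. ffall (s - row_sum n K i) 3)"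
  define Q where "Q = (\<Sum>j<n. ffall (t - col_sum m K j) 3)"
  define A where "A = real N * (\<sigma> * (\<sigma> - 1))"
  define B where "B = real N * (\<tau> * (\<tau> - 1))"
  have A: "(\<Sum>i<m. ffall s 3) = A" by (simp add: A_def \<sigma>_def ffall_3 N_rows)
  have B: "(\<Sum>j<n. ffall t 3) = B" by (simp add: B_def \<tau>_def ffall_3 N_cols)
  have P1: "P \<le> A" unfolding P_def A[symmetric] by (intro sum_mono ffall_mono) auto
  have Q1: "Q \<le> B" unfolding Q_def B[symmetric] by (intro sum_mono ffall_mono) auto
  have P0: "0 \<le> P" "0 \<le> Q" unfolding P_def Q_def by (intro sum_nonneg ffall_nonneg)+
  have P3: "A - 3 * (real s)\<^sup>2 * k K \<le> P"
  proof -
    have "(\<Sum>i<m. ffall s 3 - 3 * (real s)\<^sup>2 * real (row_sum n K i)) \<le> P"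
      unfolding P_def using lowD(3)[OF K] by (intro sum_mono ffall_3_diff) auto
    then show ?thesis using A by (simp add: sum_subtractf total_eq_rows flip: sum_distrib_left)
  qed
  have Q3: "B - 3 * (real t)\<^sup>2 * k K \<le> Q"
  proof -
    have "(\<Sum>j<n. ffall t 3 - 3 * (real t)\<^sup>2 * real (col_sum m K j)) \<le> Q"
      unfolding Q_def using lowD(4)[OF K] by (intro sum_mono ffall_3_diff) auto
    then show ?thesis using B by (simp add: sum_subtractf total_eq_cols flip: sum_distrib_left)
  qed
  have "\<sigma> * (\<sigma> - 1) \<le> (real s)\<^sup>2" "\<tau> * (\<tau> - 1) \<le> (real t)\<^sup>2"
    using s_pos t_pos by (auto simp: \<sigma>_def \<tau>_def power2_eq_square algebra_simps)
  then have A2: "A \<le> real N * (real s)\<^sup>2" "B \<le> real N * (real t)\<^sup>2"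
    unfolding A_def B_def by (auto intro: mult_left_mono)
  have k: "0 \<le> k K" "k K \<le> real N / 2" using lowD(6)[OF K] by linarith+
  have "full_rate 3 K = derange 3 * (P * Q) / ffall (N - total m n K) 3"
    unfolding full_rate_eq P_def Q_def ..
  then have f: "full_rate 3 K = P * Q / ((real N - k K) * (real N - k K - 1) * (real N - k K - 2)) / 3"
    using lowD(6)[OF K] by (simp add: derange_3 ffall_3 of_nat_diff mult_ac)
  have "\<bar>P * Q / ((real N - k K) * (real N - k K - 1) * (real N - k K - 2)) - A * B / real N ^ 3\<bar>
     \<le> 243 * (real s * real t)\<^sup>2 * (k K + 1) / (real N)\<^sup>2"
    using N_large k A2 P0 P1 P3 Q1 Q3 by (intro triple_term_expansion) auto
  moreover have "A * B / real N ^ 3 = \<sigma> * (\<sigma> - 1) * (\<tau> * (\<tau> - 1)) / real N"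
    unfolding A_def B_def using N_pos by (simp add: power3_eq_cube)
  ultimately have "\<bar>P * Q / ((real N - k K) * (real N - k K - 1) * (real N - k K - 2))
      - \<sigma> * (\<sigma> - 1) * (\<tau> * (\<tau> - 1)) / real N\<bar> \<le> 243 * x\<^sup>2 * (k K + 1) / (real N)\<^sup>2"
    by (simp only: x_def)
  from abs_diff_divide_le[OF this, of 3] show ?thesis
    unfolding f by (simp add: mult_ac)
qed

definition "linear_coeff = \<sigma> + \<tau> - 2 * \<sigma> * \<tau>"
definition "const_part = \<sigma> * \<tau> * (1 + 1 / real N) / 2 + \<sigma> * (\<sigma> - 1) * (\<tau> * (\<tau> - 1)) / (3 * real N)"

lemma sigma_tau_product_bounds: "0 \<le> \<sigma> * \<tau>" "\<sigma> * \<tau> \<le> x" "\<bar>linear_coeff\<bar> \<le> 2 * x"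
proof -
  show "0 \<le> \<sigma> * \<tau>" using sigma_tau by simp
  moreover have "x = \<sigma> * \<tau> + \<sigma> + \<tau> + 1" using sigma_tau(5) by (simp add: algebra_simps)
  ultimately show "\<sigma> * \<tau> \<le> x" "\<bar>linear_coeff\<bar> \<le> 2 * x"
    unfolding linear_coeff_def mult.assoc abs_le_iff using sigma_tau by argo+
qed

text \<open>The bounds for the values 2, for the values 3 and for everything else, written as a combination of
functions whose averages are known.\<close>

definition expansion_error :: "(nat \<times> nat \<Rightarrow> nat) \<Rightarrow> real" where
  "expansion_error K = 4 / real N * (real t * row_defect K + real s * col_defect K)
     + 44 * x / (real N)\<^sup>2 * ((k K)\<^sup>2 + 2 * k K + 1) + 81 * x\<^sup>2 / (real N)\<^sup>2 * (k K + 1)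
     + 18 * x\<^sup>2 / (real N)\<^sup>2 * k K + 288 * x / (real N)\<^sup>2 * (k K)\<^sup>2 + 512 * x ^ 3 / (real N)\<^sup>2"

lemma total_rate_expansion:
  assumes K: "K \<in> low"
  shows "\<bar>total_rate K - (const_part + linear_coeff / (2 * real N) * k K)\<bar> \<le> expansion_error K"
proof -
  define E2 where "E2 = 4 * (row_defect K * real t + real s * col_defect K) / real N + 44 * x * (k K + 1)\<^sup>2 / (real N)\<^sup>2"
  define E3 where "E3 = 81 * x\<^sup>2 * (k K + 1) / (real N)\<^sup>2"
  define E4 where "E4 = 18 * x\<^sup>2 * k K / (real N)\<^sup>2 + 288 * x * (k K)\<^sup>2 / (real N)\<^sup>2 + 512 * x ^ 3 / (real N)\<^sup>2"
  define T2 where "T2 = (\<sigma> * \<tau> * (1 + 1 / real N) + k K * (\<sigma> + \<tau> - 2 * \<sigma> * \<tau>) / real N) / 2"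
  define T3 where "T3 = \<sigma> * (\<sigma> - 1) * (\<tau> * (\<tau> - 1)) / (3 * real N)"
  have E: "E2 + E3 + E4 = expansion_error K"
    unfolding E2_def E3_def E4_def expansion_error_def
    by (simp add: power2_eq_square algebra_simps add_divide_distrib)
  have T: "const_part + linear_coeff / (2 * real N) * k K = T2 + T3"
    unfolding const_part_def linear_coeff_def T2_def T3_def by (simp add: add_divide_distrib mult.commute)
  show ?thesis
    unfolding T
    using full_rate_2_expansion[OF K, folded E2_def T2_def] full_rate_3_expansion[OF K, folded E3_def T3_def]
      total_rate_near_full[OF K, folded E4_def] E by linarith
qed

lemma avg_expansion_error_le:
  assumes "0 \<le> u" "u \<le> 1"
  shows "avg u expansion_error \<le> 400000 * x ^ 3 / (real N)\<^sup>2"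
proof -
  have k1: "avg u k \<le> 32 * x" and k2: "avg u (\<lambda>K. (k K)\<^sup>2) \<le> 1056 * x\<^sup>2"
    and r: "avg u row_defect \<le> 1168 * (real s * x\<^sup>2 / real N)"
    and c: "avg u col_defect \<le> 1168 * (real t * x\<^sup>2 / real N)"
    using assms by (rule avg_total_le avg_total_square_le avg_row_defect_le avg_col_defect_le)+
  have x1: "1 \<le> x" "x \<le> x\<^sup>2" "1 \<le> x\<^sup>2"
    using x_ge_1 by (auto simp: power2_eq_square intro: mult_left_mono[of 1 x x, simplified])
      (smt (verit) mult_le_cancel_left1)
  have "avg u expansion_error = 4 / real N * (real t * avg u row_defect + real s * avg u col_defect)
     + 44 * x / (real N)\<^sup>2 * (avg u (\<lambda>K. (k K)\<^sup>2) + 2 * avg u k + 1) + 81 * x\<^sup>2 / (real N)\<^sup>2 * (avg u k + 1)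
     + 18 * x\<^sup>2 / (real N)\<^sup>2 * avg u k + 288 * x / (real N)\<^sup>2 * avg u (\<lambda>K. (k K)\<^sup>2) + 512 * x ^ 3 / (real N)\<^sup>2"
    unfolding expansion_error_def avg_add avg_cmult avg_const[OF assms(1)] ..
  also have "\<dots> \<le> 4 / real N * (real t * (1168 * (real s * x\<^sup>2 / real N)) + real s * (1168 * (real t * x\<^sup>2 / real N)))
     + 44 * x / (real N)\<^sup>2 * (1056 * x\<^sup>2 + 2 * (32 * x\<^sup>2) + x\<^sup>2) + 81 * x\<^sup>2 / (real N)\<^sup>2 * (32 * x + x)
     + 18 * x\<^sup>2 / (real N)\<^sup>2 * (32 * x) + 288 * x / (real N)\<^sup>2 * (1056 * x\<^sup>2) + 512 * x ^ 3 / (real N)\<^sup>2"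
    using k1 k2 r c x1 by (intro add_mono mult_left_mono) auto
  also have "\<dots> = 366557 * (x ^ 3 / (real N)\<^sup>2)"
    unfolding x_def by (simp add: power2_eq_square power3_eq_cube field_simps)
  also have "\<dots> \<le> 400000 * (x ^ 3 / (real N)\<^sup>2)"
    using x_ge_1 by (intro mult_right_mono) auto
  finally show ?thesis by simp
qed

text \<open>By removal, the mean of \<open>|K|\<close> is \<open>u\<close> times twice the mean total rate, up to the contribution of
entries of at least 3; and the total rate is \<open>\<sigma> \<tau> / 2\<close> to leading order.\<close>

lemma avg_total_expansion:
  assumes "0 \<le> u" "u \<le> 1"
  shows "\<bar>avg u k - u * (\<sigma> * \<tau>)\<bar> \<le> 300 * x\<^sup>2 / real N"
proof -
  note u = assms
  let ?G = "gain (\<lambda>p a K. real a)" and ?H = "gain (\<lambda>p a K. real a - 2)"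
  have GH: "?G K = 2 * total_rate K + ?H K" for K
    unfolding gain_def total_rate_def by (simp add: sum_distrib_left algebra_simps flip: sum.distrib)
  have H: "0 \<le> ?H K" "?H K \<le> 144 * x\<^sup>2 / real N" if K: "K \<in> low" for K
  proof -
    show "0 \<le> ?H K"
      unfolding gain_def by (intro sum_nonneg mult_nonneg_nonneg rate_nonneg) auto
    have "?H K \<le> 8 * y\<^sup>2 * (\<Sum>p\<in>cells m n. 0) + 18 * (real m * real n) * y ^ 3 * 1"
    proof (intro gain_le K)
      fix a :: nat assume "2 \<le> a"
      then have "real a * 1 \<le> real a * real a" by (intro mult_left_mono) auto
      then have "real a - 2 \<le> (real a)\<^sup>2" by (simp add: power2_eq_square)
      then show "real a - 2 \<le> (real a)\<^sup>2 * (0 + (if 3 \<le> a then 1 else 0))"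
        using \<open>2 \<le> a\<close> by (cases "a = 2") auto
    qed auto
    also have "\<dots> = 18 * (real m * real n * y\<^sup>2) * y" by (simp add: power2_eq_square power3_eq_cube)
    also have "\<dots> = 144 * x\<^sup>2 / real N" unfolding cells_y2 by (simp add: y_def power2_eq_square)
    finally show "?H K \<le> 144 * x\<^sup>2 / real N" .
  qed
  define q where "q = x\<^sup>2 / real N"
  define a where "a = avg u k"
  have a: "0 \<le> a" "a \<le> 32 * x" unfolding a_def using u by (auto intro: avg_nonneg avg_total_le)
  have h: "0 \<le> avg u ?H" "avg u ?H \<le> 144 * q"
    using avg_mono[OF u(1), of "\<lambda>_. 0" ?H] avg_mono[OF u(1), of ?H "\<lambda>_. 144 * x\<^sup>2 / real N"] H
    by (auto simp: avg_const[OF u(1)] q_def)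
  have x2: "x \<le> x\<^sup>2" using x_ge_1 by (simp add: power2_eq_square)
  note st = sigma_tau_product_bounds
  have 1: "\<bar>avg u total_rate - (const_part + linear_coeff / (2 * real N) * a)\<bar> \<le> 14 * q"
  proof -
    have eq: "avg u total_rate - (const_part + linear_coeff / (2 * real N) * a)
        = avg u (\<lambda>K. total_rate K - (const_part + linear_coeff / (2 * real N) * k K))"
      unfolding a_def avg_diff avg_add avg_cmult avg_const[OF u(1)] ..
    have "\<bar>avg u total_rate - (const_part + linear_coeff / (2 * real N) * a)\<bar>
        \<le> avg u (\<lambda>K. \<bar>total_rate K - (const_part + linear_coeff / (2 * real N) * k K)\<bar>)"
      unfolding eq by (rule avg_abs_le[OF u(1)])
    also have "\<dots> \<le> avg u expansion_error" by (intro avg_mono u total_rate_expansion)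
    also have "\<dots> \<le> 400000 * x ^ 3 / (real N)\<^sup>2" by (rule avg_expansion_error_le[OF u])
    also have "\<dots> = 400000 * (x / real N) * q" by (simp add: q_def power2_eq_square power3_eq_cube)
    also have "\<dots> \<le> 14 * q"
      using N_ge N_pos by (intro mult_right_mono) (auto simp: q_def divide_le_eq)
    finally show ?thesis .
  qed
  have 2: "\<bar>linear_coeff / (2 * real N) * a\<bar> \<le> 32 * q"
  proof -
    have "\<bar>linear_coeff * a\<bar> \<le> (2 * x) * (32 * x)"
      unfolding abs_mult using st(3) a x_ge_1 by (intro mult_mono) auto
    then have "\<bar>linear_coeff * a\<bar> / (2 * real N) \<le> (2 * x) * (32 * x) / (2 * real N)"
      by (intro divide_right_mono) auto
    moreover have "\<bar>linear_coeff / (2 * real N) * a\<bar> = \<bar>linear_coeff * a\<bar> / (2 * real N)"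
      by (simp add: abs_mult)
    ultimately show ?thesis by (simp add: q_def power2_eq_square)
  qed
  have 3: "\<bar>const_part - \<sigma> * \<tau> / 2\<bar> \<le> q"
  proof -
    define v where "v = (\<sigma> * (\<sigma> - 1)) * (\<tau> * (\<tau> - 1)) / (3 * real N)"
    define w where "w = \<sigma> * \<tau> / real N"
    have "\<bar>\<sigma> * (\<sigma> - 1)\<bar> \<le> (real s)\<^sup>2" "\<bar>\<tau> * (\<tau> - 1)\<bar> \<le> (real t)\<^sup>2"
      using s_pos t_pos unfolding \<sigma>_def \<tau>_def power2_eq_square abs_mult by (auto intro!: mult_mono)
    then have "\<bar>(\<sigma> * (\<sigma> - 1)) * (\<tau> * (\<tau> - 1))\<bar> \<le> (real s)\<^sup>2 * (real t)\<^sup>2"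
      unfolding abs_mult[of "\<sigma> * (\<sigma> - 1)"] by (intro mult_mono) auto
    then have "\<bar>(\<sigma> * (\<sigma> - 1)) * (\<tau> * (\<tau> - 1)) / (3 * real N)\<bar> \<le> x\<^sup>2 / (3 * real N)"
      unfolding x_def by (simp add: power_mult_distrib divide_right_mono)
    also have "\<dots> = q / 3" by (simp add: q_def)
    finally have "\<bar>v\<bar> \<le> q / 3" unfolding v_def .
    moreover have "w \<le> q" unfolding q_def w_def using st x2 by (intro divide_right_mono) auto
    moreover have "0 \<le> w" using st by (simp add: w_def)
    moreover have "const_part - \<sigma> * \<tau> / 2 = w / 2 + v"
      unfolding const_part_def v_def w_def by (simp add: algebra_simps add_divide_distrib)
    moreover have "0 \<le> q" by (simp add: q_def)
    ultimately show ?thesis by linarith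
  qed
  have "a = u * avg u ?G"
  proof -
    have "a = avg u (\<lambda>K. \<Sum>p | p \<in> cells m n \<and> K p \<noteq> 0. real (K p))"
      unfolding a_def total_eq_occupied_sum by simp
    also have "\<dots> = u * avg u ?G" by (rule avg_removal)
    finally show ?thesis .
  qed
  also have "\<dots> = u * (2 * avg u total_rate + avg u ?H)" unfolding GH avg_add avg_cmult ..
  finally have eq: "a - u * (\<sigma> * \<tau>) = u * (2 * avg u total_rate + avg u ?H - \<sigma> * \<tau>)"
    by (simp add: algebra_simps)
  have "\<bar>a - u * (\<sigma> * \<tau>)\<bar> \<le> 1 * (300 * q)"
    unfolding eq abs_mult
  proof (intro mult_mono)
    have "0 \<le> q" by (simp add: q_def)
    then show "\<bar>2 * avg u total_rate + avg u ?H - \<sigma> * \<tau>\<bar> \<le> 300 * q" using 1 2 3 h by linarith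
  qed (use u in auto)
  then show ?thesis unfolding a_def q_def by simp
qed

text \<open>Substituting the leading order of the mean of \<open>|K|\<close> into the first-order expansion of the total rate.\<close>

lemma avg_total_rate_expansion:
  assumes "0 \<le> u" "u \<le> 1"
  shows "\<bar>avg u total_rate - (const_part + linear_coeff * (\<sigma> * \<tau>) / (2 * real N) * u)\<bar> \<le> 500000 * (x ^ 3 / (real N)\<^sup>2)"
proof -
  note u = assms
  let ?c = "linear_coeff / (2 * real N)"
  have eq: "avg u total_rate - (const_part + ?c * avg u k) = avg u (\<lambda>K. total_rate K - (const_part + ?c * k K))"
    unfolding avg_diff avg_add avg_cmult avg_const[OF u(1)] ..
  have "\<bar>avg u total_rate - (const_part + ?c * avg u k)\<bar> \<le> avg u (\<lambda>K. \<bar>total_rate K - (const_part + ?c * k K)\<bar>)"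
    unfolding eq by (rule avg_abs_le[OF u(1)])
  also have "\<dots> \<le> avg u expansion_error" by (intro avg_mono u total_rate_expansion)
  also have "\<dots> \<le> 400000 * (x ^ 3 / (real N)\<^sup>2)" using avg_expansion_error_le[OF u] by simp
  finally have 1: "\<bar>avg u total_rate - (const_part + ?c * avg u k)\<bar> \<le> 400000 * (x ^ 3 / (real N)\<^sup>2)" .
  note sigma_tau_product_bounds(3)
  then have "\<bar>?c\<bar> \<le> x / real N" using N_pos by (simp add: abs_div field_simps)
  then have "\<bar>?c * (avg u k - u * (\<sigma> * \<tau>))\<bar> \<le> (x / real N) * (300 * x\<^sup>2 / real N)"
    unfolding abs_mult using avg_total_expansion[OF u] x_ge_1 by (intro mult_mono) auto
  also have "\<dots> = 300 * (x ^ 3 / (real N)\<^sup>2)" by (simp add: power2_eq_square power3_eq_cube)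
  finally have 2: "\<bar>?c * avg u k - ?c * (u * (\<sigma> * \<tau>))\<bar> \<le> 300 * (x ^ 3 / (real N)\<^sup>2)"
    by (simp add: right_diff_distrib)
  have "?c * (u * (\<sigma> * \<tau>)) = linear_coeff * (\<sigma> * \<tau>) / (2 * real N) * u" by simp
  moreover have "0 \<le> x ^ 3 / (real N)\<^sup>2" using x_ge_1 by simp
  ultimately show ?thesis using 1 2 by linarith
qed

section \<open>The logarithm of the truncated partition function\<close>

text \<open>The removal identity for the constant function 1, whose sum over the occupied cells is the exponent
of \<open>u\<close>.\<close>

lemma Z_deriv: "(Z has_real_derivative (\<Sum>K\<in>low. tilted_weight u K * total_rate K)) (at u)"
proof -
  have "((\<lambda>u. \<Sum>K\<in>low. tilted_weight u K) has_real_derivative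
     (\<Sum>K\<in>low. real (occupied m n K) * u ^ (occupied m n K - 1) * weight m s n t K)) (at u)"
    unfolding tilted_weight_def by (auto intro!: derivative_eq_intros sum.cong)
  also have "(\<Sum>K\<in>low. real (occupied m n K) * u ^ (occupied m n K - 1) * weight m s n t K)
     = (\<Sum>K\<in>low. u ^ (occupied m n K - 1) * weight m s n t K * (\<Sum>p | p \<in> cells m n \<and> K p \<noteq> 0. 1))"
    by (intro sum.cong refl) (simp add: occupied_def)
  also have "\<dots> = (\<Sum>K\<in>low. tilted_weight u K * total_rate K)" unfolding total_rate_def by (rule low_removal)
  finally show ?thesis unfolding Z_def[abs_def] .
qed

lemma Z_0: "Z 0 = fact N / (fact s ^ m * fact t ^ n)"
proof -
  have "Z 0 = (\<Sum>K\<in>{empty_state}. tilted_weight 0 K)"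
    unfolding Z_def
  proof (intro sum.mono_neutral_right finite_low ballI)
    show "{empty_state} \<subseteq> low" using empty_state_low by (auto simp: low_def)
    fix K assume K: "K \<in> low - {empty_state}"
    have "occupied m n K \<noteq> 0"
    proof
      assume "occupied m n K = 0"
      then have "\<And>p. p \<in> cells m n \<Longrightarrow> K p = 0"
        unfolding occupied_def by (subst (asm) card_eq_0_iff) auto
      moreover have "K \<in> extensional (cells m n)" using lowD(1)[of K] K by (auto simp: PiE_def)
      ultimately have "K = empty_state"
        unfolding empty_state_def by (intro extensionalityI[of K "cells m n"]) auto
      then show False using K by simp
    qed
    then show "tilted_weight 0 K = 0" by (simp add: tilted_weight_def)
  qed
  moreover have "occupied m n empty_state = 0"
    using occupied_le_total[of m n empty_state] total_empty_state by simp
  ultimately show ?thesis by (simp add: tilted_weight_def weight_empty_state)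
qed

text \<open>Integration of the mean total rate over \<open>u\<close>; the slope in \<open>u\<close> is halved.\<close>

lemma ln_Z_expansion:
  "\<bar>ln (Z 1) - ln (Z 0) - (const_part + linear_coeff * (\<sigma> * \<tau>) / (4 * real N))\<bar>
     \<le> 500000 * (x ^ 3 / (real N)\<^sup>2)"
proof -
  define c where "c = linear_coeff * (\<sigma> * \<tau>) / (2 * real N)"
  define h where "h u = ln (Z u) - const_part * u - c * u\<^sup>2 / 2" for u
  have "(h has_real_derivative (avg u total_rate - (const_part + c * u))) (at u)" if "0 \<le> u" for u
  proof -
    have "(h has_real_derivative ((\<Sum>K\<in>low. tilted_weight u K * total_rate K) / Z u - const_part - c * u)) (at u)"
      unfolding h_def[abs_def] using Z_pos[OF that]
      by (auto intro!: derivative_eq_intros Z_deriv simp: field_simps)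
    then show ?thesis by (simp add: avg_def algebra_simps)
  qed
  then obtain z where z: "0 < z" "z < 1" "h 1 - h 0 = (1 - 0) * (avg z total_rate - (const_part + c * z))"
    using MVT2[of 0 1 h "\<lambda>u. avg u total_rate - (const_part + c * u)"] by auto
  have "\<bar>h 1 - h 0\<bar> \<le> 500000 * (x ^ 3 / (real N)\<^sup>2)"
    unfolding z(3) c_def using avg_total_rate_expansion[of z] z by simp
  moreover have "h 1 - h 0 = ln (Z 1) - ln (Z 0) - (const_part + c / 2)"
    by (simp add: h_def)
  moreover have "c / 2 = linear_coeff * (\<sigma> * \<tau>) / (4 * real N)" by (simp add: c_def)
  ultimately show ?thesis by simp
qed

section \<open>States of large total are negligible\<close>

lemma inverse_fact_deficit_le: "f \<le> s' \<Longrightarrow> s' \<noteq> 0 \<Longrightarrow> 1 / fact (s' - f) \<le> real s' ^ f / fact s'"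
proof -
  assume f: "f \<le> s'" "s' \<noteq> 0"
  have "(fact s' :: real) \<le> real s' ^ f * fact (s' - f)"
    unfolding fact_eq_ffall[OF f(1)] by (intro mult_right_mono ffall_le_power) auto
  then show ?thesis by (simp add: field_simps)
qed

definition empty_weight :: real where "empty_weight = fact N / (fact s ^ m * fact t ^ n)"

definition z :: real where "z = sqrt (x / real N)"

lemma z_bounds: "0 < z" "6 * z \<le> 1 / 27" "z\<^sup>2 = x / real N"
proof -
  have q: "0 < x / real N" using x_ge_1 N_pos by simp
  then show "0 < z" "z\<^sup>2 = x / real N" by (simp_all add: z_def)
  have "x / real N \<le> (1 / 162)\<^sup>2"
    using N_ge N_pos x_ge_1 by (simp add: divide_le_eq power2_eq_square)
  then have "z \<le> 1 / 162" unfolding z_def by (intro real_le_lsqrt) (use q in auto)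
  then show "6 * z \<le> 1 / 27" by simp
qed

text \<open>With \<open>z\<^sup>2 = s t / N\<close>, a state of total \<open>k\<close> has relative weight at most \<open>(6 z\<^sup>2)\<^sup>k\<close> times its derangement
factors.  One factor \<open>z\<^sup>k\<close> is kept to make the sum over all states a product over the cells; the other,
\<open>(6 z)\<^sup>k\<close>, is exponentially small in \<open>N\<close>.\<close>

lemma weight_le_tail:
  assumes K: "K \<in> states m s n t N" and tail: "N < 2 * total m n K"
  shows "weight m s n t K \<le> empty_weight * exp (- (3 / 2) * real N) * (\<Prod>p\<in>cells m n. derange (K p) * z ^ K p)"
proof -
  let ?k = "total m n K"
  have kN: "?k \<le> N" using K by (auto simp: states_def)
  define d where "d = (\<Prod>p\<in>cells m n. derange (K p))"
  have d: "0 \<le> d" unfolding d_def by (intro prod_nonneg derange_nonneg ballI)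
  have R: "(\<Prod>i<m. 1 / fact (s - row_sum n K i)) \<le> real s ^ ?k / fact s ^ m"
  proof -
    have "(\<Prod>i<m. 1 / fact (s - row_sum n K i)) \<le> (\<Prod>i<m. real s ^ row_sum n K i / fact s)"
      using K s_pos by (intro prod_mono) (auto simp: states_def intro!: inverse_fact_deficit_le)
    then show ?thesis by (simp add: prod_dividef power_sum total_eq_rows)
  qed
  have C: "(\<Prod>j<n. 1 / fact (t - col_sum m K j)) \<le> real t ^ ?k / fact t ^ n"
  proof -
    have "(\<Prod>j<n. 1 / fact (t - col_sum m K j)) \<le> (\<Prod>j<n. real t ^ col_sum m K j / fact t)"
      using K t_pos by (intro prod_mono) (auto simp: states_def intro!: inverse_fact_deficit_le)
    then show ?thesis by (simp add: prod_dividef power_sum total_eq_cols)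
  qed
  have ff: "(real N / 6) ^ ?k \<le> ffall N ?k"
  proof -
    have "(real N / 6) ^ ?k \<le> (real ?k / 3) ^ ?k" using tail by (intro power_mono) auto
    also have "\<dots> \<le> fact ?k" by (rule fact_ge_power_div_3)
    also have "\<dots> = ffall ?k ?k" using fact_eq_ffall[of ?k ?k] by simp
    also have "\<dots> \<le> ffall N ?k" by (rule ffall_mono[OF kN])
    finally show ?thesis .
  qed
  have f: "(fact (N - ?k) :: real) \<le> fact N / (real N / 6) ^ ?k"
  proof -
    have "(real N / 6) ^ ?k * fact (N - ?k) \<le> (fact N :: real)"
      unfolding fact_eq_ffall[OF kN] using ff by (intro mult_right_mono) auto
    then show ?thesis using N_pos by (simp add: le_divide_eq mult.commute)
  qed
  have "weight m s n t K = d * (fact (N - ?k) *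
     ((\<Prod>i<m. 1 / fact (s - row_sum n K i)) * (\<Prod>j<n. 1 / fact (t - col_sum m K j))))"
    by (simp add: weight_def N_def d_def prod_dividef)
  also have "\<dots> \<le> d * ((fact N / (real N / 6) ^ ?k) * ((real s ^ ?k / fact s ^ m) * (real t ^ ?k / fact t ^ n)))"
    using d f R C N_pos by (intro mult_left_mono mult_mono mult_nonneg_nonneg prod_nonneg) auto
  also have "\<dots> = d * empty_weight * (6 * z\<^sup>2) ^ ?k"
    unfolding z_bounds(3) empty_weight_def x_def by (simp add: power_mult_distrib power_divide mult_ac)
  also have "6 * z\<^sup>2 = 6 * z * z" by (simp add: power2_eq_square)
  also have "(6 * z * z) ^ ?k = (6 * z) ^ ?k * z ^ ?k" by (rule power_mult_distrib)
  also have "d * empty_weight * ((6 * z) ^ ?k * z ^ ?k) \<le> d * empty_weight * (exp (- (3 / 2) * real N) * z ^ ?k)"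
  proof (intro mult_left_mono mult_right_mono)
    have "6 * z \<le> exp (- 3)"
    proof -
      have "exp 3 = exp (1::real) ^ 3" by (simp flip: exp_of_nat_mult)
      also have "\<dots> \<le> 3 ^ 3" using exp_le by (intro power_mono) auto
      finally have "1 / 27 \<le> 1 / exp (3::real)" by (intro divide_left_mono) auto
      moreover have "exp (- 3) = 1 / exp (3::real)" by (simp add: exp_minus inverse_eq_divide)
      ultimately show ?thesis using z_bounds(2) by linarith
    qed
    then have "(6 * z) ^ ?k \<le> exp (- 3) ^ ?k" using z_bounds by (intro power_mono) auto
    also have "\<dots> = exp (real ?k * - 3)" by (rule exp_of_nat_mult[symmetric])
    also have "\<dots> \<le> exp (- (3 / 2) * real N)" using tail by simp
    finally show "(6 * z) ^ ?k \<le> exp (- (3 / 2) * real N)" .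
  qed (use d z_bounds in \<open>auto simp: empty_weight_def\<close>)
  also have "\<dots> = empty_weight * exp (- (3 / 2) * real N) * (d * z ^ ?k)" by simp
  also have "d * z ^ ?k = (\<Prod>p\<in>cells m n. derange (K p) * z ^ K p)"
    by (simp add: d_def prod.distrib power_sum total_def)
  finally show ?thesis .
qed

lemma sum_derange_power_le: "(\<Sum>a\<le>M. derange a * z ^ a) \<le> exp (11 / 10 * z\<^sup>2)"
proof -
  have z: "0 < z" "z \<le> 1 / 162" using z_bounds by auto
  have "(\<Sum>a\<le>M. derange a * z ^ a) \<le> (\<Sum>a\<le>Suc M. derange a * z ^ a)"
    using z by (simp add: derange_nonneg)
  also have "\<dots> = 1 + (\<Sum>a=2..Suc M. derange a * z ^ a)"
  proof -
    have "{..Suc M} = insert 0 (insert 1 {2..Suc M})" by auto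
    then show ?thesis by simp
  qed
  also have "(\<Sum>a=2..Suc M. derange a * z ^ a) \<le> (\<Sum>a=2..Suc M. z ^ a)"
    using z mult_right_mono[OF derange_le_1] by (intro sum_mono) fastforce
  also have "(\<Sum>a=2..Suc M. z ^ a) \<le> 11 / 10 * z\<^sup>2"
  proof (cases "M = 0")
    case False
    then have "(1 - z) * (\<Sum>a=2..Suc M. z ^ a) = z\<^sup>2 - z ^ Suc (Suc M)"
      by (intro sum_gp_multiplied) auto
    also have "\<dots> \<le> z\<^sup>2" using z by simp
    finally have "(\<Sum>a=2..Suc M. z ^ a) \<le> z\<^sup>2 / (1 - z)"
      using z by (simp add: le_divide_eq mult.commute)
    also have "\<dots> \<le> z\<^sup>2 / (10 / 11)" using z by (intro divide_left_mono) auto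
    finally show ?thesis by simp
  qed simp
  also have "1 + 11 / 10 * z\<^sup>2 \<le> exp (11 / 10 * z\<^sup>2)" by (rule exp_ge_add_one_self)
  finally show ?thesis by simp
qed

text \<open>The product over the \<open>m n\<close> cells is at most \<open>exp (11/10 N)\<close>, since \<open>m n z\<^sup>2 = N\<close>, and the
factor \<open>exp (- 3/2 N)\<close> beats it.\<close>

lemma tail_le:
  "(\<Sum>K | K \<in> states m s n t N \<and> N div 2 < total m n K. weight m s n t K) \<le> empty_weight * (13 / (real N)\<^sup>2)"
proof -
  define A where "A = {K. K \<in> states m s n t N \<and> N div 2 < total m n K}"
  define g where "g K = (\<Prod>p\<in>cells m n. derange (K p) * z ^ K p)" for K
  have g0: "0 \<le> g K" for K
    unfolding g_def using z_bounds by (intro prod_nonneg mult_nonneg_nonneg derange_nonneg ballI) auto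
  have sub: "A \<subseteq> cells m n \<rightarrow>\<^sub>E {..N}"
  proof
    fix K assume "K \<in> A"
    then have K: "K \<in> states m s n t N" by (simp add: A_def)
    have "K p \<le> N" if "p \<in> cells m n" for p
    proof -
      have "K p \<le> total m n K" unfolding total_def using that by (intro member_le_sum) auto
      then show ?thesis using K by (auto simp: states_def)
    qed
    then show "K \<in> cells m n \<rightarrow>\<^sub>E {..N}" using K by (auto simp: states_def PiE_def)
  qed
  have "sum g A \<le> sum g (cells m n \<rightarrow>\<^sub>E {..N})"
    using sub g0 by (intro sum_mono2 finite_PiE) auto
  also have "\<dots> = (\<Prod>p\<in>cells m n. \<Sum>a\<le>N. derange a * z ^ a)"
    unfolding g_def by (intro prod_sum_PiE[symmetric]) auto
  also have "\<dots> \<le> (\<Prod>p\<in>cells m n. exp (11 / 10 * z\<^sup>2))"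
    using z_bounds by (intro prod_mono conjI sum_derange_power_le sum_nonneg mult_nonneg_nonneg derange_nonneg) auto
  also have "\<dots> = exp (real (m * n) * (11 / 10 * z\<^sup>2))"
    by (subst exp_of_nat_mult) simp
  also have "real (m * n) * (11 / 10 * z\<^sup>2) = 11 / 10 * (real m * real n * x / real N)"
    unfolding z_bounds(3) by simp
  also have "\<dots> = 11 / 10 * real N" unfolding cells_x using N_pos by (simp add: power2_eq_square)
  finally have G: "sum g A \<le> exp (11 / 10 * real N)" .
  have "sum (weight m s n t) A \<le> (\<Sum>K\<in>A. empty_weight * exp (- (3 / 2) * real N) * g K)"
    unfolding g_def by (intro sum_mono weight_le_tail) (auto simp: A_def)
  also have "\<dots> = empty_weight * exp (- (3 / 2) * real N) * sum g A" by (simp add: sum_distrib_left)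
  also have "\<dots> \<le> empty_weight * exp (- (3 / 2) * real N) * exp (11 / 10 * real N)"
    using G by (intro mult_left_mono) (auto simp: empty_weight_def)
  also have "\<dots> = empty_weight * exp (- (2 / 5 * real N))"
    by (simp add: mult.assoc flip: exp_add)
  also have "\<dots> \<le> empty_weight * (13 / (real N)\<^sup>2)"
  proof (intro mult_left_mono)
    have "1 + 2 / 5 * real N + (2 / 5 * real N)\<^sup>2 / 2 \<le> exp (2 / 5 * real N)"
      by (rule exp_lower_Taylor_quadratic) simp
    moreover have "(2 / 5 * real N)\<^sup>2 / 2 = 2 / 25 * (real N)\<^sup>2" by (simp add: power2_eq_square)
    ultimately have e: "2 / 25 * (real N)\<^sup>2 \<le> exp (2 / 5 * real N)" by simp
    have "exp (- (2 / 5 * real N)) = 1 / exp (2 / 5 * real N)" by (simp add: exp_minus inverse_eq_divide)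
    also have "\<dots> \<le> 1 / (2 / 25 * (real N)\<^sup>2)" using e N_pos by (intro divide_left_mono) auto
    also have "\<dots> = (25 / 2) / (real N)\<^sup>2" by simp
    also have "\<dots> \<le> 13 / (real N)\<^sup>2" by (intro divide_right_mono) auto
    finally show "exp (- (2 / 5 * real N)) \<le> 13 / (real N)\<^sup>2" .
  qed (simp add: empty_weight_def)
  finally show ?thesis unfolding A_def .
qed

lemma ln_M_count_expansion:
  "\<bar>ln (real (M_count m s n t)) - ln empty_weight - (const_part + linear_coeff * (\<sigma> * \<tau>) / (4 * real N))\<bar>
     \<le> 600000 * (x ^ 3 / (real N)\<^sup>2)"
proof -
  define T where "T = (\<Sum>K | K \<in> states m s n t N \<and> N div 2 < total m n K. weight m s n t K)"
  have M: "real (M_count m s n t) = Z 1 + T"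
  proof -
    have "states m s n t N = low \<union> {K. K \<in> states m s n t N \<and> N div 2 < total m n K}"
      unfolding low_def states_def by auto
    then have "real (M_count m s n t)
        = sum (weight m s n t) (low \<union> {K. K \<in> states m s n t N \<and> N div 2 < total m n K})"
      using M_count_eq_sum_weight[OF margins] by (simp add: N_def)
    also have "\<dots> = sum (weight m s n t) low + T"
      unfolding T_def by (intro sum.union_disjoint finite_low) (auto simp: finite_states, auto simp: low_def states_def)
    finally show ?thesis by (simp add: Z_def tilted_weight_def)
  qed
  have T0: "0 \<le> T" unfolding T_def by (intro sum_nonneg weight_nonneg)
  have empty_weight: "empty_weight = Z 0" "empty_weight \<le> Z 1" "0 < Z 1" using Z_0 Z_ge[of 1] Z_pos[of 1] by (simp_all add: empty_weight_def)
  have "T \<le> Z 1 * (13 / (real N)\<^sup>2)"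
    by (rule order_trans[OF tail_le[folded T_def]]) (use empty_weight in \<open>auto intro!: divide_right_mono\<close>)
  then have "T / Z 1 \<le> 13 / (real N)\<^sup>2" using empty_weight by (simp add: divide_le_eq mult.commute)
  also have "\<dots> \<le> 13 * x ^ 3 / (real N)\<^sup>2"
    using x_ge_1 one_le_power[of x 3] by (intro divide_right_mono) auto
  finally have T1: "T / Z 1 \<le> 13 * (x ^ 3 / (real N)\<^sup>2)" by simp
  have "ln (Z 1 + T) = ln (Z 1) + ln (1 + T / Z 1)"
  proof -
    have "Z 1 + T = Z 1 * (1 + T / Z 1)" using empty_weight by (simp add: field_simps)
    moreover have "0 < 1 + T / Z 1" using empty_weight T0 by (intro add_pos_nonneg) auto
    ultimately show ?thesis using empty_weight by (simp add: ln_mult)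
  qed
  moreover have "0 \<le> ln (1 + T / Z 1)" using T0 empty_weight by simp
  moreover have "ln (1 + T / Z 1) \<le> T / Z 1" using T0 empty_weight by (intro ln_add_one_self_le_self) auto
  moreover have "0 \<le> x ^ 3 / (real N)\<^sup>2" using x_ge_1 by simp
  ultimately show ?thesis using ln_Z_expansion T1 unfolding M empty_weight(1) by linarith
qed

section \<open>Comparison with the defining formula\<close>

lemma mn_pos: "m > 0" "n > 0"
  using N_pos N_rows N_cols by (auto intro!: gr0I)

lemma row_ln_sum:
  "\<bar>real m * (\<Sum>i<s. ln (1 + real i * (1 / real n)))
     - (real t * \<sigma> / 2 - (real t)\<^sup>2 * \<sigma> * (2 * real s - 1) / (12 * real N))\<bar> \<le> x ^ 3 / (real N)\<^sup>2"
proof -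
  define L where "L = (\<Sum>i<s. ln (1 + real i * (1 / real n)))"
  define c where "c = 1 / real n"
  define E where "E = c * (real s * (real s - 1)) / 2 - c\<^sup>2 * ((real s - 1) * real s * (2 * real s - 1)) / 12"
  have c: "c = real t / real N" using t_pos by (simp add: c_def N_cols)
  have m: "real m = real N / real s" using s_pos by (simp add: N_rows)
  have "\<bar>L - E\<bar> \<le> c ^ 3 * real s ^ 4 / 3"
    unfolding L_def E_def c_def by (rule sum_ln_expansion) simp
  then have "real m * \<bar>L - E\<bar> \<le> real m * (c ^ 3 * real s ^ 4 / 3)" by (intro mult_left_mono) auto
  also have "real m * (c ^ 3 * real s ^ 4 / 3) = (x ^ 3 / (real N)\<^sup>2) / 3"
    unfolding m c x_def using s_pos N_pos
    by (simp add: field_simps power2_eq_square power3_eq_cube power4_eq_xxxx)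
  also have "\<dots> \<le> x ^ 3 / (real N)\<^sup>2"
  proof -
    have third: "q / 3 \<le> q" if "0 \<le> q" for q :: real using that by simp
    show ?thesis by (rule third) (use x_ge_1 in simp)
  qed
  also have "real m * \<bar>L - E\<bar> = \<bar>real m * L - real m * E\<bar>"
    by (simp add: abs_mult flip: right_diff_distrib)
  also have "real m * E = real t * \<sigma> / 2 - (real t)\<^sup>2 * \<sigma> * (2 * real s - 1) / (12 * real N)"
    unfolding m c E_def \<sigma>_def using s_pos N_pos by (simp add: field_simps power2_eq_square)
  finally show ?thesis unfolding L_def .
qed

text \<open>Transposition exchanges rows and columns, so each estimate for rows gives one for columns.\<close>

lemma transposed: "sparse_margins n t m s"
  using s_pos t_pos margins sparse by unfold_locales (auto simp: mult.commute)

lemma col_ln_sum: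
  "\<bar>real n * (\<Sum>i<t. ln (1 + real i * (1 / real m)))
     - (real s * \<tau> / 2 - (real s)\<^sup>2 * \<tau> * (2 * real t - 1) / (12 * real N))\<bar> \<le> x ^ 3 / (real N)\<^sup>2"
  using sparse_margins.row_ln_sum[OF transposed] margins
  by (simp add: sparse_margins.\<sigma>_def[OF transposed] sparse_margins.x_def[OF transposed]
      sparse_margins.N_def[OF transposed] \<tau>_def x_def N_def mult.commute)

lemma total_ln_sum:
  "\<bar>(\<Sum>i<N. ln (1 + real i * (1 / real (m * n)))) - (x / 2 - x / (2 * real N) - x\<^sup>2 / (6 * real N))\<bar>
     \<le> 2 * (x ^ 3 / (real N)\<^sup>2)"
proof -
  define L where "L = (\<Sum>i<N. ln (1 + real i * (1 / real (m * n))))"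
  define c where "c = 1 / real (m * n)"
  define E where "E = c * (real N * (real N - 1)) / 2 - c\<^sup>2 * ((real N - 1) * real N * (2 * real N - 1)) / 12"
  define e where "e = x ^ 3 / (real N)\<^sup>2"
  have c: "c = x / (real N)\<^sup>2" unfolding c_def cells_x[symmetric] using mn_pos x_ge_1 by simp
  have "\<bar>L - E\<bar> \<le> c ^ 3 * real N ^ 4 / 3"
    unfolding L_def E_def c_def by (rule sum_ln_expansion) simp
  also have "c ^ 3 * real N ^ 4 / 3 = e / 3"
    unfolding c e_def using N_pos by (simp add: field_simps power2_eq_square power3_eq_cube power4_eq_xxxx)
  finally have 1: "\<bar>L - E\<bar> \<le> e / 3" .
  have 2: "E - (x / 2 - x / (2 * real N) - x\<^sup>2 / (6 * real N)) = x\<^sup>2 * (3 * real N - 1) / (12 * real N ^ 3)"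
    unfolding c E_def using N_pos by (simp add: field_simps power2_eq_square power3_eq_cube)
  have 3: "0 \<le> x\<^sup>2 * (3 * real N - 1) / (12 * real N ^ 3)" using N_large by simp
  have "x\<^sup>2 * (3 * real N - 1) / (12 * real N ^ 3) \<le> x\<^sup>2 * (12 * real N) / (12 * real N ^ 3)"
    using N_pos by (intro divide_right_mono mult_left_mono) auto
  also have "\<dots> = x\<^sup>2 / (real N)\<^sup>2" using N_pos by (simp add: power2_eq_square power3_eq_cube)
  also have "\<dots> \<le> e" unfolding e_def using x_ge_1 by (intro divide_right_mono power_increasing) auto
  finally have 4: "x\<^sup>2 * (3 * real N - 1) / (12 * real N ^ 3) \<le> e" .
  show ?thesis using 1 2 3 4 unfolding L_def[symmetric] e_def[symmetric] by linarith
qed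

lemma factor_m:
  "\<bar>(real m - 1) / 2 * ln ((real m + 1) / real m) - (1 / 2 - 3 * real s / (4 * real N))\<bar> \<le> x ^ 3 / (real N)\<^sup>2"
proof -
  have m: "1 / real m = real s / real N" using s_pos by (simp add: N_rows)
  have "real s \<le> x" unfolding x_def using t_pos mult_left_mono[of 1 "real t" "real s"] by simp
  then have "(real s)\<^sup>2 \<le> x\<^sup>2" by (intro power_mono) auto
  also have "\<dots> \<le> x ^ 3" using x_ge_1 by (intro power_increasing) auto
  finally have "(real s)\<^sup>2 / (real N)\<^sup>2 \<le> x ^ 3 / (real N)\<^sup>2" by (intro divide_right_mono) auto
  moreover have "1 / (real m)\<^sup>2 = (real s)\<^sup>2 / (real N)\<^sup>2" using m by (metis power_one_over power_divide)
  moreover have "3 / (4 * real m) = 3 * real s / (4 * real N)" using m by (simp add: field_simps)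
  ultimately show ?thesis using half_power_factor_expansion[OF mn_pos(1)] by simp
qed

lemma factor_n:
  "\<bar>(real n - 1) / 2 * ln ((real n + 1) / real n) - (1 / 2 - 3 * real t / (4 * real N))\<bar> \<le> x ^ 3 / (real N)\<^sup>2"
  using sparse_margins.factor_m[OF transposed] margins
  by (simp add: sparse_margins.x_def[OF transposed] sparse_margins.N_def[OF transposed] x_def N_def mult.commute)

text \<open>The error is the sum of the errors of the logarithm of \<open>M_count\<close> and of the five terms of the
formula.\<close>

theorem Delta_expansion:
  "\<bar>Delta m s n t / (real m + real n) - 5 / (6 * real N)\<bar> \<le> 700000 * (x ^ 3 / (real N)\<^sup>2)"
proof -
  define e where "e = x ^ 3 / (real N)\<^sup>2"
  define D where "D = Delta m s n t / (real m + real n)"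
  define L1 where "L1 = real m * (\<Sum>i<s. ln (1 + real i * (1 / real n)))"
  define L2 where "L2 = real n * (\<Sum>i<t. ln (1 + real i * (1 / real m)))"
  define L3 where "L3 = (\<Sum>i<N. ln (1 + real i * (1 / real (m * n))))"
  define H1 where "H1 = (real m - 1) / 2 * ln ((real m + 1) / real m)"
  define H2 where "H2 = (real n - 1) / 2 * ln ((real n + 1) / real n)"
  define W where "W = const_part + linear_coeff * (\<sigma> * \<tau>) / (4 * real N)"
  define l1 where "l1 = real t * \<sigma> / 2 - (real t)\<^sup>2 * \<sigma> * (2 * real s - 1) / (12 * real N)"
  define l2 where "l2 = real s * \<tau> / 2 - (real s)\<^sup>2 * \<tau> * (2 * real t - 1) / (12 * real N)"
  define l3 where "l3 = x / 2 - x / (2 * real N) - x\<^sup>2 / (6 * real N)"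
  define h1 where "h1 = 1 / 2 - 3 * real s / (4 * real N)"
  define h2 where "h2 = 1 / 2 - 3 * real t / (4 * real N)"
  have eq: "ln (real (M_count m s n t)) = ln empty_weight + L1 + L2 - L3 + H1 + H2 - 1 / 2 + D"
    using ln_M_formula[OF mn_pos margins s_pos, of "Delta m s n t"] Delta_eq[OF mn_pos margins]
    by (simp add: empty_weight_def L1_def L2_def L3_def H1_def H2_def D_def N_def)
  have b0: "\<bar>ln (real (M_count m s n t)) - ln empty_weight - W\<bar> \<le> 600000 * e"
    unfolding W_def e_def by (rule ln_M_count_expansion)
  have b1: "\<bar>L1 - l1\<bar> \<le> e" unfolding L1_def l1_def e_def by (rule row_ln_sum)
  have b2: "\<bar>L2 - l2\<bar> \<le> e" unfolding L2_def l2_def e_def by (rule col_ln_sum)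
  have b3: "\<bar>L3 - l3\<bar> \<le> 2 * e" unfolding L3_def l3_def e_def by (rule total_ln_sum)
  have b4: "\<bar>H1 - h1\<bar> \<le> e" unfolding H1_def h1_def e_def by (rule factor_m)
  have b5: "\<bar>H2 - h2\<bar> \<le> e" unfolding H2_def h2_def e_def by (rule factor_n)
  have main: "W - l1 - l2 + l3 - h1 - h2 + 1 / 2 = 5 / (6 * real N)"
  proof -
    define v where "v = 1 / real N"
    have v: "a / (c * real N) = a * v / c" "a / real N = a * v" for a c by (simp_all add: v_def)
    show ?thesis
      unfolding W_def l1_def l2_def l3_def h1_def h2_def const_part_def linear_coeff_def \<sigma>_def \<tau>_def x_def v
      by (rule trans[OF leading_coefficient_identity]) simp
  qed
  note lower = b0[THEN abs_le_D1] b1[THEN abs_le_D1] b2[THEN abs_le_D1] b3[THEN abs_le_D1]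
    b4[THEN abs_le_D1] b5[THEN abs_le_D1]
  note upper = b0[THEN abs_le_D2] b1[THEN abs_le_D2] b2[THEN abs_le_D2] b3[THEN abs_le_D2]
    b4[THEN abs_le_D2] b5[THEN abs_le_D2]
  have "0 \<le> e" unfolding e_def using x_ge_1 by simp
  then have "\<bar>D - 5 / (6 * real N)\<bar> \<le> 700000 * e"
    using eq main lower upper by (intro abs_leI) linarith+
  then show ?thesis unfolding D_def e_def .
qed

theorem Delta_relative_error:
  "\<bar>Delta m s n t / (5 * (real s + real t) / (6 * real s * real t)) - 1\<bar> \<le> 840000 * (x ^ 3 / real N)"
proof -
  define D where "D = Delta m s n t / (real m + real n)"
  define b where "b = 5 / (6 * real N)"
  have mn: "0 < real m + real n" using mn_pos by simp
  have b: "0 < b" using N_pos by (simp add: b_def)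
  have "real m = real N / real s" using s_pos by (simp add: N_rows)
  moreover have "real n = real N / real t" using t_pos by (simp add: N_cols)
  ultimately have "real m + real n = real N * (real s + real t) / (real s * real t)"
    using s_pos t_pos by (simp add: field_simps)
  then have denominator: "5 * (real s + real t) / (6 * real s * real t) = b * (real m + real n)"
    unfolding b_def using N_pos by simp
  have "Delta m s n t / (b * (real m + real n)) - 1 = (D - b) / b"
  proof -
    have "a / (c * M) - 1 = (a / M - c) / c" if "0 < c" "0 < M" for a c M :: real
      using that by (simp add: field_simps)
    from this[OF b mn] show ?thesis unfolding D_def .
  qed
  then have "\<bar>Delta m s n t / (b * (real m + real n)) - 1\<bar> = \<bar>D - b\<bar> / b"
    using b by (simp only: abs_divide abs_of_pos)
  also have "\<dots> \<le> 700000 * (x ^ 3 / (real N)\<^sup>2) / b"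
    unfolding D_def b_def using Delta_expansion N_pos by (intro divide_right_mono) auto
  also have "\<dots> = 840000 * (x ^ 3 / real N)"
    unfolding b_def using N_pos by (simp add: power2_eq_square)
  finally show ?thesis unfolding denominator .
qed

end

section \<open>The asymptotic statement\<close>

text \<open>With \<open>P = m n\<close> and \<open>x = s t\<close>, a bound on \<open>x / P\<^bsup>1/5\<^esup>\<close> is a bound on \<open>x\<^sup>6 / N\<^sup>2\<close>, because
\<open>P x = N\<^sup>2\<close>.\<close>

lemma cube_le_of_fifth_root_bound:
  fixes x N P \<eta> :: real
  assumes "0 < x" "0 \<le> N" "0 < \<eta>" "P * x = N\<^sup>2" "x \<le> (\<eta>\<^sup>2) powr (1 / 5) * P powr (1 / 5)"
  shows "x ^ 3 \<le> \<eta> * N"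
proof -
  have P: "0 \<le> P" using assms(1,4) by (metis mult_less_0_iff not_less zero_le_power2)
  have p5: "(a powr (1 / 5)) ^ 5 = a" if "0 \<le> a" for a :: real
  proof (cases "a = 0")
    case False
    then have "(a powr (1 / 5)) ^ 5 = (a powr (1 / 5)) powr real 5" by (subst powr_realpow) auto
    then show ?thesis using that by (simp add: powr_powr)
  qed simp
  have "x ^ 5 \<le> ((\<eta>\<^sup>2) powr (1 / 5) * P powr (1 / 5)) ^ 5" using assms by (intro power_mono) auto
  also have "\<dots> = \<eta>\<^sup>2 * P" using P by (simp add: power_mult_distrib p5)
  finally have "x ^ 5 * x \<le> \<eta>\<^sup>2 * P * x" using assms(1) by (intro mult_right_mono) auto
  also have "\<dots> = (\<eta> * N)\<^sup>2" using assms(4) by (simp add: power_mult_distrib)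
  also have "x ^ 5 * x = x ^ Suc 5" by (rule power_Suc2[symmetric])
  also have "x ^ Suc 5 = x ^ (3 * 2)" by (rule arg_cong) simp
  also have "\<dots> = (x ^ 3)\<^sup>2" by (rule power_mult)
  finally have "(x ^ 3)\<^sup>2 \<le> (\<eta> * N)\<^sup>2" .
  moreover have "0 \<le> \<eta> * N" using assms(2,3) by simp
  ultimately show ?thesis by (rule power2_le_imp_le)
qed

theorem corollary4p2:
  fixes s t :: "nat \<Rightarrow> nat \<Rightarrow> nat" and D :: "(nat \<times> nat) set"
  assumes "\<And>m n. (m, n) \<in> D \<Longrightarrow> s m n > 0"
    and "\<And>m n. (m, n) \<in> D \<Longrightarrow> t m n > 0"
    and "\<And>m n. (m, n) \<in> D \<Longrightarrow> m * s m n = n * t m n"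
    and "(\<lambda>(m, n). real (s m n * t m n)) \<in> o[pairs_at_top D](\<lambda>(m, n). (real m * real n) powr (1 / 5))"
  shows "\<exists>\<epsilon> \<in> o[pairs_at_top D](\<lambda>_. 1 :: real). \<forall>(m, n) \<in> D.
           Delta m (s m n) n (t m n)
             = 5 * (real (s m n) + real (t m n)) / (6 * real (s m n) * real (t m n)) * (1 + \<epsilon> (m, n))"
proof
  define c where "c m n = 5 * (real (s m n) + real (t m n)) / (6 * real (s m n) * real (t m n))" for m n
  define \<epsilon> where "\<epsilon> = (\<lambda>(m, n). Delta m (s m n) n (t m n) / c m n - 1)"
  show "\<forall>(m, n) \<in> D. Delta m (s m n) n (t m n)
      = 5 * (real (s m n) + real (t m n)) / (6 * real (s m n) * real (t m n)) * (1 + \<epsilon> (m, n))"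
  proof (clarify)
    fix m n assume "(m, n) \<in> D"
    then have "c m n \<noteq> 0" using assms(1,2)[of m n] by (simp add: c_def)
    then show "Delta m (s m n) n (t m n)
      = 5 * (real (s m n) + real (t m n)) / (6 * real (s m n) * real (t m n)) * (1 + \<epsilon> (m, n))"
      unfolding c_def[symmetric] \<epsilon>_def by simp
  qed
  show "\<epsilon> \<in> o[pairs_at_top D](\<lambda>_. 1)"
  proof (rule landau_o.smallI)
    fix d :: real assume d: "d > 0"
    \<comment> \<open>The first bound gives the sparseness condition, the second the relative error.\<close>
    define \<eta> where "\<eta> = min (1 / 30000) (d / 840000)"
    have \<eta>: "0 < \<eta>" "\<eta> \<le> 1 / 30000" "840000 * \<eta> \<le> d" using d by (auto simp: \<eta>_def min_def)
    have "\<forall>\<^sub>F p in pairs_at_top D. p \<in> D"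
      unfolding pairs_at_top_def by (simp add: eventually_inf_principal)
    moreover have "\<forall>\<^sub>F p in pairs_at_top D.
        norm (case p of (m, n) \<Rightarrow> real (s m n * t m n))
          \<le> (\<eta>\<^sup>2) powr (1 / 5) * norm (case p of (m, n) \<Rightarrow> (real m * real n) powr (1 / 5))"
      using landau_o.smallD[OF assms(4), of "(\<eta>\<^sup>2) powr (1 / 5)"] \<eta> by simp
    ultimately show "\<forall>\<^sub>F p in pairs_at_top D. norm (\<epsilon> p) \<le> d * norm (1 :: real)"
    proof eventually_elim
      case (elim p)
      obtain m n where p: "p = (m, n)" by (cases p)
      let ?s = "s m n" and ?t = "t m n"
      have st: "?s > 0" "?t > 0" and eq: "m * ?s = n * ?t" using elim(1) assms(1-3) p by auto
      have x: "0 < real ?s * real ?t" using st by simp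
      have bound: "real ?s * real ?t \<le> (\<eta>\<^sup>2) powr (1 / 5) * (real m * real n) powr (1 / 5)"
        using elim(2) unfolding p by simp
      have "real m * real n * (real ?s * real ?t) = real (m * ?s) * real (n * ?t)" by simp
      also have "\<dots> = (real (m * ?s))\<^sup>2" unfolding eq[symmetric] by (simp only: power2_eq_square)
      finally have "real m * real n * (real ?s * real ?t) = (real (m * ?s))\<^sup>2" .
      then have cube: "(real ?s * real ?t) ^ 3 \<le> \<eta> * real (m * ?s)"
        using cube_le_of_fifth_root_bound[OF x _ \<eta>(1) _ bound] by simp
      have "1 \<le> ?s * ?t" using st by simp
      then have "1 \<le> real (?s * ?t)" by linarith
      then have x1: "1 \<le> real ?s * real ?t" by simp
      \<comment> \<open>This excludes the pair \<open>(0, 0)\<close>, which may belong to \<open>D\<close>.\<close>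
      have N: "0 < real (m * ?s)"
        using less_le_trans[OF zero_less_power[OF x, of 3] cube] \<eta>(1) zero_less_mult_pos by blast
      have "real ?s * real ?t \<le> (real ?s * real ?t) ^ 3"
        using x1 power_increasing[of 1 3 "real ?s * real ?t"] by simp
      also note cube
      also have "\<eta> * real (m * ?s) \<le> 1 / 30000 * real (m * ?s)" using \<eta>(2) by (intro mult_right_mono) auto
      finally have "real (30000 * (?s * ?t)) \<le> real (m * ?s)" by simp
      then have "30000 * (?s * ?t) \<le> m * ?s" by (simp only: of_nat_le_iff)
      then interpret sparse_margins m ?s n ?t
        using st eq by unfold_locales
      have "\<bar>\<epsilon> p\<bar> \<le> 840000 * ((real ?s * real ?t) ^ 3 / real (m * ?s))"
        using Delta_relative_error unfolding p \<epsilon>_def c_def x_def N_def by simp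
      also have "\<dots> \<le> 840000 * \<eta>" using cube N by (intro mult_left_mono) (simp_all add: divide_le_eq)
      finally show ?case using \<eta>(3) by simp
    qed
  qed
qed

end
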